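(* For $n\ge 1$ let $r_n$ be the number of unlabelled rigid interval orders on $n$ points. Then there are real constants $D_0, D_1, D_2, \dots$ such that, as $n\to\infty$, \[ r_n \sim n! \sqrt{n} \left( \frac{6}{\pi^2} \right)^n \left( D_0 + \frac{D_1}{n} + \frac{D_2}{n^2} + \cdots \right) \] in the sense of an asymptotic expansion, that is, for every integer $m\ge 0$, \[ r_n = n! \sqrt{n} \left(\frac{6}{\pi^2}\right)^n \left( \sum_{i=0}^{m} \frac{D_i}{n^i} + O\!\left(n^{-m-1}\right) \right) \quad (n\to\infty), \] where \[ D_0 = \frac{12\sqrt{3}}{\pi^{5/2}e^{\pi^2/12}}, \] and the further $D_i$ are explicitly computable.
   Context: An interval order is a (finite, strict) partially ordered set $P=(X,<)$ for which one can assign to each $x\in X$ a closed real interval $[a_x,b_x]$ (with $a_x\le b_x$) such that $x<y$ in $P$ if and only if $b_x<a_y$. A poset is rigid if its automorphism group is trivial. Unlabelled means that posets are counted up to isomorphism, so $r_n$ is the number of isomorphism classes of rigid interval orders with exactly $n$ elements. "Explicitly computable" means that there is an explicit effective procedure which, given $i$, determines the constant $D_i$. *)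

theory Defs
  imports "HOL-Library.Landau_Symbols" "HOL-Combinatorics.Permutations"
begin

definition strict_poset :: "'a set \<Rightarrow> 'a rel \<Rightarrow> bool" where
  "strict_poset X R \<longleftrightarrow> finite X \<and> R \<subseteq> X \<times> X \<and> irrefl R \<and> trans R"

definition interval_order :: "'a set \<Rightarrow> 'a rel \<Rightarrow> bool" where
  "interval_order X R \<longleftrightarrow> strict_poset X R \<and>
     (\<exists>a b :: 'a \<Rightarrow> real. (\<forall>x\<in>X. a x \<le> b x) \<and>
        (\<forall>x\<in>X. \<forall>y\<in>X. (x, y) \<in> R \<longleftrightarrow> b x < a y))"

definition poset_iso :: "'a set \<Rightarrow> 'a rel \<Rightarrow> 'b set \<Rightarrow> 'b rel \<Rightarrow> ('a \<Rightarrow> 'b) \<Rightarrow> bool" where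
  "poset_iso X R Y S f \<longleftrightarrow> bij_betw f X Y \<and>
     (\<forall>x\<in>X. \<forall>y\<in>X. (x, y) \<in> R \<longleftrightarrow> (f x, f y) \<in> S)"

(* Automorphisms are taken to fix every point outside X, so that each automorphism
   of the poset is represented by exactly one function. *)
definition automorphisms :: "'a set \<Rightarrow> 'a rel \<Rightarrow> ('a \<Rightarrow> 'a) set" where
  "automorphisms X R = {f. f permutes X \<and> poset_iso X R X R f}"

definition rigid :: "'a set \<Rightarrow> 'a rel \<Rightarrow> bool" where
  "rigid X R \<longleftrightarrow> automorphisms X R = {id}"

definition rigid_interval_orders :: "nat \<Rightarrow> nat rel set" where
  "rigid_interval_orders n = {R. interval_order {..<n} R \<and> rigid {..<n} R}"

definition isomorphism_rel :: "nat \<Rightarrow> (nat rel \<times> nat rel) set" where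
  "isomorphism_rel n =
     {(R, S). R \<in> rigid_interval_orders n \<and> S \<in> rigid_interval_orders n \<and>
              (\<exists>f. poset_iso {..<n} R {..<n} S f)}"

definition num_rigid_interval_orders :: "nat \<Rightarrow> nat" where
  "num_rigid_interval_orders n = card (rigid_interval_orders n // isomorphism_rel n)"

lemma poset_iso_id: "poset_iso X R X R id"
  by (simp add: poset_iso_def)

lemma poset_iso_inv:
  assumes "poset_iso X R Y S f"
  shows "poset_iso Y S X R (inv_into X f)"
proof -
  have f: "bij_betw f X Y" using assms by (simp add: poset_iso_def)
  have "(u, v) \<in> S \<longleftrightarrow> (inv_into X f u, inv_into X f v) \<in> R" if "u \<in> Y" "v \<in> Y" for u v
  proof -
    have "inv_into X f u \<in> X" "inv_into X f v \<in> X"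
      using bij_betw_inv_into[OF f] that by (auto dest: bij_betwE)
    thus ?thesis
      using assms that by (simp add: poset_iso_def bij_betw_inv_into_right[OF f])
  qed
  thus ?thesis using bij_betw_inv_into[OF f] by (simp add: poset_iso_def)
qed

lemma poset_iso_comp:
  assumes "poset_iso X R Y S f" "poset_iso Y S Z T g"
  shows "poset_iso X R Z T (g \<circ> f)"
  using assms unfolding poset_iso_def by (auto intro: bij_betw_trans dest: bij_betwE)

lemma equiv_isomorphism_rel: "equiv (rigid_interval_orders n) (isomorphism_rel n)"
proof (rule equivI)
  show "isomorphism_rel n \<subseteq> rigid_interval_orders n \<times> rigid_interval_orders n"
    by (auto simp: isomorphism_rel_def)
  show "refl_on (rigid_interval_orders n) (isomorphism_rel n)"
    by (auto simp: refl_on_def isomorphism_rel_def intro: poset_iso_id)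
  show "sym (isomorphism_rel n)"
    by (auto simp: sym_def isomorphism_rel_def intro: poset_iso_inv)
  show "trans (isomorphism_rel n)"
    by (auto simp: trans_def isomorphism_rel_def intro: poset_iso_comp)
qed

lemma rigid_iff:
  "rigid X R \<longleftrightarrow> (\<forall>f. poset_iso X R X R f \<longrightarrow> (\<forall>x\<in>X. f x = x))"
proof
  assume r: "rigid X R"
  show "\<forall>f. poset_iso X R X R f \<longrightarrow> (\<forall>x\<in>X. f x = x)"
  proof (intro allI impI)
    fix f assume f: "poset_iso X R X R f"
    define g where "g x = (if x \<in> X then f x else x)" for x
    have "bij_betw g X X"
      using f by (simp add: poset_iso_def g_def cong: bij_betw_cong)
    hence "g permutes X"
      by (rule bij_imp_permutes) (simp add: g_def)
    moreover have "poset_iso X R X R g"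
      using f \<open>bij_betw g X X\<close> by (auto simp: poset_iso_def g_def)
    ultimately have "g = id" using r by (auto simp: rigid_def automorphisms_def)
    thus "\<forall>x\<in>X. f x = x" by (metis g_def id_apply)
  qed
next
  assume "\<forall>f. poset_iso X R X R f \<longrightarrow> (\<forall>x\<in>X. f x = x)"
  moreover have "f = id" if "f permutes X" "\<forall>x\<in>X. f x = x" for f
    using that by (metis eq_id_iff permutes_not_in)
  ultimately show "rigid X R"
    by (auto simp: rigid_def automorphisms_def permutes_id poset_iso_id)
qed

lemma rigid_interval_order_representative:
  assumes "interval_order X R" "rigid X R" "card X = n"
  shows "\<exists>S\<in>rigid_interval_orders n. \<exists>f. poset_iso X R {..<n} S f"
proof -
  have po: "strict_poset X R" using assms(1) by (simp add: interval_order_def)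
  then obtain f where f: "bij_betw f X {..<n}"
    using assms(3) by (metis strict_poset_def ex_bij_betw_finite_nat lessThan_atLeast0)
  define h where "h = inv_into X f"
  define S where "S = {(u, v). u < n \<and> v < n \<and> (h u, h v) \<in> R}"
  have h: "h u \<in> X" if "u < n" for u
    using f that by (metis bij_betwE bij_betw_inv_into h_def lessThan_iff)
  have iso: "poset_iso X R {..<n} S f"
    using f by (auto simp: poset_iso_def S_def h_def bij_betw_inv_into_left dest: bij_betwE)
  have "strict_poset {..<n} S"
    using po unfolding strict_poset_def S_def irrefl_def trans_def by fast
  moreover obtain a b :: "_ \<Rightarrow> real" where "\<forall>x\<in>X. a x \<le> b x"
    "\<forall>x\<in>X. \<forall>y\<in>X. (x, y) \<in> R \<longleftrightarrow> b x < a y"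
    using assms(1) by (auto simp: interval_order_def)
  hence "(\<forall>x\<in>{..<n}. (a \<circ> h) x \<le> (b \<circ> h) x) \<and>
    (\<forall>x\<in>{..<n}. \<forall>y\<in>{..<n}. (x, y) \<in> S \<longleftrightarrow> (b \<circ> h) x < (a \<circ> h) y)"
    by (auto simp: S_def h)
  ultimately have "interval_order {..<n} S" unfolding interval_order_def by blast
  moreover have "rigid {..<n} S"
    unfolding rigid_iff
  proof (intro allI impI ballI)
    fix g u assume g: "poset_iso {..<n} S {..<n} S g" and u: "u \<in> {..<n}"
    have "poset_iso X R X R (h \<circ> (g \<circ> f))"
      unfolding h_def by (intro poset_iso_comp poset_iso_inv) (use iso g in auto)
    hence "h (g (f (h u))) = h u" using assms(2) u h by (auto simp: rigid_iff)
    moreover have "f (h v) = v" if "v \<in> {..<n}" for v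
      using f that by (simp add: h_def bij_betw_inv_into_right)
    moreover have "g u \<in> {..<n}" using g u by (auto simp: poset_iso_def dest: bij_betwE)
    ultimately show "g u = u" using u by metis
  qed
  ultimately show ?thesis using iso by (auto simp: rigid_interval_orders_def)
qed

(* Programs for the partial recursive functions. PrimRec recurses on the first
   argument, Minim searches for the least value of a new first argument. *)
datatype recf =
    Zero
  | Succ
  | Proj nat
  | Comp recf "recf list"
  | PrimRec recf recf
  | Minim recf

inductive computes :: "recf \<Rightarrow> nat list \<Rightarrow> nat \<Rightarrow> bool" where
  zero: "computes Zero xs 0"
| succ: "computes Succ [x] (Suc x)"
| proj: "i < length xs \<Longrightarrow> computes (Proj i) xs (xs ! i)"
| comp: "list_all2 (\<lambda>g y. computes g xs y) gs ys \<Longrightarrow> computes f ys z \<Longrightarrow>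
         computes (Comp f gs) xs z"
| prim0: "computes f xs y \<Longrightarrow> computes (PrimRec f g) (0 # xs) y"
| primS: "computes (PrimRec f g) (n # xs) y \<Longrightarrow> computes g (n # y # xs) z \<Longrightarrow>
          computes (PrimRec f g) (Suc n # xs) z"
| minim: "computes f (n # xs) 0 \<Longrightarrow> (\<forall>m<n. \<exists>y>0. computes f (m # xs) y) \<Longrightarrow>
          computes (Minim f) xs n"

inductive_cases computes_elims:
  "computes Zero xs y"
  "computes Succ xs y"
  "computes (Proj i) xs y"
  "computes (Comp f gs) xs y"
  "computes (PrimRec f g) (0 # xs) y"
  "computes (PrimRec f g) (Suc n # xs) y"
  "computes (Minim f) xs y"

lemma computes_deterministic: "computes p xs y \<Longrightarrow> computes p xs z \<Longrightarrow> y = z"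
proof (induction arbitrary: z rule: computes.induct)
  case (comp xs gs ys f w)
  from comp.prems obtain ys' where ys': "list_all2 (\<lambda>g y. computes g xs y) gs ys'"
    and z: "computes f ys' z" by (rule computes_elims(4))
  have "ys' = ys"
  proof (rule nth_equalityI)
    show "length ys' = length ys"
      using list_all2_lengthD[OF ys'] list_all2_lengthD[OF comp.IH(1)] by simp
    fix i assume i: "i < length ys'"
    hence "i < length gs" using list_all2_lengthD[OF ys'] by simp
    from list_all2_nthD[OF comp.IH(1) this] list_all2_nthD[OF ys' this]
    show "ys' ! i = ys ! i" by metis
  qed
  thus ?case using comp.IH(2) z by blast
next
  case (primS f g n xs y w)
  from primS.prems obtain y' where "computes (PrimRec f g) (n # xs) y'"
    "computes g (n # y' # xs) z" by (rule computes_elims(6))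
  thus ?case using primS.IH by metis
next
  case (minim f n xs)
  from minim.prems have z: "computes f (z # xs) 0"
    and less: "\<forall>m<z. \<exists>y>0. computes f (m # xs) y"
    by (auto elim: computes_elims(7))
  have "\<not> n < z"
  proof
    assume "n < z"
    then obtain y where "y > 0" "computes f (n # xs) y" using less by blast
    thus False using minim.IH(1) by force
  qed
  moreover have "\<not> z < n"
  proof
    assume "z < n"
    then obtain y where "y > 0" "\<And>v. computes f (z # xs) v \<Longrightarrow> y = v"
      using minim.IH(2) by blast
    thus False using z by force
  qed
  ultimately show ?case by simp
next
  case (prim0 f xs y g)
  thus ?case by (blast elim: computes_elims(5))
next
  case (zero xs)
  thus ?case by (blast elim: computes_elims(1))
next
  case (succ x)
  thus ?case by (blast elim: computes_elims(2))
next
  case (proj i xs)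
  thus ?case by (blast elim: computes_elims(3))
qed

definition computable2 :: "(nat \<Rightarrow> nat \<Rightarrow> nat) \<Rightarrow> bool" where
  "computable2 f \<longleftrightarrow> (\<exists>p. \<forall>i k. computes p [i, k] (f i k))"

(* Computable sequence of real numbers in the sense of Pour-El and Richards: one
   procedure that, given i and k, returns a rational number within 2^-k of D i. *)
definition computable_real_seq :: "(nat \<Rightarrow> real) \<Rightarrow> bool" where
  "computable_real_seq D \<longleftrightarrow>
     (\<exists>s p q. computable2 s \<and> computable2 p \<and> computable2 q \<and>
        (\<forall>i k. q i k \<noteq> 0 \<and>
           \<bar>(-1) ^ s i k * real (p i k) / real (q i k) - D i\<bar> \<le> 1 / 2 ^ k))"

end

(* A rigid interval order on n points is determined by the set of pairs (left level, right level)
   of its points: an upper triangular 0/1 matrix with n ones and no zero row or column. Inclusion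
   and exclusion over the rows gives the generating function
   sum_c prod_{i=1..c} (1 - (1+x)^(-i)), that is F(log(1+x)) for the Kontsevich-Zagier series
   F(t) = sum_c prod_{i=1..c} (1 - exp(-i t)).

   With q = exp(-t) and x = q^m, S_m = (1-x) sum_c x^c prod_{i=1..c} (1 - x q^i) satisfies
   S_m = 1 - q x^2 - q^2 x^3 S_(m+1) and S_0 = 0. Let L be the linear functional on polynomials
   in d with L(exp(s d)) = sinh s / cosh(3s/2). Then
   U_m = L(exp(t (m/2 + m d + 1/24 - d^2/6))) satisfies the same recursion, so S_m = U_m. All
   coefficients are polynomials in m, and comparing the terms linear in m gives
   F(t) = exp(t/24) sum_n a_n t^n with a_n = (-1/6)^n/n! L(d^(2n+1)). The poles of sinh s / cosh(3s/2) nearest to 0 are at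
   s = +-i pi/3, so a_n = C0 Gamma(n+3/2) (6/pi^2)^n up to an exponentially smaller relative error.

   Write x/log(1+x) = 1 + x kappa and rho = 1/tau = 6/pi^2. Expanding log(1+x)^n in powers of kappa
   turns sum_n Gamma(n+3/2) rho^n [x^N] (1+x)^(1/24) log(1+x)^n into
   sum_p Gamma(N-p+3/2) rho^(N-p) d_p up to negligible errors, where
   d_p = [x^p] (1+x)^(1/24) (1 + x kappa)^(3/2) exp(-tau kappa). Each
   Gamma(N-p+3/2)/(N! sqrt N) has an expansion in 1/N with rational coefficients by Watson's lemma.
   Hence D_i is a fixed constant times a polynomial in tau whose rational coefficients are
   primitive recursive functions of the indices. *)
theory Submission
  imports Defs "HOL-Complex_Analysis.Complex_Analysis" "HOL-Real_Asymp.Real_Asymp"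
begin

unbundle no vec_syntax

section \<open>Rigid interval orders as triangular 0/1 matrices\<close>

text \<open>For t > 0 the terms of the Kontsevich-Zagier series tend to a nonzero limit, so F exists
  only as a formal series and offers no function whose singularities could be studied; the link to
  the moments has to be a formal identity. The parameter m provides it: the recursion can be run
  upwards from S_0 = U_0 = 0, and the factor 1 - x in S_m makes F visible in the terms linear in m.

  L and the quadratic exponent fit together: d -> d - 3 carries the exponent of U_m to that of
  U_(m+1) up to a constant, while (1 + exp(-3s)) sinh s / cosh(3s/2) is half-integrally shifted to a
  difference of just two exponentials.

  The argument n + 3/2 comes from (2n+1)!/n!. Binomials with upper index -(n+3/2) raise the argument
  of Gamma(n+3/2), so log(1+x)^n can be expanded such that all terms of equal p share one Gamma
  value. Since kappa has constant term 1/2, exp(-tau kappa) contributes exp(-tau/2) = exp(-pi^2/12)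
  to D_0.\<close>

definition pred_set :: "'a set \<Rightarrow> 'a rel \<Rightarrow> 'a \<Rightarrow> 'a set" where
  "pred_set X R x = {y \<in> X. (y, x) \<in> R}"

text \<open>The predecessor sets of an interval order form a chain under inclusion; this is the rank
  of the predecessor set of \<open>x\<close> in it, used as the left end of a canonical interval for
  \<open>x\<close>.\<close>

definition left_level :: "'a set \<Rightarrow> 'a rel \<Rightarrow> 'a \<Rightarrow> nat" where
  "left_level X R x = card {d \<in> pred_set X R ` X. d \<subset> pred_set X R x}"

text \<open>Extending \<open>x\<close> up to the largest left end that it does not precede makes
  precedence a comparison of levels. In a strict order the maximum ranges over a nonempty set, as
  \<open>x\<close> does not precede itself.\<close>

definition right_level :: "'a set \<Rightarrow> 'a rel \<Rightarrow> 'a \<Rightarrow> nat" where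
  "right_level X R x = Max (left_level X R ` {y \<in> X. (x, y) \<notin> R})"

definition levels :: "'a set \<Rightarrow> 'a rel \<Rightarrow> 'a \<Rightarrow> nat \<times> nat" where
  "levels X R x = (left_level X R x, right_level X R x)"

definition interval_matrices :: "(nat \<times> nat) set set" where
  "interval_matrices = {M. finite M \<and> (\<forall>p\<in>M. fst p \<le> snd p) \<and>
     (\<exists>k. fst ` M = {..<k} \<and> snd ` M = {..<k})}"

definition matrix_order :: "(nat \<times> nat) set \<Rightarrow> (nat \<times> nat) rel" where
  "matrix_order M = {(p, q) \<in> M \<times> M. snd p < fst q}"

text \<open>The levels are built from the order alone, so isomorphisms preserve them. This makes the
  set of level pairs an isomorphism invariant, and it leaves no room for automorphisms of a matrix
  order.\<close>

lemma poset_iso_levels: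
  assumes f: "poset_iso X R Y S f" and x: "x \<in> X" and fin: "finite X"
  shows "levels Y S (f x) = levels X R x"
proof -
  have bij: "bij_betw f X Y" and iso: "\<And>x y. x \<in> X \<Longrightarrow> y \<in> X \<Longrightarrow> (x, y) \<in> R \<longleftrightarrow> (f x, f y) \<in> S"
    using f by (auto simp: poset_iso_def)
  have Y: "Y = f ` X" using bij by (simp add: bij_betw_def)
  have inj: "inj_on f X" using bij by (simp add: bij_betw_def)
  have pred: "pred_set Y S (f x) = f ` pred_set X R x" if "x \<in> X" for x
    using that iso by (auto simp: pred_set_def Y)
  have sub: "pred_set X R x \<subseteq> X" for x by (auto simp: pred_set_def)
  have ssub: "f ` A \<subset> f ` B \<longleftrightarrow> A \<subset> B" if "A \<subseteq> X" "B \<subseteq> X" for A B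
    using inj_on_image_eq_iff[OF inj that] inj_on_image_subset_iff[OF inj that]
    by (auto simp: psubset_eq)
  have left: "left_level Y S (f x) = left_level X R x" if "x \<in> X" for x
  proof -
    have "{d \<in> pred_set Y S ` Y. d \<subset> pred_set Y S (f x)} =
        image f ` {d \<in> pred_set X R ` X. d \<subset> pred_set X R x}"
      (is "?L = _ ` ?R")
    proof (intro equalityI subsetI)
      fix d assume "d \<in> ?L"
      then obtain z where z: "z \<in> X" "d = pred_set Y S (f z)" "d \<subset> pred_set Y S (f x)"
        unfolding Y by blast
      hence "d = f ` pred_set X R z" "f ` pred_set X R z \<subset> f ` pred_set X R x"
        using pred[OF z(1)] pred[OF that] by simp_all
      with z(1) show "d \<in> image f ` ?R" using ssub[OF sub sub] by auto
    next
      fix d assume "d \<in> image f ` ?R"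
      then obtain z where z: "z \<in> X" "d = f ` pred_set X R z" "pred_set X R z \<subset> pred_set X R x"
        by auto
      hence "d = pred_set Y S (f z)" "d \<subset> pred_set Y S (f x)"
        using pred[OF z(1)] pred[OF that] ssub[OF sub sub] by simp_all
      with z(1) show "d \<in> ?L" unfolding Y by blast
    qed
    moreover have "inj_on (image f) ?R"
      by (rule inj_on_subset[OF inj_on_image_Pow[OF inj]]) (use sub in auto)
    ultimately show ?thesis unfolding left_level_def by (simp add: card_image)
  qed
  have "left_level Y S ` {y \<in> Y. (f x, y) \<notin> S} = left_level X R ` {y \<in> X. (x, y) \<notin> R}"
    using iso[OF x] left by (force simp: Y image_iff)
  thus ?thesis using left[OF x] by (simp add: levels_def right_level_def)
qed

text \<open>The given intervals only serve to write predecessor sets as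
  \<open>{y \<in> X. b y < a x}\<close> and so to see that they form a chain. The levels then yield
  a representation that depends on the order alone.\<close>

lemma interval_order_levels:
  assumes "interval_order X R"
  defines "k \<equiv> card (pred_set X R ` X)"
  shows left_level_image: "left_level X R ` X = {..<k}"
    and right_level_image: "right_level X R ` X = {..<k}"
    and left_le_right_level: "\<And>x. x \<in> X \<Longrightarrow> left_level X R x \<le> right_level X R x"
    and interval_order_iff_levels:
      "\<And>x y. x \<in> X \<Longrightarrow> y \<in> X \<Longrightarrow> (x, y) \<in> R \<longleftrightarrow> right_level X R x < left_level X R y"
proof -
  have po: "strict_poset X R" using assms(1) by (simp add: interval_order_def)
  hence fin: "finite X" and irr: "\<And>x. (x, x) \<notin> R" by (auto simp: strict_poset_def irrefl_def)
  obtain a b :: "'a \<Rightarrow> real" where ab: "\<forall>x\<in>X. a x \<le> b x"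
    "\<forall>x\<in>X. \<forall>y\<in>X. (x, y) \<in> R \<longleftrightarrow> b x < a y"
    using assms(1) unfolding interval_order_def by blast
  let ?D = "pred_set X R"
  have D: "?D x = {y \<in> X. b y < a x}" if "x \<in> X" for x
    using that ab by (auto simp: pred_set_def)
  have chain: "?D x \<subseteq> ?D y \<or> ?D y \<subset> ?D x" if "x \<in> X" "y \<in> X" for x y
    using that D by (cases "a x \<le> a y") auto
  have less: "left_level X R x < left_level X R y" if "x \<in> X" "?D x \<subset> ?D y" for x y
    unfolding left_level_def
  proof (rule psubset_card_mono)
    show "finite {d \<in> ?D ` X. d \<subset> ?D y}" using fin by simp
    show "{d \<in> ?D ` X. d \<subset> ?D x} \<subset> {d \<in> ?D ` X. d \<subset> ?D y}"
      using that by blast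
  qed
  have less_iff: "left_level X R x < left_level X R y \<longleftrightarrow> ?D x \<subset> ?D y"
    if "x \<in> X" "y \<in> X" for x y
  proof
    assume l: "left_level X R x < left_level X R y"
    show "?D x \<subset> ?D y"
    proof (rule ccontr)
      assume "\<not> ?D x \<subset> ?D y"
      hence "?D y \<subset> ?D x \<or> ?D x = ?D y" using chain[OF that] by auto
      thus False using less[OF that(2), of x] l by (auto simp: left_level_def)
    qed
  qed (rule less[OF that(1)])
  have lt_k: "left_level X R x < k" if "x \<in> X" for x
    unfolding left_level_def k_def
    by (rule psubset_card_mono) (use fin that in auto)
  show left: "left_level X R ` X = {..<k}"
  proof (rule card_subset_eq)
    show "left_level X R ` X \<subseteq> {..<k}" using lt_k by auto
    define g where "g d = card {d' \<in> ?D ` X. d' \<subset> d}" for d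
    have "left_level X R ` X = g ` ?D ` X" by (auto simp: g_def left_level_def)
    moreover have "inj_on g (?D ` X)"
    proof (rule inj_onI)
      fix d d' assume "d \<in> ?D ` X" "d' \<in> ?D ` X" "g d = g d'"
      then obtain x y where xy: "x \<in> X" "y \<in> X" "d = ?D x" "d' = ?D y" by auto
      hence "left_level X R x = left_level X R y" using \<open>g d = g d'\<close> by (simp add: g_def left_level_def)
      hence "\<not> ?D x \<subset> ?D y" "\<not> ?D y \<subset> ?D x" using less_iff xy by (metis less_irrefl)+
      thus "d = d'" using chain xy by blast
    qed
    ultimately show "card (left_level X R ` X) = card {..<k}" by (simp add: card_image k_def)
  qed auto
  have ge: "left_level X R y \<le> right_level X R x" if "y \<in> X" "(x, y) \<notin> R" for x y
    unfolding right_level_def using that fin by (intro Max_ge) auto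
  show ll: "left_level X R x \<le> right_level X R x" if "x \<in> X" for x
    using ge[OF that irr] .
  have attained: "\<exists>y\<in>X. (x, y) \<notin> R \<and> right_level X R x = left_level X R y" if "x \<in> X" for x
  proof -
    have "right_level X R x \<in> left_level X R ` {y \<in> X. (x, y) \<notin> R}"
      unfolding right_level_def using that fin irr by (intro Max_in) auto
    thus ?thesis by auto
  qed
  show iff: "(x, y) \<in> R \<longleftrightarrow> right_level X R x < left_level X R y" if xy: "x \<in> X" "y \<in> X" for x y
  proof
    assume r: "(x, y) \<in> R"
    obtain z where z: "z \<in> X" "(x, z) \<notin> R" "right_level X R x = left_level X R z"
      using attained[OF xy(1)] by blast
    have "x \<in> ?D y" "x \<notin> ?D z" using r z xy by (auto simp: pred_set_def)
    hence "?D z \<subset> ?D y" using chain[OF xy(2) z(1)] chain[OF z(1) xy(2)] by blast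
    thus "right_level X R x < left_level X R y" using less z by simp
  next
    assume "right_level X R x < left_level X R y"
    thus "(x, y) \<in> R" using ge[OF xy(2), of x] by force
  qed
  show "right_level X R ` X = {..<k}"
  proof (intro equalityI subsetI)
    fix j assume "j \<in> right_level X R ` X"
    thus "j \<in> {..<k}" using attained lt_k by force
  next
    fix j assume "j \<in> {..<k}"
    then obtain y where y: "y \<in> X" "left_level X R y = j" using left by (metis image_iff)
    show "j \<in> right_level X R ` X"
    proof (cases "Suc j < k")
      case True
      then obtain y' where y': "y' \<in> X" "left_level X R y' = Suc j" using left
        by (metis image_iff lessThan_iff)
      have "?D y \<subset> ?D y'" using less_iff[OF y(1) y'(1)] y y' by simp
      \<comment> \<open>A point in the gap between two consecutive predecessor sets ends exactly at
        the lower of the two levels.\<close>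
      then obtain x where x: "x \<in> X" "(x, y') \<in> R" "(x, y) \<notin> R" by (auto simp: pred_set_def)
      have "right_level X R x < Suc j" using iff x y' by metis
      moreover have "j \<le> right_level X R x" using ge[OF y(1) x(3)] y by simp
      ultimately have "right_level X R x = j" by simp
      thus ?thesis using x by blast
    next
      case False
      have "right_level X R y < k" using attained[OF y(1)] lt_k by force
      hence "right_level X R y = j" using ll[OF y(1)] y False by simp
      thus ?thesis using y by blast
    qed
  qed
qed

text \<open>Rigidity enters through injectivity: two points with equal levels could be exchanged by
  an automorphism, because the order is determined by the levels.\<close>

lemma levels_poset_iso:
  assumes "interval_order X R" "rigid X R"
  shows "poset_iso X R (levels X R ` X) (matrix_order (levels X R ` X)) (levels X R)"
    and "levels X R ` X \<in> interval_matrices" and "card (levels X R ` X) = card X"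
proof -
  note iff = interval_order_iff_levels[OF assms(1)]
  have inj: "inj_on (levels X R) X"
  proof (rule inj_onI)
    fix x y assume xy: "x \<in> X" "y \<in> X" "levels X R x = levels X R y"
    define f where "f = Transposition.transpose x y"
    have lev: "levels X R (f z) = levels X R z" for z
      using xy by (auto simp: f_def Transposition.transpose_def)
    have "f permutes X" unfolding f_def by (rule permutes_swap_id) (use xy in auto)
    hence bij: "bij_betw f X X" by (rule permutes_imp_bij)
    have "(u, v) \<in> R \<longleftrightarrow> (f u, f v) \<in> R" if "u \<in> X" "v \<in> X" for u v
    proof -
      have "f u \<in> X" "f v \<in> X" using bij that by (auto dest: bij_betwE)
      thus ?thesis using iff that lev[of u] lev[of v] by (simp add: levels_def)
    qed
    hence "poset_iso X R X R f" using bij by (auto simp: poset_iso_def)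
    hence "f x = x" using assms(2) xy by (auto simp: rigid_iff)
    thus "x = y" by (simp add: f_def)
  qed
  show "card (levels X R ` X) = card X" by (rule card_image[OF inj])
  show "poset_iso X R (levels X R ` X) (matrix_order (levels X R ` X)) (levels X R)"
    unfolding poset_iso_def matrix_order_def
    using inj iff by (auto simp: bij_betw_def levels_def)
  have "fst ` levels X R ` X = left_level X R ` X" "snd ` levels X R ` X = right_level X R ` X"
    by (auto simp: levels_def image_image)
  moreover have "finite X" using assms(1) by (simp add: interval_order_def strict_poset_def)
  ultimately show "levels X R ` X \<in> interval_matrices"
    using left_level_image[OF assms(1)] right_level_image[OF assms(1)] left_le_right_level[OF assms(1)]
    unfolding interval_matrices_def by (auto simp: levels_def)
qed

text \<open>Nonzero columns make the sets \<open>E i\<close> strictly increasing, so the rank of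
  \<open>E (fst p)\<close> is \<open>fst p\<close>; nonzero rows make each of these sets occur and
  let the maximum reach \<open>snd p\<close>. Distinct matrices thus carry non-isomorphic
  orders.\<close>

lemma levels_matrix_order:
  assumes "M \<in> interval_matrices" "p \<in> M"
  shows "levels M (matrix_order M) p = p"
proof -
  obtain k where k: "fst ` M = {..<k}" "snd ` M = {..<k}" and fin: "finite M"
    and le: "\<And>p. p \<in> M \<Longrightarrow> fst p \<le> snd p"
    using assms(1) by (auto simp: interval_matrices_def)
  define E where "E i = {q \<in> M. snd q < i}" for i
  have D: "pred_set M (matrix_order M) p = E (fst p)" if "p \<in> M" for p
    using that by (auto simp: pred_set_def matrix_order_def E_def)
  have psub: "E i \<subset> E j" if ij: "i < j" "j < k" for i j
  proof -
    obtain q where "q \<in> M" "snd q = i" using k ij by (metis image_iff lessThan_iff order.strict_trans)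
    hence "q \<in> E j - E i" using ij by (auto simp: E_def)
    moreover have "E i \<subseteq> E j" using ij by (auto simp: E_def)
    ultimately show ?thesis by blast
  qed
  have left: "left_level M (matrix_order M) p = fst p" if "p \<in> M" for p
  proof -
    have pk: "fst p < k" using k that by auto
    have "pred_set M (matrix_order M) ` M = E ` {..<k}"
      unfolding k(1)[symmetric] image_image using D by (intro image_cong) auto
    hence "{d \<in> pred_set M (matrix_order M) ` M. d \<subset> pred_set M (matrix_order M) p} =
        {d \<in> E ` {..<k}. d \<subset> E (fst p)}" by (simp add: D that)
    also have "\<dots> = E ` {..<fst p}"
    proof (intro equalityI subsetI)
      fix d assume "d \<in> {d \<in> E ` {..<k}. d \<subset> E (fst p)}"
      then obtain i where i: "i < k" "d = E i" "E i \<subset> E (fst p)" by auto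
      hence "i < fst p" using psub[of "fst p" i] by (cases "i" "fst p" rule: linorder_cases) auto
      thus "d \<in> E ` {..<fst p}" using i by auto
    qed (use psub pk in auto)
    also have "card \<dots> = fst p"
    proof -
      have "inj_on E {..<fst p}"
        by (rule linorder_inj_onI) (use psub pk in force)+
      thus ?thesis by (simp add: card_image)
    qed
    finally show ?thesis by (simp add: left_level_def)
  qed
  have "left_level M (matrix_order M) ` {q \<in> M. (p, q) \<notin> matrix_order M} =
      fst ` {q \<in> M. fst q \<le> snd p}"
    using assms(2) left by (intro image_cong) (auto simp: matrix_order_def)
  moreover have "Max (fst ` {q \<in> M. fst q \<le> snd p}) = snd p"
  proof (rule Max_eqI)
    have "snd p \<in> fst ` M" using k assms(2) by auto
    thus "snd p \<in> fst ` {q \<in> M. fst q \<le> snd p}" by auto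
  qed (use fin in auto)
  ultimately show ?thesis using left[OF assms(2)] by (simp add: levels_def right_level_def)
qed

text \<open>Row and column index serve as the two ends of an interval. Rigidity follows because the
  levels of a point of \<open>M\<close> are the point itself and automorphisms preserve
  levels.\<close>

lemma matrix_order_rigid_interval_order:
  assumes "M \<in> interval_matrices"
  shows "interval_order M (matrix_order M)" "rigid M (matrix_order M)"
proof -
  have fin: "finite M" and le: "\<And>p. p \<in> M \<Longrightarrow> fst p \<le> snd p"
    using assms by (auto simp: interval_matrices_def)
  have "strict_poset M (matrix_order M)"
    unfolding strict_poset_def
  proof (intro conjI)
    show "irrefl (matrix_order M)" using le by (force simp: irrefl_def matrix_order_def)
    show "trans (matrix_order M)"
    proof (rule transI)
      fix x y z assume "(x, y) \<in> matrix_order M" "(y, z) \<in> matrix_order M"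
      thus "(x, z) \<in> matrix_order M" using le[of y] by (auto simp: matrix_order_def)
    qed
  qed (use fin in \<open>auto simp: matrix_order_def\<close>)
  thus "interval_order M (matrix_order M)"
    unfolding interval_order_def using le
    by (intro conjI exI[of _ "\<lambda>p. real (fst p)"] exI[of _ "\<lambda>p. real (snd p)"])
       (auto simp: matrix_order_def)
  show "rigid M (matrix_order M)"
    unfolding rigid_iff
  proof (intro allI impI ballI)
    fix f p assume f: "poset_iso M (matrix_order M) M (matrix_order M) f" and p: "p \<in> M"
    have "f p \<in> M" using f p by (auto simp: poset_iso_def dest: bij_betwE)
    thus "f p = p" using poset_iso_levels[OF f p fin] levels_matrix_order[OF assms] p by simp
  qed
qed

lemma num_rigid_interval_orders_eq_card:
  "num_rigid_interval_orders n = card {M \<in> interval_matrices. card M = n}"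
proof -
  let ?A = "rigid_interval_orders n"
  define sig where "sig R = levels {..<n} R ` {..<n}" for R
  have A: "interval_order {..<n} R" "rigid {..<n} R" if "R \<in> ?A" for R
    using that by (auto simp: rigid_interval_orders_def)
  \<comment> \<open>The carrier type is left open: the fact is applied to orders on numbers and to
    matrix orders on pairs.\<close>
  have iso_sig: "sig S = levels X R ` X" if "poset_iso X R {..<n} S f" "finite X"
    for X :: "'b set" and R S f
  proof -
    have "f ` X = {..<n}" using that(1) by (simp add: poset_iso_def bij_betw_def)
    thus ?thesis using poset_iso_levels[OF that(1) _ that(2)]
      by (simp add: sig_def) (metis (no_types, lifting) image_cong image_image)
  qed
  have rel: "(R, S) \<in> isomorphism_rel n \<longleftrightarrow> R \<in> ?A \<and> S \<in> ?A \<and> sig R = sig S" for R S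
  proof
    assume "(R, S) \<in> isomorphism_rel n"
    then obtain f where f: "R \<in> ?A" "S \<in> ?A" "poset_iso {..<n} R {..<n} S f"
      by (auto simp: isomorphism_rel_def)
    thus "R \<in> ?A \<and> S \<in> ?A \<and> sig R = sig S" using iso_sig[OF f(3)] by (simp add: sig_def)
  next
    assume *: "R \<in> ?A \<and> S \<in> ?A \<and> sig R = sig S"
    have "poset_iso {..<n} R (sig R) (matrix_order (sig R)) (levels {..<n} R)"
      "poset_iso {..<n} S (sig S) (matrix_order (sig S)) (levels {..<n} S)"
      unfolding sig_def using * A levels_poset_iso(1) by blast+
    hence "\<exists>f. poset_iso {..<n} R {..<n} S f"
      using poset_iso_comp poset_iso_inv * by metis
    thus "(R, S) \<in> isomorphism_rel n" using * by (simp add: isomorphism_rel_def)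
  qed
  have sig: "sig ` ?A = {M \<in> interval_matrices. card M = n}"
  proof (intro equalityI subsetI)
    fix M assume "M \<in> sig ` ?A"
    thus "M \<in> {M \<in> interval_matrices. card M = n}"
      using A levels_poset_iso(2,3) by (fastforce simp: sig_def)
  next
    fix M assume M: "M \<in> {M \<in> interval_matrices. card M = n}"
    then obtain S f where S: "S \<in> ?A" "poset_iso M (matrix_order M) {..<n} S f"
      using rigid_interval_order_representative matrix_order_rigid_interval_order
      by (metis (mono_tags, lifting) mem_Collect_eq)
    have "sig S = levels M (matrix_order M) ` M"
      by (rule iso_sig[OF S(2)]) (use M in \<open>auto simp: interval_matrices_def\<close>)
    also have "\<dots> = M" using M levels_matrix_order by auto
    finally show "M \<in> sig ` ?A" using S by blast
  qed
  \<comment> \<open>Isomorphism classes are the nonempty fibres of \<open>sig\<close>, so its image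
    counts them.\<close>
  define h where "h m = {S \<in> ?A. sig S = m}" for m
  have "?A // isomorphism_rel n = (\<lambda>R. isomorphism_rel n `` {R}) ` ?A"
    by (auto simp: quotient_def)
  also have "\<dots> = (\<lambda>R. h (sig R)) ` ?A"
  proof (rule image_cong[OF refl])
    fix R assume "R \<in> ?A"
    thus "isomorphism_rel n `` {R} = h (sig R)"
      unfolding Image_singleton rel h_def by auto
  qed
  finally have "?A // isomorphism_rel n = h ` sig ` ?A" by (simp add: image_image)
  moreover have "inj_on h (sig ` ?A)" by (rule inj_onI) (auto simp: h_def)
  ultimately show ?thesis
    unfolding num_rigid_interval_orders_def sig[symmetric] by (simp add: card_image)
qed

section \<open>Counting by inclusion and exclusion over the rows\<close>

definition fps_inf_sum :: "(nat \<Rightarrow> 'a::comm_ring_1 fps) \<Rightarrow> 'a fps" where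
  "fps_inf_sum g = Abs_fps (\<lambda>n. \<Sum>k\<le>n. g k $ n)"

text \<open>Because the \<open>k\<close>-th term starts in degree \<open>k\<close> or later, the
  diagonal truncation in \<open>fps_inf_sum\<close> is the true sum: degree \<open>n\<close> sees
  finitely many terms, and a later cut-off gives the same value.\<close>

lemma fps_inf_sum_nth:
  assumes "\<And>k n. n < k \<Longrightarrow> g k $ n = 0" "n \<le> N"
  shows "fps_inf_sum g $ n = (\<Sum>k\<le>N. g k $ n)"
  unfolding fps_inf_sum_def fps_nth_Abs_fps
  by (rule sum.mono_neutral_left) (use assms in \<open>auto simp: not_le\<close>)

lemma fps_inf_sum_diff: "fps_inf_sum (\<lambda>k. f k - g k) = fps_inf_sum f - fps_inf_sum g"
  by (rule fps_ext) (simp add: fps_inf_sum_def sum_subtractf)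

lemma fps_inf_sum_mult:
  assumes "\<And>k n. n < k \<Longrightarrow> g k $ n = 0"
  shows "fps_inf_sum (\<lambda>k. A * g k) = A * fps_inf_sum g"
proof (rule fps_ext)
  fix n
  have "(A * fps_inf_sum g) $ n = (\<Sum>i=0..n. A $ i * (\<Sum>k\<le>n. g k $ (n - i)))"
    unfolding fps_mult_nth
    by (intro sum.cong refl arg_cong2[where f = "(*)"] fps_inf_sum_nth assms) auto
  also have "\<dots> = (\<Sum>k\<le>n. \<Sum>i=0..n. A $ i * g k $ (n - i))"
    unfolding sum_distrib_left by (rule sum.swap)
  finally show "fps_inf_sum (\<lambda>k. A * g k) $ n = (A * fps_inf_sum g) $ n"
    by (simp add: fps_inf_sum_def fps_mult_nth)
qed

lemma fps_inf_sum_Suc: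
  assumes "\<And>k n. n < k \<Longrightarrow> g k $ n = 0"
  shows "fps_inf_sum g = g 0 + fps_inf_sum (\<lambda>k. g (Suc k))"
proof (rule fps_ext)
  fix n
  have "fps_inf_sum g $ n = (\<Sum>k\<le>Suc n. g k $ n)"
    by (rule fps_inf_sum_nth) (use assms in auto)
  also have "\<dots> = g 0 $ n + (\<Sum>k\<le>n. g (Suc k) $ n)"
    by (simp only: sum.atMost_Suc_shift)
  finally show "fps_inf_sum g $ n = (g 0 + fps_inf_sum (\<lambda>k. g (Suc k))) $ n"
    by (simp add: fps_inf_sum_def)
qed

lemma fps_inf_sum_compose:
  assumes "\<And>k n. n < k \<Longrightarrow> g k $ n = 0" "h $ 0 = 0"
  shows "fps_inf_sum g oo h = fps_inf_sum (\<lambda>k. g k oo h)"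
proof (rule fps_ext)
  fix n
  have "(fps_inf_sum g oo h) $ n = (\<Sum>i=0..n. (\<Sum>k\<le>n. g k $ i) * (h ^ i) $ n)"
    unfolding fps_compose_nth
    by (intro sum.cong refl arg_cong2[where f = "(*)"] fps_inf_sum_nth assms) auto
  also have "\<dots> = (\<Sum>k\<le>n. \<Sum>i=0..n. g k $ i * (h ^ i) $ n)"
    unfolding sum_distrib_right by (rule sum.swap)
  finally show "(fps_inf_sum g oo h) $ n = fps_inf_sum (\<lambda>k. g k oo h) $ n"
    by (simp add: fps_inf_sum_def fps_compose_nth)
qed

lemma fps_mult_nth_below:
  fixes A B :: "'a::comm_ring_1 fps"
  assumes "A $ 0 = 0" "\<And>n. n < k \<Longrightarrow> B $ n = 0" "n < Suc k"
  shows "(A * B) $ n = 0"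
  unfolding fps_mult_nth
proof (rule sum.neutral, intro ballI)
  fix i assume "i \<in> {0..n}"
  thus "A $ i * B $ (n - i) = 0"
    by (cases i) (use assms in auto)
qed

lemma fps_prod_nth_below:
  fixes A :: "nat \<Rightarrow> 'a::comm_ring_1 fps"
  assumes "\<And>i. i \<in> {1..k} \<Longrightarrow> A i $ 0 = 0" "n < k"
  shows "(\<Prod>i=1..k. A i) $ n = 0"
  using assms
proof (induction k arbitrary: n)
  case (Suc k)
  have "(A (Suc k) * (\<Prod>i=1..k. A i)) $ n = 0"
    by (rule fps_mult_nth_below[where k = k]) (use Suc in auto)
  thus ?case by (simp add: mult.commute)
qed simp

section \<open>Matrices with a prescribed set of admissible rows\<close>

definition column_sets :: "nat \<Rightarrow> nat set \<Rightarrow> (nat \<times> nat) set set" where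
  "column_sets k S = {M. M \<subseteq> {(i, j). i \<le> j \<and> i \<in> S} \<and> snd ` M = {..<k}}"

lemma column_sets_subset:
  assumes "M \<in> column_sets k S" shows "M \<subseteq> {..<k} \<times> {..<k}"
proof
  fix p assume p: "p \<in> M"
  hence "snd p \<in> {..<k}" "fst p \<le> snd p" using assms by (auto simp: column_sets_def)
  thus "p \<in> {..<k} \<times> {..<k}" by (cases p) auto
qed

lemma finite_column_sets: "finite (column_sets k S)"
  by (rule finite_subset[of _ "Pow ({..<k} \<times> {..<k})"]) (use column_sets_subset in blast, simp)

lemma finite_column_set: "M \<in> column_sets k S \<Longrightarrow> finite M"
  by (rule finite_subset[OF column_sets_subset]) simp_all

lemma sum_power_card_Pow:
  fixes x :: "'a::comm_ring_1"
  assumes "finite A" shows "(\<Sum>B\<in>Pow A. x ^ card B) = (1 + x) ^ card A"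
  using prod_add[OF assms, of "\<lambda>_. x" "\<lambda>_. 1"] by (simp add: add.commute)

text \<open>Once the set \<open>S\<close> of admissible rows is fixed the columns are independent:
  column \<open>j\<close> may carry any nonempty subset of \<open>S \<inter> {..j}\<close>, which
  contributes one factor. Hence only the rows require inclusion and exclusion.\<close>

lemma sum_column_sets:
  fixes x :: "'a::comm_ring_1"
  shows "(\<Sum>M\<in>column_sets k S. x ^ card M) = (\<Prod>j<k. (1 + x) ^ card (S \<inter> {..j}) - 1)"
proof (induction k)
  case 0
  have "column_sets 0 S = {{}}" by (auto simp: column_sets_def)
  thus ?case by simp
next
  case (Suc k)
  define P where "P = Pow (S \<inter> {..k}) - {{}}"
  define join where "join = (\<lambda>(M, A). M \<union> (\<lambda>i. (i, k)) ` A :: (nat \<times> nat) set)"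
  define split where "split M = ({p \<in> M. snd p < k}, {i. (i, k) \<in> M})" for M :: "(nat \<times> nat) set"
  have below: "snd p < k" if "M \<in> column_sets k S" "p \<in> M" for M p
    using that by (auto simp: column_sets_def)
  have "(\<Sum>M\<in>column_sets (Suc k) S. x ^ card M) =
      (\<Sum>(M, A)\<in>column_sets k S \<times> P. x ^ card M * x ^ card A)"
  proof (rule sum.reindex_bij_witness[where i = join and j = split])
    fix M assume M: "M \<in> column_sets (Suc k) S"
    have le: "snd p < Suc k" if "p \<in> M" for p using M that by (auto simp: column_sets_def)
    have *: "M = {p \<in> M. snd p < k} \<union> (\<lambda>i. (i, k)) ` {i. (i, k) \<in> M}" (is "M = ?M1 \<union> ?M2")
    proof (intro equalityI subsetI)
      fix p assume p: "p \<in> M"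
      show "p \<in> ?M1 \<union> ?M2"
      proof (cases "snd p < k")
        case False
        hence "p = (fst p, k)" using le[OF p] by (simp add: prod_eq_iff)
        thus ?thesis using p by (metis (mono_tags, lifting) UnI2 imageI mem_Collect_eq)
      qed (use p in simp)
    qed auto
    thus "join (split M) = M" by (simp add: join_def split_def)
    have "{..<k} \<subseteq> snd ` ?M1"
    proof
      fix j assume j: "j \<in> {..<k}"
      hence "j \<in> snd ` M" using M by (auto simp: column_sets_def)
      thus "j \<in> snd ` ?M1" using j by force
    qed
    moreover have "{i. (i, k) \<in> M} \<noteq> {}"
    proof -
      have "k \<in> snd ` M" using M by (auto simp: column_sets_def)
      thus ?thesis by force
    qed
    ultimately show "split M \<in> column_sets k S \<times> P"
      using M by (auto simp: split_def column_sets_def P_def)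
    have fin: "finite ?M1" "finite ?M2"
      by (rule finite_subset[OF _ finite_column_set[OF M]], auto)+
    have "card M = card (?M1 \<union> ?M2)" by (rule arg_cong[OF *])
    also have "\<dots> = card ?M1 + card ?M2" by (rule card_Un_disjoint[OF fin]) auto
    also have "card ?M2 = card {i. (i, k) \<in> M}" by (rule card_image) (auto intro: inj_onI)
    finally show "(case split M of (M, A) \<Rightarrow> x ^ card M * x ^ card A) = x ^ card M"
      by (simp add: split_def power_add)
  next
    fix MA assume "MA \<in> column_sets k S \<times> P"
    then obtain M A where MA: "MA = (M, A)" "M \<in> column_sets k S" "A \<in> P" by auto
    have [simp]: "(i, k) \<notin> M" for i using below[OF MA(2), of "(i, k)"] by auto
    have "{p \<in> M \<union> (\<lambda>i. (i, k)) ` A. snd p < k} = M" using below[OF MA(2)] by auto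
    moreover have "{i. (i, k) \<in> M \<union> (\<lambda>i. (i, k)) ` A} = A" by auto
    ultimately show "split (join MA) = MA" unfolding MA(1) split_def join_def by simp
    have "snd ` (\<lambda>i. (i, k)) ` A = {k}" using MA(3) by (auto simp: P_def image_image)
    thus "join MA \<in> column_sets (Suc k) S"
      using MA(2,3) by (auto simp: MA(1) join_def column_sets_def P_def image_Un lessThan_Suc)
  qed
  also have "\<dots> = (\<Sum>M\<in>column_sets k S. x ^ card M) * (\<Sum>A\<in>P. x ^ card A)"
    by (simp add: sum.cartesian_product[symmetric] sum_product)
  also have "(\<Sum>A\<in>P. x ^ card A) = (1 + x) ^ card (S \<inter> {..k}) - 1"
    unfolding P_def by (subst sum_diff1) (simp_all add: sum_power_card_Pow del: Pow_Int_eq)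
  finally show ?case by (simp add: Suc.IH)
qed

text \<open>The product of \<open>1 + f x\<close> over \<open>U\<close> is evaluated in two ways. On
  \<open>A\<close> the value \<open>f x = 0\<close> kills every subset whose complement meets
  \<open>A\<close>; off \<open>A\<close> the factor \<open>1 + f x\<close> is 0, so the product
  vanishes unless \<open>A\<close> is all of \<open>U\<close>.\<close>

lemma sum_supersets_sign:
  fixes A U :: "'b set"
  assumes "finite U" "A \<subseteq> U"
  shows "(\<Sum>S\<in>{S \<in> Pow U. A \<subseteq> S}. (-1) ^ card (U - S)) = (if A = U then 1 else 0 :: 'a::comm_ring_1)"
proof -
  define f where "f x = (if x \<in> A then 0 else -1 :: 'a)" for x
  have fin: "finite S" if "S \<subseteq> U" for S using assms(1) that by (rule rev_finite_subset)
  have "(\<Prod>x\<in>U. 1 + f x) = (\<Sum>S\<in>Pow U. \<Prod>x\<in>U - S. f x)"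
    using prod_add[OF assms(1), of "\<lambda>_. 1" f] by simp
  also have "\<dots> = (\<Sum>S\<in>Pow U. if A \<subseteq> S then (-1) ^ card (U - S) else 0)"
  proof (intro sum.cong refl)
    fix S assume S: "S \<in> Pow U"
    show "(\<Prod>x\<in>U - S. f x) = (if A \<subseteq> S then (-1) ^ card (U - S) else 0)"
    proof (cases "A \<subseteq> S")
      case True
      hence "(\<Prod>x\<in>U - S. f x) = (\<Prod>x\<in>U - S. -1)" by (intro prod.cong) (auto simp: f_def)
      thus ?thesis using True by simp
    next
      case False
      then obtain x where "x \<in> A" "x \<notin> S" by auto
      hence "\<exists>x\<in>U - S. f x = 0" using assms by (auto simp: f_def)
      thus ?thesis using False assms(1) by (simp add: prod_zero)
    qed
  qed
  also have "\<dots> = (\<Sum>S\<in>{S \<in> Pow U. A \<subseteq> S}. (-1) ^ card (U - S))"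
    by (rule sum.inter_filter[symmetric]) (use assms(1) in simp)
  also have "(\<Prod>x\<in>U. 1 + f x) = (if A = U then 1 else 0)"
  proof (cases "A = U")
    case True
    thus ?thesis by (simp add: f_def)
  next
    case False
    then obtain x where "x \<in> U" "x \<notin> A" using assms by auto
    hence "\<exists>x\<in>U. 1 + f x = 0" by (auto simp: f_def)
    thus ?thesis using False assms(1) by (simp add: prod_zero)
  qed
  finally show ?thesis ..
qed

text \<open>With the occupied rows of \<open>M\<close> in the role of \<open>A\<close>,
  \<open>sum_supersets_sign\<close> selects the matrices without zero row. Exchanging the sums then
  leaves the column count for each fixed \<open>S\<close>.\<close>

lemma sum_interval_matrices_of_size:
  fixes x :: "'a::comm_ring_1"
  shows "(\<Sum>M\<in>{M \<in> column_sets k {..<k}. fst ` M = {..<k}}. x ^ card M) =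
    (\<Sum>S\<in>Pow {..<k}. (-1) ^ (k - card S) * (\<Prod>j<k. (1 + x) ^ card (S \<inter> {..j}) - 1))"
proof -
  let ?U = "{..<k}"
  have "(\<Sum>M\<in>{M \<in> column_sets k ?U. fst ` M = ?U}. x ^ card M) =
      (\<Sum>M\<in>column_sets k ?U. (if fst ` M = ?U then 1 else 0) * x ^ card M)"
    by (simp add: sum.inter_filter[OF finite_column_sets, symmetric] if_distrib[of "\<lambda>c. c * _"] cong: if_cong)
  also have "\<dots> = (\<Sum>M\<in>column_sets k ?U. \<Sum>S\<in>Pow ?U.
      if fst ` M \<subseteq> S then (-1) ^ (k - card S) * x ^ card M else 0)"
  proof (intro sum.cong refl)
    fix M assume M: "M \<in> column_sets k ?U"
    hence sub: "fst ` M \<subseteq> ?U" by (force simp: column_sets_def)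
    have "(if fst ` M = ?U then 1 else 0) * x ^ card M =
        (\<Sum>S\<in>{S \<in> Pow ?U. fst ` M \<subseteq> S}. (-1) ^ card (?U - S)) * x ^ card M"
      using sum_supersets_sign[OF _ sub, where 'a = 'a] by simp
    also have "\<dots> = (\<Sum>S\<in>{S \<in> Pow ?U. fst ` M \<subseteq> S}. (-1) ^ (k - card S) * x ^ card M)"
      unfolding sum_distrib_right
      by (intro sum.cong refl) (auto simp: card_Diff_subset finite_subset)
    also have "\<dots> = (\<Sum>S\<in>Pow ?U. if fst ` M \<subseteq> S then (-1) ^ (k - card S) * x ^ card M else 0)"
      by (rule sum.inter_filter) simp
    finally show "(if fst ` M = ?U then 1 else 0) * x ^ card M =
        (\<Sum>S\<in>Pow ?U. if fst ` M \<subseteq> S then (-1) ^ (k - card S) * x ^ card M else 0)" .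
  qed
  also have "\<dots> = (\<Sum>S\<in>Pow ?U. \<Sum>M\<in>column_sets k ?U.
      if fst ` M \<subseteq> S then (-1) ^ (k - card S) * x ^ card M else 0)"
    by (rule sum.swap)
  also have "\<dots> = (\<Sum>S\<in>Pow ?U. (-1) ^ (k - card S) * (\<Sum>M\<in>column_sets k S. x ^ card M))"
  proof (intro sum.cong refl)
    fix S assume S: "S \<in> Pow ?U"
    have eq: "M \<subseteq> {(i, j). i \<le> j \<and> i \<in> S} \<longleftrightarrow>
        M \<subseteq> {(i, j). i \<le> j \<and> i \<in> ?U} \<and> fst ` M \<subseteq> S" for M
      using S by (auto simp: subset_iff)
    have "{M \<in> column_sets k ?U. fst ` M \<subseteq> S} = column_sets k S"
      unfolding column_sets_def eq by blast
    moreover have "(\<Sum>M\<in>column_sets k ?U. if fst ` M \<subseteq> S then (-1) ^ (k - card S) * x ^ card M else 0) =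
        (\<Sum>M\<in>{M \<in> column_sets k ?U. fst ` M \<subseteq> S}. (-1) ^ (k - card S) * x ^ card M)"
      by (rule sum.inter_filter[OF finite_column_sets, symmetric])
    ultimately show "(\<Sum>M\<in>column_sets k ?U. if fst ` M \<subseteq> S then (-1) ^ (k - card S) * x ^ card M else 0) =
        (-1) ^ (k - card S) * (\<Sum>M\<in>column_sets k S. x ^ card M)"
      by (simp only: sum_distrib_left)
  qed
  finally show ?thesis by (simp add: sum_column_sets)
qed

text \<open>\<open>sieve k c\<close> collects the terms of the inclusion-exclusion sum for size \<open>k\<close> in which \<open>c\<close> rows
  are allowed.\<close>
fun sieve :: "nat \<Rightarrow> nat \<Rightarrow> real fps" where
  "sieve 0 c = (if c = 0 then 1 else 0)"
| "sieve (Suc k) c = ((1 + fps_X) ^ c - 1) * ((if c = 0 then 0 else sieve k (c - 1)) - sieve k c)"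

lemma sieve_eq_0: "k < c \<Longrightarrow> sieve k c = 0"
  by (induction k arbitrary: c) auto

lemma one_plus_X_power_nth_0 [simp]: "((1 + fps_X :: 'a::comm_ring_1 fps) ^ c) $ 0 = 1"
  by (induction c) auto

lemma sieve_nth_below: "n < k \<Longrightarrow> sieve k c $ n = 0"
proof (induction k arbitrary: c n)
  case (Suc k)
  show ?case unfolding sieve.simps
    by (rule fps_mult_nth_below[where k = k]) (use Suc in auto)
qed simp

text \<open>Induction by whether row \<open>k\<close> is admissible: leaving it out costs a sign,
  admitting it raises the count by one, and in both cases the new column sees all admissible rows.
  The arbitrary weight \<open>\<phi>\<close> carries the induction, since the step applies the
  hypothesis to a difference of two shifted weights.\<close>

lemma sum_Pow_eq_sum_sieve:
  "(\<Sum>S\<in>Pow {..<k}. (-1) ^ (k - card S) *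
      (\<Prod>j<k. (1 + fps_X) ^ card (S \<inter> {..j}) - 1) * \<phi> (card S)) = (\<Sum>c\<le>k. sieve k c * \<phi> c)"
proof (induction k arbitrary: \<phi>)
  case (Suc k)
  define y :: "real fps" where "y = 1 + fps_X"
  define T where "T k S = (-1) ^ (k - card S) * (\<Prod>j<k. y ^ card (S \<inter> {..j}) - 1)" for k S
  have fin: "finite S" "card S \<le> k" "k \<notin> S" if "S \<in> Pow {..<k}" for S
    using that card_mono[of "{..<k}" S] by (auto intro: finite_subset)
  have T1: "T (Suc k) S = - T k S * (y ^ card S - 1)" if S: "S \<in> Pow {..<k}" for S
  proof -
    have "S \<inter> {..k} = S" using S by auto
    thus ?thesis using fin[OF S] by (simp add: T_def Suc_diff_le)
  qed
  have T2: "T (Suc k) (insert k S) = T k S * (y ^ Suc (card S) - 1)" if S: "S \<in> Pow {..<k}" for S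
  proof -
    have "(\<Prod>j<k. y ^ card (insert k S \<inter> {..j}) - 1) = (\<Prod>j<k. y ^ card (S \<inter> {..j}) - 1)"
      by (intro prod.cong refl) (auto simp: Int_insert_left)
    moreover have "insert k S \<inter> {..k} = insert k S" using S by auto
    ultimately show ?thesis using fin[OF S] by (simp add: T_def)
  qed
  have "(\<Sum>S\<in>Pow {..<Suc k}. T (Suc k) S * \<phi> (card S)) =
      (\<Sum>S\<in>Pow {..<k}. T (Suc k) S * \<phi> (card S)) +
      (\<Sum>S\<in>insert k ` Pow {..<k}. T (Suc k) S * \<phi> (card S))"
    unfolding lessThan_Suc Pow_insert by (rule sum.union_disjoint) auto
  also have "(\<Sum>S\<in>insert k ` Pow {..<k}. T (Suc k) S * \<phi> (card S)) =
      (\<Sum>S\<in>Pow {..<k}. T (Suc k) (insert k S) * \<phi> (card (insert k S)))"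
    by (subst sum.reindex) (auto intro!: inj_onI simp: comp_def)
  also have "(\<Sum>S\<in>Pow {..<k}. T (Suc k) S * \<phi> (card S)) + \<dots> =
      (\<Sum>S\<in>Pow {..<k}. T k S * ((y ^ Suc (card S) - 1) * \<phi> (Suc (card S)) -
         (y ^ card S - 1) * \<phi> (card S)))"
    unfolding sum.distrib[symmetric]
    by (intro sum.cong refl) (simp add: T1 T2 fin algebra_simps)
  also have "\<dots> = (\<Sum>c\<le>k. sieve k c * ((y ^ Suc c - 1) * \<phi> (Suc c) - (y ^ c - 1) * \<phi> c))"
    using Suc.IH[of "\<lambda>c. (y ^ Suc c - 1) * \<phi> (Suc c) - (y ^ c - 1) * \<phi> c"]
    unfolding T_def y_def by simp
  also have "\<dots> = (\<Sum>c\<le>k. sieve k c * (y ^ Suc c - 1) * \<phi> (Suc c)) -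
      (\<Sum>c\<le>Suc k. sieve k c * (y ^ c - 1) * \<phi> c)"
    by (simp add: sieve_eq_0 sum_subtractf sum.distrib algebra_simps)
  also have "(\<Sum>c\<le>k. sieve k c * (y ^ Suc c - 1) * \<phi> (Suc c)) =
      (\<Sum>c\<le>Suc k. (if c = 0 then 0 else sieve k (c - 1)) * (y ^ c - 1) * \<phi> c)"
    by (subst sum.atMost_Suc_shift) simp
  also have "\<dots> - (\<Sum>c\<le>Suc k. sieve k c * (y ^ c - 1) * \<phi> c) = (\<Sum>c\<le>Suc k. sieve (Suc k) c * \<phi> c)"
    unfolding sum_subtractf[symmetric]
    by (intro sum.cong refl) (simp add: y_def algebra_simps)
  finally show ?case unfolding T_def y_def .
qed simp

text \<open>Summing the recursion over \<open>k\<close> relates the sums for \<open>c\<close> and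
  \<open>Suc c\<close> by \<open>s (Suc c) = (y - 1) * (s c - s (Suc c))\<close> with
  \<open>y = (1 + fps_X) ^ Suc c\<close>. Solving for \<open>s (Suc c)\<close> is what produces the
  inverse power.\<close>

lemma fps_inf_sum_sieve:
  "fps_inf_sum (\<lambda>k. sieve k c) = (\<Prod>i=1..c. 1 - inverse ((1 + fps_X) ^ i))"
proof (induction c)
  case 0
  have "fps_inf_sum (\<lambda>k. sieve k 0) = sieve 0 0 + fps_inf_sum (\<lambda>k. sieve (Suc k) 0)"
    by (rule fps_inf_sum_Suc) (rule sieve_nth_below)
  also have "fps_inf_sum (\<lambda>k. sieve (Suc k) 0) = 0" by (rule fps_ext) (simp add: fps_inf_sum_def)
  finally show ?case by simp
next
  case (Suc c)
  define y :: "real fps" where "y = (1 + fps_X) ^ Suc c"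
  have y: "y $ 0 \<noteq> 0" by (simp add: y_def)
  let ?s = "\<lambda>c. fps_inf_sum (\<lambda>k. sieve k c)"
  have "?s (Suc c) = sieve 0 (Suc c) + fps_inf_sum (\<lambda>k. sieve (Suc k) (Suc c))"
    by (rule fps_inf_sum_Suc) (rule sieve_nth_below)
  also have "fps_inf_sum (\<lambda>k. sieve (Suc k) (Suc c)) =
      (y - 1) * fps_inf_sum (\<lambda>k. sieve k c - sieve k (Suc c))"
    by (subst fps_inf_sum_mult[symmetric]) (simp_all add: sieve_nth_below y_def)
  also have "\<dots> = (y - 1) * (?s c - ?s (Suc c))"
    by (simp only: fps_inf_sum_diff)
  finally have "y * ?s (Suc c) = (y - 1) * ?s c" by (simp add: algebra_simps)
  hence "inverse y * y * ?s (Suc c) = inverse y * (y - 1) * ?s c" by (simp only: mult.assoc)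
  moreover have y': "inverse y * y = 1" using y by (rule inverse_mult_eq_1)
  moreover have "inverse y * (y - 1) = 1 - inverse y"
    unfolding right_diff_distrib y' by simp
  ultimately have "?s (Suc c) = (1 - inverse y) * ?s c" by (simp only: mult_1_left)
  thus ?case using Suc.IH by (simp add: y_def mult.commute)
qed

theorem rigid_interval_orders_gf:
  "real (num_rigid_interval_orders n) =
     fps_inf_sum (\<lambda>c. \<Prod>i=1..c. 1 - inverse ((1 + fps_X) ^ i)) $ n"
proof -
  define V where "V k = {M \<in> column_sets k {..<k}. fst ` M = {..<k}}" for k
  have V: "V k = {M \<in> interval_matrices. snd ` M = {..<k}}" for k
  proof (intro equalityI subsetI)
    fix M assume "M \<in> V k"
    thus "M \<in> {M \<in> interval_matrices. snd ` M = {..<k}}"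
      unfolding V_def interval_matrices_def using finite_column_set by (auto simp: column_sets_def)
  next
    fix M assume "M \<in> {M \<in> interval_matrices. snd ` M = {..<k}}"
    then obtain k' where "fst ` M = {..<k'}" "snd ` M = {..<k'}" "\<forall>p\<in>M. fst p \<le> snd p"
      "snd ` M = {..<k}" by (auto simp: interval_matrices_def)
    moreover from this have "k' = k" by (metis lessThan_eq_iff)
    moreover have "fst p \<in> fst ` M" if "p \<in> M" for p using that by simp
    ultimately show "M \<in> V k" unfolding V_def column_sets_def by auto
  qed
  have fin: "finite (V k)" for k unfolding V_def using finite_column_sets by simp
  \<comment> \<open>A matrix with \<open>n\<close> ones has at most \<open>n\<close> nonzero
    columns, hence size at most \<open>n\<close>.\<close>
  have "{M \<in> interval_matrices. card M = n} = (\<Union>k\<in>{..n}. {M \<in> V k. card M = n})"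
  proof (intro equalityI subsetI)
    fix M assume M: "M \<in> {M \<in> interval_matrices. card M = n}"
    then obtain k where k: "snd ` M = {..<k}" and fin: "finite M" by (auto simp: interval_matrices_def)
    have "k \<le> n" using card_image_le[OF fin, of snd] M k by simp
    thus "M \<in> (\<Union>k\<in>{..n}. {M \<in> V k. card M = n})" using M k by (auto simp: V)
  qed (auto simp: V)
  also have "card \<dots> = (\<Sum>k\<le>n. card {M \<in> V k. card M = n})"
  proof (rule card_UN_disjoint)
    show "\<forall>i\<in>{..n}. \<forall>j\<in>{..n}. i \<noteq> j \<longrightarrow> {M \<in> V i. card M = n} \<inter> {M \<in> V j. card M = n} = {}"
      by (auto simp: V)
  qed (use fin in auto)
  finally have "real (num_rigid_interval_orders n) = (\<Sum>k\<le>n. real (card {M \<in> V k. card M = n}))"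
    by (simp add: num_rigid_interval_orders_eq_card)
  also have "\<dots> = (\<Sum>k\<le>n. (\<Sum>c\<le>k. sieve k c) $ n)"
  proof (intro sum.cong refl)
    fix k
    have "real (card {M \<in> V k. card M = n}) = (\<Sum>M\<in>V k. if card M = n then 1 else 0)"
      using fin[of k] by (simp add: sum.inter_filter[symmetric])
    also have "\<dots> = (\<Sum>M\<in>V k. fps_X ^ card M) $ n"
      by (simp add: fps_sum_nth) (intro sum.cong, auto)
    also have "(\<Sum>M\<in>V k. fps_X ^ card M :: real fps) = (\<Sum>c\<le>k. sieve k c)"
      unfolding V_def sum_interval_matrices_of_size
      using sum_Pow_eq_sum_sieve[of k "\<lambda>_. 1"] by simp
    finally show "real (card {M \<in> V k. card M = n}) = (\<Sum>c\<le>k. sieve k c) $ n" .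
  qed
  \<comment> \<open>The range of \<open>c\<close> is made independent of \<open>k\<close> so that
    the sums can be exchanged.\<close>
  also have "\<dots> = (\<Sum>k\<le>n. \<Sum>c\<le>n. sieve k c $ n)"
    unfolding fps_sum_nth
    by (intro sum.cong[OF refl] sum.mono_neutral_left) (auto simp: sieve_eq_0)
  also have "\<dots> = (\<Sum>c\<le>n. \<Sum>k\<le>n. sieve k c $ n)" by (rule sum.swap)
  also have "\<dots> = (\<Sum>c\<le>n. fps_inf_sum (\<lambda>k. sieve k c) $ n)" by (simp add: fps_inf_sum_def)
  finally show ?thesis by (simp add: fps_inf_sum_sieve) (simp add: fps_inf_sum_def)
qed

section \<open>The Kontsevich-Zagier series\<close>

text \<open>With \<open>q = exp (- t)\<close> and \<open>x = q powr m\<close>, \<open>kz_tail m\<close> is the sum over \<open>n\<close> of \<open>x\<^sup>n\<close> times the product of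
  the \<open>1 - x q\<^sup>i\<close> for \<open>1 \<le> i \<le> n\<close>, as a power series in \<open>t\<close>; \<open>kz_tail 0\<close> is the Kontsevich-Zagier series.\<close>
definition kz_partial :: "real \<Rightarrow> nat \<Rightarrow> real fps" where
  "kz_partial m n = (\<Prod>i=1..n. 1 - fps_exp (- (m + real i)))"

definition kz_tail :: "real \<Rightarrow> real fps" where
  "kz_tail m = fps_inf_sum (\<lambda>n. fps_exp (- (real n * m)) * kz_partial m n)"

lemma kz_partial_nth_below: "n < k \<Longrightarrow> kz_partial m k $ n = 0"
  unfolding kz_partial_def by (rule fps_prod_nth_below) auto

lemma fps_mult_nth_below':
  fixes A B :: "'a::comm_ring_1 fps"
  assumes "\<And>n. n < k \<Longrightarrow> B $ n = 0" "n < k"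
  shows "(A * B) $ n = 0"
  unfolding fps_mult_nth by (rule sum.neutral) (use assms in auto)

lemma kz_partial_Suc: "kz_partial m (Suc n) = kz_partial m n * (1 - fps_exp (- (m + real (Suc n))))"
  by (simp add: kz_partial_def)

lemma kz_partial_shift:
  "(1 - fps_exp (- (m + 1))) * kz_partial (m + 1) n = kz_partial m (Suc n)"
proof (induction n)
  case (Suc n)
  have "(1 - fps_exp (- (m + 1))) * kz_partial (m + 1) (Suc n) =
      kz_partial m (Suc n) * (1 - fps_exp (- (m + 1 + real (Suc n))))"
    unfolding Suc.IH[symmetric] by (simp add: kz_partial_Suc mult.assoc)
  also have "m + 1 + real (Suc n) = m + real (Suc (Suc n))" by simp
  finally show ?case by (simp only: kz_partial_Suc[of m "Suc n"])
qed (simp add: kz_partial_def)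

text \<open>By \<open>kz_partial_shift\<close> the series at \<open>m + 1\<close>, multiplied by its
  prefactor, is the difference of two index shifts of the series \<open>g\<close> at
  \<open>m\<close>. They recombine to \<open>S m\<close> apart from the initial terms
  \<open>g 0\<close> and \<open>g 1\<close>.\<close>

lemma kz_tail_recursion:
  defines "S \<equiv> \<lambda>m. (1 - fps_exp (- m)) * kz_tail m"
  shows "S m = 1 - fps_exp (- (2 * m + 1)) - fps_exp (- (3 * m + 2)) * S (m + 1)"
proof -
  define g where "g n = fps_exp (- (real n * m)) * kz_partial m n" for n
  have g: "g k $ n = 0" if "n < k" for k n
    unfolding g_def by (rule fps_mult_nth_below') (use that kz_partial_nth_below in auto)
  have g1: "g (Suc k) $ n = 0" if "n < k" for k n using g that by simp
  have "fps_exp (- (3 * m + 2)) * S (m + 1) =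
      (fps_exp (- (3 * m + 2)) * (1 - fps_exp (- (m + 1)))) * kz_tail (m + 1)"
    by (simp add: S_def mult.assoc)
  also have "\<dots> = fps_inf_sum (\<lambda>n. (fps_exp (- (3 * m + 2)) * (1 - fps_exp (- (m + 1)))) *
      (fps_exp (- (real n * (m + 1))) * kz_partial (m + 1) n))"
    unfolding kz_tail_def
    by (rule fps_inf_sum_mult[symmetric], rule fps_mult_nth_below')
       (use kz_partial_nth_below in auto)
  also have "(\<lambda>n. (fps_exp (- (3 * m + 2)) * (1 - fps_exp (- (m + 1)))) *
      (fps_exp (- (real n * (m + 1))) * kz_partial (m + 1) n)) =
      (\<lambda>n. fps_exp (- m) * g (Suc n) - g (Suc (Suc n)))"
  proof
    fix n
    have "(fps_exp (- (3 * m + 2)) * (1 - fps_exp (- (m + 1)))) *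
        (fps_exp (- (real n * (m + 1))) * kz_partial (m + 1) n) =
        (fps_exp (- (3 * m + 2)) * fps_exp (- (real n * (m + 1)))) * kz_partial m (Suc n)"
      unfolding kz_partial_shift[symmetric] by (simp only: mult_ac)
    also have "fps_exp (- (3 * m + 2)) * fps_exp (- (real n * (m + 1))) =
        fps_exp (- (real (Suc (Suc n)) * m)) * fps_exp (- (m + real (Suc (Suc n))))"
      unfolding fps_exp_add_mult[symmetric] by (rule arg_cong[where f = fps_exp]) (simp add: algebra_simps)
    also have "\<dots> * kz_partial m (Suc n) = fps_exp (- (real (Suc (Suc n)) * m)) * kz_partial m (Suc n)
        - g (Suc (Suc n))"
      unfolding g_def kz_partial_Suc[of m "Suc n"] by (simp add: algebra_simps)
    also have "fps_exp (- (real (Suc (Suc n)) * m)) = fps_exp (- m) * fps_exp (- (real (Suc n) * m))"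
      unfolding fps_exp_add_mult[symmetric] by (rule arg_cong[where f = fps_exp]) (simp add: algebra_simps)
    finally show "(fps_exp (- (3 * m + 2)) * (1 - fps_exp (- (m + 1)))) *
      (fps_exp (- (real n * (m + 1))) * kz_partial (m + 1) n) = fps_exp (- m) * g (Suc n) - g (Suc (Suc n))"
      by (simp only: g_def mult.assoc)
  qed
  also have "fps_inf_sum \<dots> = fps_exp (- m) * fps_inf_sum (\<lambda>n. g (Suc n)) -
      fps_inf_sum (\<lambda>n. g (Suc (Suc n)))"
    by (simp add: fps_inf_sum_diff fps_inf_sum_mult g)
  also have "fps_inf_sum (\<lambda>n. g (Suc n)) = kz_tail m - g 0"
    using fps_inf_sum_Suc[OF g] by (simp add: kz_tail_def g_def)
  also have "fps_inf_sum (\<lambda>n. g (Suc (Suc n))) = kz_tail m - g 0 - g 1"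
    using fps_inf_sum_Suc[OF g1] fps_inf_sum_Suc[OF g] by (simp add: kz_tail_def g_def)
  also have "g 0 = 1" by (simp add: g_def kz_partial_def)
  also have "g 1 = fps_exp (- m) - fps_exp (- m) * fps_exp (- (m + 1))"
    by (simp add: g_def kz_partial_def algebra_simps)
  also have "fps_exp (- m) * fps_exp (- (m + 1)) = fps_exp (- (2 * m + 1))"
    unfolding fps_exp_add_mult[symmetric] by (rule arg_cong[where f = fps_exp]) simp
  finally show ?thesis by (simp add: S_def algebra_simps)
qed

text \<open>The expansion of \<open>sinh s / cosh (3 s / 2)\<close>.\<close>
definition moment_fps :: "real fps" where
  "moment_fps = (fps_exp 1 - fps_exp (- 1)) * inverse (fps_exp (3 / 2) + fps_exp (- (3 / 2)))"

lemma moment_fps_mult: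
  "moment_fps * (fps_exp (3 / 2) + fps_exp (- (3 / 2))) = fps_exp 1 - fps_exp (- 1)"
proof -
  have "inverse (fps_exp (3 / 2) + fps_exp (- (3 / 2))) * (fps_exp (3 / 2) + fps_exp (- (3 / 2))) = (1 :: real fps)"
    by (rule inverse_mult_eq_1) simp
  thus ?thesis by (simp add: moment_fps_def mult.assoc)
qed

text \<open>\<open>sinh s / cosh (3 s / 2)\<close> is odd: substituting \<open>- fps_X\<close> in
  the defining equation flips only the numerator, and the denominator cancels.\<close>

lemma moment_fps_even_nth: "even n \<Longrightarrow> moment_fps $ n = 0"
proof -
  have "(moment_fps oo - fps_X) * ((fps_exp (3 / 2) + fps_exp (- (3 / 2))) oo - fps_X) =
      (fps_exp 1 - fps_exp (- 1)) oo - fps_X"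
    unfolding moment_fps_mult[symmetric] by (rule fps_compose_mult_distrib[symmetric]) simp
  hence "(moment_fps oo - fps_X) * (fps_exp (3 / 2) + fps_exp (- (3 / 2))) =
      - moment_fps * (fps_exp (3 / 2) + fps_exp (- (3 / 2)))"
    by (simp add: fps_compose_add_distrib fps_compose_sub_distrib moment_fps_mult add.commute)
  moreover have "fps_exp (3 / 2) + fps_exp (- (3 / 2)) \<noteq> (0 :: real fps)"
  proof
    assume "fps_exp (3 / 2) + fps_exp (- (3 / 2)) = (0 :: real fps)"
    hence "(fps_exp (3 / 2) + fps_exp (- (3 / 2)) :: real fps) $ 0 = 0" by simp
    thus False by simp
  qed
  ultimately have "moment_fps oo - fps_X = - moment_fps" using mult_right_cancel by blast
  hence "(moment_fps oo - fps_X) $ n = (- moment_fps) $ n" by simp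
  moreover assume "even n"
  ultimately show ?thesis by (simp add: fps_compose_uminus')
qed

section \<open>The functional L on polynomials\<close>

definition moment :: "nat \<Rightarrow> real" where
  "moment k = fact k * moment_fps $ k"

text \<open>The functional L of the overview; \<open>moment k\<close> is its value at the
  \<open>k\<close>-th power of d.\<close>

definition umbral :: "real poly \<Rightarrow> real" where
  "umbral p = (\<Sum>k\<le>degree p. coeff p k * moment k)"

lemma umbral_degree_le: "degree p \<le> n \<Longrightarrow> umbral p = (\<Sum>k\<le>n. coeff p k * moment k)"
  unfolding umbral_def by (rule sum.mono_neutral_left) (auto simp: coeff_eq_0)

lemma umbral_add: "umbral (p + q) = umbral p + umbral q"
proof -
  define n where "n = max (degree p) (degree q)"
  have "degree (p + q) \<le> n" "degree p \<le> n" "degree q \<le> n"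
    by (auto simp: n_def degree_add_le_max)
  thus ?thesis by (simp add: umbral_degree_le[of _ n] sum.distrib algebra_simps)
qed

lemma umbral_smult: "umbral (smult c p) = c * umbral p"
  by (subst umbral_degree_le[of _ "degree p"]) (auto simp: umbral_def sum_distrib_left algebra_simps)

lemma umbral_0 [simp]: "umbral 0 = 0" by (simp add: umbral_def)

lemma umbral_sum: "umbral (sum f A) = (\<Sum>x\<in>A. umbral (f x))"
  by (induction A rule: infinite_finite_induct) (auto simp: umbral_add)

lemma umbral_monom: "umbral (monom c k) = c * moment k"
  by (cases "c = 0") (auto simp: umbral_def degree_monom_eq if_distrib[of "\<lambda>x. x * _"] cong: if_cong)

text \<open>After division by factorials the binomial theorem is a convolution, so a constant added
  to the exponent factors out of the exponential generating function as \<open>fps_exp c\<close>.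
  The spectator \<open>Q\<close> leaves room for the factor d that appears on comparing terms linear
  in m.\<close>

lemma umbral_shift_binomial:
  "umbral (([:c:] + E) ^ n * Q) / fact n = (\<Sum>k\<le>n. c ^ k / fact k * (umbral (E ^ (n - k) * Q) / fact (n - k)))"
proof -
  have "([:c:] + E) ^ n * Q = (\<Sum>k\<le>n. smult (of_nat (n choose k) * c ^ k) (E ^ (n - k) * Q))"
    unfolding binomial_ring sum_distrib_right
    by (intro sum.cong refl) (simp add: poly_const_pow of_nat_poly algebra_simps)
  thus ?thesis
    by (simp add: umbral_sum umbral_smult sum_divide_distrib)
       (intro sum.cong refl, simp add: binomial_fact field_simps)
qed

lemma fps_umbral_shift:
  "Abs_fps (\<lambda>n. umbral (([:c:] + E) ^ n * Q) / fact n) =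
     fps_exp c * Abs_fps (\<lambda>n. umbral (E ^ n * Q) / fact n)"
  by (rule fps_ext) (simp add: fps_mult_nth umbral_shift_binomial atMost_atLeast0)

lemma pcompose_power: "pcompose (p ^ n) q = pcompose p q ^ n" for p q :: "'a::comm_semiring_1 poly"
  by (induction n) (simp_all add: pcompose_mult pcompose_1)

text \<open>This is the generating function identity (1 + exp(-3s)) sinh s / cosh(3s/2) = exp(-s/2)
  - exp(-5s/2), read off on monomials: 1 + exp(-3s) is exp(-3s/2) times twice the
  denominator.\<close>

lemma umbral_difference:
  "umbral p + umbral (pcompose p [:-3, 1:]) = poly p (- 1 / 2) - poly p (- 5 / 2)"
proof -
  have mon: "umbral (monom 1 n) + umbral (pcompose (monom 1 n) [:-3, 1:]) = (- 1 / 2) ^ n - (- 5 / 2) ^ n" for n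
  proof -
    have "pcompose (monom 1 n) [:-3, 1:] = ([:-3:] + monom 1 1) ^ n * (1 :: real poly)"
      by (simp add: monom_altdef pcompose_power pcompose_pCons)
    hence "umbral (pcompose (monom 1 n) [:-3, 1:]) / fact n =
        (\<Sum>k\<le>n. (-3) ^ k / fact k * (umbral (monom 1 1 ^ (n - k) * 1) / fact (n - k)))"
      by (simp only: umbral_shift_binomial)
    also have "\<dots> = (\<Sum>k\<le>n. fps_exp (-3) $ k * moment_fps $ (n - k))"
      by (intro sum.cong refl) (simp add: monom_power umbral_monom moment_def)
    also have "\<dots> = (fps_exp (-3) * moment_fps) $ n" by (simp add: fps_mult_nth atMost_atLeast0)
    finally have "(umbral (monom 1 n) + umbral (pcompose (monom 1 n) [:-3, 1:])) / fact n =
        (moment_fps * (1 + fps_exp (-3))) $ n"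
      by (simp add: umbral_monom moment_def add_divide_distrib algebra_simps)
    also have "moment_fps * (1 + fps_exp (-3)) = fps_exp (- (3 / 2)) * (fps_exp 1 - fps_exp (- 1))"
      unfolding moment_fps_mult[symmetric]
      by (simp add: algebra_simps fps_exp_add_mult[symmetric])
    also have "\<dots> = fps_exp (- 1 / 2) - fps_exp (- 5 / 2)"
      by (simp add: algebra_simps fps_exp_add_mult[symmetric])
    finally show ?thesis by (simp add: field_simps)
  qed
  have p: "p = (\<Sum>i\<le>degree p. smult (coeff p i) (monom 1 i))"
    using poly_as_sum_of_monoms[of p] by (simp add: smult_monom)
  have "umbral p = (\<Sum>i\<le>degree p. coeff p i * umbral (monom 1 i))"
    using arg_cong[OF p, of umbral] by (simp only: umbral_sum umbral_smult)
  moreover have "umbral (pcompose p [:-3, 1:]) =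
      (\<Sum>i\<le>degree p. coeff p i * umbral (pcompose (monom 1 i) [:-3, 1:]))"
    using arg_cong[OF p, of "\<lambda>p. umbral (pcompose p [:-3, 1:])"]
    by (simp only: pcompose_sum pcompose_smult umbral_sum umbral_smult)
  ultimately have "umbral p + umbral (pcompose p [:-3, 1:]) =
      (\<Sum>i\<le>degree p. coeff p i * (umbral (monom 1 i) + umbral (pcompose (monom 1 i) [:-3, 1:])))"
    by (simp only: sum.distrib distrib_left)
  also have "\<dots> = poly p (- 1 / 2) - poly p (- 5 / 2)"
    unfolding mon by (simp add: poly_altdef sum_subtractf algebra_simps)
  finally show ?thesis .
qed


text \<open>Made for the recursion: replacing d by d - 3 gives the exponent for \<open>m + 1\<close>
  minus \<open>3 * m + 2\<close>, and the values at the points -1/2 and -5/2 of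
  \<open>umbral_difference\<close> are 0 and \<open>- (2 * m + 1)\<close>. These are the three
  exponents occurring in \<open>kz_tail_recursion\<close>.\<close>

definition kz_exponent :: "real \<Rightarrow> real poly" where
  "kz_exponent m = [:m / 2 + 1 / 24, m, - 1 / 6:]"

lemma umbral_even:
  assumes "pcompose p [:0, -1:] = p" shows "umbral p = 0"
proof -
  have "coeff p k * moment k = 0" for k
  proof (cases "even k")
    case False
    have "coeff p k = (-1) ^ k * coeff p k"
      using arg_cong[OF assms, of "\<lambda>p. coeff p k"] by (simp add: coeff_pcompose_linear)
    thus ?thesis using False by simp
  qed (simp add: moment_def moment_fps_even_nth)
  thus ?thesis unfolding umbral_def by (intro sum.neutral ballI)
qed

text \<open>For \<open>m = 0\<close> the exponent is even in d, whereas only odd moments are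
  nonzero. This matches the vanishing factor \<open>1 - fps_exp 0\<close> on the other side.\<close>

lemma umbral_kz_exponent_0_power: "umbral (kz_exponent 0 ^ n) = 0"
  by (rule umbral_even) (simp add: pcompose_power kz_exponent_def pcompose_pCons)

lemma umbral_kz_exponent_recursion:
  defines "U \<equiv> \<lambda>m. Abs_fps (\<lambda>n. umbral (kz_exponent m ^ n) / fact n)"
  shows "U m = 1 - fps_exp (- (2 * m + 1)) - fps_exp (- (3 * m + 2)) * U (m + 1)"
proof -
  have "pcompose (kz_exponent m) [:-3, 1:] = [:- (3 * m + 2):] + kz_exponent (m + 1)"
    by (simp add: kz_exponent_def pcompose_pCons algebra_simps)
  hence pc: "umbral (pcompose (kz_exponent m ^ n) [:-3, 1:]) / fact n =
      (fps_exp (- (3 * m + 2)) * U (m + 1)) $ n" for n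
    unfolding U_def using fps_umbral_shift[of "- (3 * m + 2)" "kz_exponent (m + 1)" 1]
    by (simp add: pcompose_power fps_eq_iff)
  have "(U m + fps_exp (- (3 * m + 2)) * U (m + 1)) $ n = (1 - fps_exp (- (2 * m + 1))) $ n" for n
  proof -
    have "poly (kz_exponent m) (- 1 / 2) = 0" "poly (kz_exponent m) (- 5 / 2) = - (2 * m + 1)"
      by (simp_all add: kz_exponent_def field_simps)
    hence "umbral (kz_exponent m ^ n) + umbral (pcompose (kz_exponent m ^ n) [:-3, 1:]) =
        0 ^ n - (- (2 * m + 1)) ^ n"
      using umbral_difference[of "kz_exponent m ^ n"] by (simp only: poly_power)
    moreover have "U m $ n = umbral (kz_exponent m ^ n) / fact n" by (simp add: U_def)
    ultimately have "(U m + fps_exp (- (3 * m + 2)) * U (m + 1)) $ n = (0 ^ n - (- (2 * m + 1)) ^ n) / fact n"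
      by (simp only: fps_add_nth pc[symmetric] add_divide_distrib[symmetric])
    thus ?thesis by (cases n) (simp_all add: diff_divide_distrib del: fact_Suc)
  qed
  thus ?thesis by (simp add: fps_eq_iff eq_diff_eq)
qed

text \<open>The exponential factor in the common recursion can be cancelled, so the value at
  \<open>m\<close> determines the one at \<open>m + 1\<close>. The induction therefore reaches
  natural numbers only; passing to terms linear in m needs polynomial dependence.\<close>

lemma kz_tail_eq_umbral:
  "(1 - fps_exp (- real m)) * kz_tail (real m) = Abs_fps (\<lambda>n. umbral (kz_exponent (real m) ^ n) / fact n)"
proof (induction m)
  case 0
  show ?case by (simp add: umbral_kz_exponent_0_power fps_eq_iff)
next
  case (Suc m)
  define S where "S m = (1 - fps_exp (- m)) * kz_tail m" for m
  define U where "U m = Abs_fps (\<lambda>n. umbral (kz_exponent m ^ n) / fact n)" for m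
  have "1 - fps_exp (- (2 * real m + 1)) - fps_exp (- (3 * real m + 2)) * S (real m + 1) =
      1 - fps_exp (- (2 * real m + 1)) - fps_exp (- (3 * real m + 2)) * U (real m + 1)"
    unfolding S_def U_def kz_tail_recursion[symmetric] umbral_kz_exponent_recursion[symmetric]
    by (rule Suc.IH)
  hence "S (real m + 1) = U (real m + 1)" by simp
  thus ?case by (simp add: add.commute S_def U_def)
qed

section \<open>Polynomial dependence on m\<close>

definition poly_fun :: "(real \<Rightarrow> real) \<Rightarrow> bool" where
  "poly_fun f \<longleftrightarrow> (\<exists>p. f = poly p)"

lemma poly_fun_const: "poly_fun (\<lambda>m. c)"
  unfolding poly_fun_def by (intro exI[of _ "[:c:]"]) auto

lemma poly_fun_id: "poly_fun (\<lambda>m. m)"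
  unfolding poly_fun_def by (intro exI[of _ "[:0, 1:]"]) auto

lemma poly_fun_add: "poly_fun f \<Longrightarrow> poly_fun g \<Longrightarrow> poly_fun (\<lambda>m. f m + g m)"
  unfolding poly_fun_def by (metis (no_types, lifting) poly_add ext)

lemma poly_fun_mult: "poly_fun f \<Longrightarrow> poly_fun g \<Longrightarrow> poly_fun (\<lambda>m. f m * g m)"
  unfolding poly_fun_def by (metis (no_types, lifting) poly_mult ext)

lemma poly_fun_minus: "poly_fun f \<Longrightarrow> poly_fun (\<lambda>m. - f m)"
  using poly_fun_mult[OF poly_fun_const[of "-1"], of f] by simp

lemma poly_fun_diff: "poly_fun f \<Longrightarrow> poly_fun g \<Longrightarrow> poly_fun (\<lambda>m. f m - g m)"
  using poly_fun_add[of f "\<lambda>m. - g m"] poly_fun_minus[of g] by simp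

lemma poly_fun_divide: "poly_fun f \<Longrightarrow> poly_fun (\<lambda>m. f m / c)"
  using poly_fun_mult[OF _ poly_fun_const[of "1 / c"], of f] by simp

lemma poly_fun_sum: "(\<And>i. i \<in> A \<Longrightarrow> poly_fun (f i)) \<Longrightarrow> poly_fun (\<lambda>m. \<Sum>i\<in>A. f i m)"
  by (induction A rule: infinite_finite_induct) (auto intro: poly_fun_const poly_fun_add)

lemma poly_fun_power: "poly_fun f \<Longrightarrow> poly_fun (\<lambda>m. f m ^ n)"
  by (induction n) (auto intro: poly_fun_const poly_fun_mult)

lemmas poly_fun_intros = poly_fun_const poly_fun_id poly_fun_add poly_fun_mult poly_fun_minus
  poly_fun_diff poly_fun_divide poly_fun_sum poly_fun_power

text \<open>The identity to which this is applied carries a factor \<open>m\<close>, which cancels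
  at positive integers; these are infinitely many, so the two polynomials coincide and 0 may be
  inserted.\<close>

lemma poly_fun_eq_at_0:
  assumes "poly_fun f" "poly_fun g" "\<And>m. f (real (Suc m)) = g (real (Suc m))"
  shows "f 0 = g 0"
proof -
  obtain p q where pq: "f = poly p" "g = poly q" using assms by (auto simp: poly_fun_def)
  have "p - q = 0"
  proof (rule ccontr)
    assume "p - q \<noteq> 0"
    hence "finite {x. poly (p - q) x = 0}" by (rule poly_roots_finite)
    moreover have "range (\<lambda>m. real (Suc m)) \<subseteq> {x. poly (p - q) x = 0}"
      using assms(3) by (auto simp: pq)
    ultimately have "finite (range (\<lambda>m. real (Suc m)))" by (rule rev_finite_subset)
    moreover have "inj (\<lambda>m. real (Suc m))" by (auto intro: injI)
    ultimately show False using finite_imageD infinite_UNIV_nat by blast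
  qed
  thus ?thesis by (simp add: pq)
qed

lemma poly_fun_fps_mult:
  assumes "\<And>n. poly_fun (\<lambda>m. F m $ n)" "\<And>n. poly_fun (\<lambda>m. G m $ n)"
  shows "poly_fun (\<lambda>m. (F m * G m) $ n)"
  unfolding fps_mult_nth by (intro poly_fun_intros assms)

lemma poly_fun_fps_exp: "poly_fun f \<Longrightarrow> poly_fun (\<lambda>m. fps_exp (f m) $ n)"
  by (simp del: fact_Suc) (intro poly_fun_intros)

lemma poly_fun_kz_tail: "poly_fun (\<lambda>m. kz_tail m $ n)"
proof -
  have "poly_fun (\<lambda>m. kz_partial m k $ n)" for k n
  proof (induction k arbitrary: n)
    case 0
    show ?case by (simp add: kz_partial_def poly_fun_const)
  next
    case (Suc k)
    show ?case unfolding kz_partial_Suc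
      by (intro poly_fun_fps_mult Suc.IH) (simp only: fps_sub_nth, intro poly_fun_intros poly_fun_fps_exp)
  qed
  thus ?thesis unfolding kz_tail_def fps_inf_sum_def fps_nth_Abs_fps
    by (intro poly_fun_sum poly_fun_fps_mult poly_fun_fps_exp poly_fun_intros)
qed

lemma poly_fun_coeff_mult:
  assumes "\<And>k. poly_fun (\<lambda>m. coeff (P m) k)" "\<And>k. poly_fun (\<lambda>m. coeff (Q m) k)"
  shows "poly_fun (\<lambda>m. coeff (P m * Q m) k)"
  unfolding coeff_mult by (intro poly_fun_intros assms)

lemma poly_fun_umbral:
  assumes "\<And>k. poly_fun (\<lambda>m. coeff (P m) k)" "\<And>m. degree (P m) \<le> n"
  shows "poly_fun (\<lambda>m. umbral (P m))"
proof -
  have "(\<lambda>m. umbral (P m)) = (\<lambda>m. \<Sum>k\<le>n. coeff (P m) k * moment k)"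
    using umbral_degree_le[OF assms(2)] by (rule ext)
  moreover have "poly_fun \<dots>" by (intro poly_fun_intros assms(1))
  ultimately show ?thesis by simp
qed

text \<open>Both sides of \<open>kz_tail_eq_umbral\<close> vanish at \<open>m = 0\<close>; their coefficients are polynomials in \<open>m\<close>
  that agree at all natural numbers, so the linear coefficients agree as well.\<close>
lemma kz_tail_0_nth: "kz_tail 0 $ n = umbral ([:1 / 2, 1:] * kz_exponent 0 ^ n) / fact n"
proof -
  define E where "E = kz_exponent"
  \<comment> \<open>The quotient of \<open>1 - fps_exp (- m)\<close> by \<open>m\<close>, written
    out so that it makes sense at \<open>m = 0\<close>, where it equals
    \<open>fps_X\<close>.\<close>
  define B where "B m = Abs_fps (\<lambda>n. if n = 0 then 0 else (-1) ^ Suc n * m ^ (n - 1) / fact n)" for m :: real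
  \<comment> \<open>The quotient of \<open>E m ^ n - E 0 ^ n\<close> by \<open>m\<close>;
    subtracting \<open>E 0 ^ n\<close> leaves the umbral value unchanged.\<close>
  define W where "W m n = [:1 / 2, 1:] * (\<Sum>i<n. E 0 ^ (n - Suc i) * E m ^ i)" for m n
  have B: "1 - fps_exp (- m) = fps_const m * B m" for m
  proof (rule fps_ext)
    fix n show "(1 - fps_exp (- m)) $ n = (fps_const m * B m) $ n"
      by (cases n) (simp_all add: B_def power_minus[of m] del: fact_Suc)
  qed
  have W: "umbral (E m ^ n) = m * umbral (W m n)" for m n
  proof -
    have "E m - E 0 = smult m [:1 / 2, 1:]" by (simp add: E_def kz_exponent_def)
    hence "E m ^ n - E 0 ^ n = smult m (W m n)"
      unfolding power_diff_sumr2 W_def by (simp only: mult_smult_left)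
    hence "umbral (E m ^ n) = umbral (E 0 ^ n + smult m (W m n))" by (simp add: algebra_simps)
    thus ?thesis by (simp add: umbral_add umbral_smult E_def umbral_kz_exponent_0_power)
  qed
  \<comment> \<open>Since \<open>B 0\<close> is \<open>fps_X\<close>, coefficient \<open>n\<close>
    of \<open>kz_tail 0\<close> appears in degree \<open>Suc n\<close>. The \<open>Suc n\<close>
    equal summands of \<open>W 0 (Suc n)\<close> later reduce \<open>fact (Suc n)\<close> to
    \<open>fact n\<close>.\<close>
  have "(B 0 * kz_tail 0) $ Suc n = umbral (W 0 (Suc n)) / fact (Suc n)"
  proof (rule poly_fun_eq_at_0)
    fix m
    let ?m = "real (Suc m)"
    have "(fps_const ?m * B ?m * kz_tail ?m) $ Suc n = umbral (E ?m ^ Suc n) / fact (Suc n)"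
      unfolding B[symmetric] kz_tail_eq_umbral by (simp add: E_def)
    hence "?m * (B ?m * kz_tail ?m) $ Suc n = ?m * (umbral (W ?m (Suc n)) / fact (Suc n))"
      unfolding W by (simp add: mult.assoc)
    thus "(B ?m * kz_tail ?m) $ Suc n = umbral (W ?m (Suc n)) / fact (Suc n)"
      by (metis mult_left_cancel of_nat_eq_0_iff nat.distinct(2))
  next
    have "poly_fun (\<lambda>m. B m $ n)" for n
      by (cases "n = 0") (simp_all add: B_def poly_fun_const, intro poly_fun_intros)
    thus "poly_fun (\<lambda>m. (B m * kz_tail m) $ Suc n)"
      by (intro poly_fun_fps_mult poly_fun_kz_tail)
  next
    have E: "poly_fun (\<lambda>m. coeff (E m) k)" for k
    proof -
      consider "k = 0" | "k = 1" | "k = 2" | j where "k = Suc (Suc (Suc j))"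
        by (metis One_nat_def Suc_1 nat.exhaust)
      thus ?thesis
        by cases (simp_all add: E_def kz_exponent_def numeral_2_eq_2 poly_fun_intros)
    qed
    have Epow: "poly_fun (\<lambda>m. coeff (E m ^ i) k)" for i k
      by (induction i arbitrary: k) (auto intro!: poly_fun_coeff_mult E poly_fun_const)
    have "poly_fun (\<lambda>m. coeff (W m (Suc n)) k)" for k
      unfolding W_def
      by (intro poly_fun_coeff_mult poly_fun_const, unfold coeff_sum)
         (intro poly_fun_sum poly_fun_coeff_mult poly_fun_const Epow)
    moreover have "degree (W m (Suc n)) \<le> 1 + (2 * n + 2 * n)" for m
    proof -
      have deg: "degree (E m ^ i) \<le> 2 * n" if "i \<le> n" for i m
      proof -
        have "degree (E m ^ i) \<le> degree (E m) * i" by (rule degree_power_le)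
        also have "\<dots> \<le> 2 * n" using that by (intro mult_le_mono) (auto simp: E_def kz_exponent_def)
        finally show ?thesis .
      qed
      have "degree (E 0 ^ (Suc n - Suc i) * E m ^ i) \<le> 2 * n + 2 * n" if "i < Suc n" for i
        by (rule order.trans[OF degree_mult_le], rule add_mono) (use that in \<open>auto intro!: deg\<close>)
      hence "degree (\<Sum>i<Suc n. E 0 ^ (Suc n - Suc i) * E m ^ i) \<le> 2 * n + 2 * n"
        by (intro degree_sum_le) auto
      thus ?thesis unfolding W_def by (intro order.trans[OF degree_mult_le] add_mono) auto
    qed
    ultimately have "poly_fun (\<lambda>m. umbral (W m (Suc n)))" by (rule poly_fun_umbral)
    thus "poly_fun (\<lambda>m. umbral (W m (Suc n)) / fact (Suc n))" by (rule poly_fun_divide)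
  qed
  moreover have "B 0 = fps_X" by (auto simp: B_def fps_eq_iff fps_X_def power_0_left)
  moreover have "W 0 (Suc n) = smult (real (Suc n)) ([:1 / 2, 1:] * E 0 ^ n)"
  proof -
    have "(\<Sum>i<Suc n. E 0 ^ (Suc n - Suc i) * E 0 ^ i) = (\<Sum>i<Suc n. E 0 ^ n)"
      by (intro sum.cong refl) (simp add: power_add[symmetric])
    thus ?thesis by (simp add: W_def of_nat_poly)
  qed
  ultimately show ?thesis by (simp add: umbral_smult E_def field_simps del: of_nat_Suc)
qed

definition kz_coeff :: "nat \<Rightarrow> real" where
  "kz_coeff n = (- 1 / 6) ^ n / fact n * moment (2 * n + 1)"

text \<open>The constant 1/24 of the exponent comes out as \<open>fps_exp (1 / 24)\<close>. Of the
  linear factor 1/2 + d only d survives, because L annihilates even polynomials.\<close>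

lemma kz_tail_0: "kz_tail 0 = fps_exp (1 / 24) * Abs_fps kz_coeff"
proof -
  have E: "kz_exponent 0 = [:1 / 24:] + monom (- 1 / 6) 2"
    by (simp add: kz_exponent_def monom_altdef power2_eq_square)
  have "umbral ([:1 / 2, 1:] * kz_exponent 0 ^ n) = umbral (kz_exponent 0 ^ n * monom 1 1)" for n
  proof -
    have "[:1 / 2, 1:] * kz_exponent 0 ^ n = smult (1 / 2) (kz_exponent 0 ^ n) + kz_exponent 0 ^ n * monom 1 1"
      by (simp add: monom_altdef algebra_simps)
    thus ?thesis by (simp add: umbral_add umbral_smult umbral_kz_exponent_0_power)
  qed
  hence "kz_tail 0 = Abs_fps (\<lambda>n. umbral (kz_exponent 0 ^ n * monom 1 1) / fact n)"
    by (simp add: fps_eq_iff kz_tail_0_nth)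
  also have "\<dots> = fps_exp (1 / 24) * Abs_fps (\<lambda>n. umbral (monom (- 1 / 6) 2 ^ n * monom 1 1) / fact n)"
    unfolding E by (rule fps_umbral_shift)
  also have "(\<lambda>n. umbral (monom (- 1 / 6) 2 ^ n * monom 1 1) / fact n) = kz_coeff"
    by (simp add: fun_eq_iff monom_power mult_monom umbral_monom kz_coeff_def mult.commute)
  finally show ?thesis .
qed

lemma fps_mult_compose_nth:
  fixes A G H :: "'a::comm_ring_1 fps"
  assumes "H $ 0 = 0"
  shows "(A * (G oo H)) $ n = (\<Sum>k\<le>n. G $ k * (A * H ^ k) $ n)"
proof -
  have nth: "(G oo H) $ i = (\<Sum>k\<le>n. G $ k * (H ^ k) $ i)" if "i \<le> n" for i
    unfolding fps_compose_nth atLeast0AtMost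
    by (rule sum.mono_neutral_left)
       (use that startsby_zero_power_prefix[OF assms] in auto)
  have "(A * (G oo H)) $ n = (\<Sum>i=0..n. A $ i * (\<Sum>k\<le>n. G $ k * (H ^ k) $ (n - i)))"
    unfolding fps_mult_nth by (intro sum.cong refl arg_cong2[where f = "(*)"] nth) auto
  also have "\<dots> = (\<Sum>i=0..n. \<Sum>k\<le>n. G $ k * (A $ i * (H ^ k) $ (n - i)))"
    by (simp add: sum_distrib_left mult_ac)
  also have "\<dots> = (\<Sum>k\<le>n. \<Sum>i=0..n. G $ k * (A $ i * (H ^ k) $ (n - i)))"
    by (rule sum.swap)
  finally show ?thesis by (simp add: fps_mult_nth sum_distrib_left)
qed

text \<open>Both series solve (1 + x) y' = c y with y(0) = 1.\<close>

lemma fps_exp_compose_ln: "fps_exp c oo fps_ln 1 = fps_binomial (c :: real)"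
proof -
  have "fps_deriv (fps_exp c oo fps_ln 1) = fps_const c * (fps_exp c oo fps_ln 1) / (1 + fps_X)"
    by (simp add: fps_compose_deriv fps_ln_deriv fps_compose_mult_distrib fps_divide_unit)
  thus ?thesis unfolding fps_binomial_ODE_unique by simp
qed

theorem num_rigid_interval_orders_eq_sum:
  "real (num_rigid_interval_orders n) =
     (\<Sum>k\<le>n. kz_coeff k * (fps_binomial (1 / 24) * fps_ln 1 ^ k) $ n)"
proof -
  have "kz_tail 0 oo fps_ln 1 = fps_inf_sum (\<lambda>k. kz_partial 0 k oo fps_ln 1)"
    unfolding kz_tail_def by (subst fps_inf_sum_compose) (simp_all add: kz_partial_nth_below)
  also have "(\<lambda>k. kz_partial 0 k oo fps_ln 1) = (\<lambda>k. \<Prod>i=1..k. 1 - inverse ((1 + fps_X) ^ i))"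
    by (simp add: kz_partial_def fps_compose_prod_distrib fps_compose_sub_distrib fps_exp_compose_ln
        fps_binomial_minus_of_nat)
  finally have "real (num_rigid_interval_orders n) = (kz_tail 0 oo fps_ln 1) $ n"
    by (simp add: rigid_interval_orders_gf)
  also have "kz_tail 0 oo fps_ln 1 = fps_binomial (1 / 24) * (Abs_fps kz_coeff oo fps_ln 1)"
    by (simp add: kz_tail_0 fps_compose_mult_distrib fps_exp_compose_ln)
  also have "\<dots> $ n = (\<Sum>k\<le>n. kz_coeff k * (fps_binomial (1 / 24) * fps_ln 1 ^ k) $ n)"
    by (subst fps_mult_compose_nth) auto
  finally show ?thesis .
qed

section \<open>Asymptotics of the coefficients\<close>

definition sinhc :: "complex \<Rightarrow> complex" where
  "sinhc w = (if w = 0 then 1 else (exp w - exp (- w)) / (2 * w))"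

lemma sinhc_holomorphic: "sinhc holomorphic_on UNIV"
proof -
  define f where "f w = (exp w - exp (- w)) / 2" for w :: complex
  have hol: "f holomorphic_on UNIV" unfolding f_def by (intro holomorphic_intros) auto
  have "(f has_field_derivative 1) (at 0)"
    unfolding f_def by (auto intro!: derivative_eq_intros)
  hence "deriv f 0 = 1" by (rule DERIV_imp_deriv)
  hence "(\<lambda>z. if z = 0 then deriv f 0 else (f z - f 0) / (z - 0)) = sinhc"
    by (auto simp: sinhc_def f_def fun_eq_iff)
  thus ?thesis using pole_lemma_open[OF hol open_UNIV, of 0] by simp
qed

lemma mult_sinhc: "2 * w * sinhc w = exp w - exp (- w)"
  by (simp add: sinhc_def)

text \<open>A zero satisfies exp(2w) = 1, hence is an integer multiple of \<open>\<i>\<close> pi; it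
  is not 0, where the value is 1.\<close>

lemma sinhc_nonzero:
  assumes "norm w < pi" shows "sinhc w \<noteq> 0"
proof
  assume 0: "sinhc w = 0"
  hence w: "w \<noteq> 0" by (auto simp: sinhc_def)
  have "exp w = exp (- w)" using mult_sinhc[of w] 0 by simp
  hence "exp (2 * w) = 1" by (metis exp_minus_inverse exp_double power2_eq_square)
  then obtain n :: int where n: "Re (2 * w) = 0" "Im (2 * w) = of_int (2 * n) * pi"
    by (auto simp: exp_eq_1)
  hence im: "Re w = 0" "Im w = of_int n * pi" by auto
  hence "n \<noteq> 0" using w by (auto simp: complex_eq_iff)
  hence "\<bar>of_int n * pi\<bar> \<ge> pi" by (simp add: abs_mult)
  moreover have "\<bar>Im w\<bar> \<le> norm w" by (rule abs_Im_le_cmod)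
  ultimately show False using assms im by simp
qed

text \<open>Equals \<open>(z\<^sup>2 + (pi / 3)\<^sup>2) * sinh z / cosh (3 z / 2)\<close> with the singularities at \<open>\<plusminus> \<i> pi / 3\<close> removed:
  \<open>cosh (3 z / 2) = cosh (z / 2) * (2 * cosh z - 1)\<close>, and \<open>2 * cosh z - 1\<close> is the product of the two \<open>sinhc\<close>
  factors with \<open>z\<^sup>2 + (pi / 3)\<^sup>2\<close>.\<close>
definition moment_factor :: "complex \<Rightarrow> complex" where
  "moment_factor z = (exp (z / 2) - exp (- (z / 2))) /
     (sinhc ((z + \<i> * (pi / 3)) / 2) * sinhc ((z - \<i> * (pi / 3)) / 2))"

text \<open>Radius 2 contains the poles at distance pi/3 with room to spare and still keeps both
  shifted arguments in the disc where \<open>sinhc\<close> has no zero.\<close>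

lemma norm_half_shift_lt_pi:
  assumes "norm z < 2" "c = \<i> * (pi / 3) \<or> c = - (\<i> * (pi / 3))"
  shows "norm ((z + c) / 2) < pi"
proof -
  have "norm c = norm (\<i> * complex_of_real (pi / 3))" using assms(2) by (metis norm_minus_cancel)
  also have "\<dots> = pi / 3" by (simp add: norm_mult norm_divide)
  finally have "norm c = pi / 3" .
  hence "norm ((z + c) / 2) \<le> (norm z + pi / 3) / 2"
    using norm_triangle_ineq[of z c] by (simp add: norm_divide)
  also have "\<dots> < pi" using assms(1) pi_gt3 by simp
  finally show ?thesis .
qed

lemma sinhc_half_shift_nonzero:
  assumes "norm z < 2"
  shows "sinhc ((z + \<i> * (pi / 3)) / 2) \<noteq> 0" "sinhc ((z - \<i> * (pi / 3)) / 2) \<noteq> 0"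
  using sinhc_nonzero[OF norm_half_shift_lt_pi[OF assms, of "\<i> * (pi / 3)"]]
    sinhc_nonzero[OF norm_half_shift_lt_pi[OF assms, of "- (\<i> * (pi / 3))"]] by simp_all

lemma moment_factor_holomorphic: "moment_factor holomorphic_on ball 0 2"
proof -
  have comp: "(\<lambda>z. sinhc ((z + c) / 2)) holomorphic_on ball 0 2" for c
  proof -
    have "(\<lambda>z. (z + c) / 2) holomorphic_on ball 0 2" by (intro holomorphic_intros) auto
    hence "(sinhc \<circ> (\<lambda>z. (z + c) / 2)) holomorphic_on ball 0 2"
      using sinhc_holomorphic by (rule holomorphic_on_compose_gen) auto
    thus ?thesis by (simp add: comp_def)
  qed
  have "(\<lambda>z. (exp (z / 2) - exp (- (z / 2))) /
     (sinhc ((z + \<i> * (pi / 3)) / 2) * sinhc ((z + (- (\<i> * (pi / 3)))) / 2))) holomorphic_on ball 0 2"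
    using sinhc_half_shift_nonzero by (intro holomorphic_intros comp) auto
  thus ?thesis by (simp add: moment_factor_def[abs_def])
qed

lemma exp_third_pi: "exp (\<i> * (pi / 3)) + exp (- (\<i> * (pi / 3))) = 1"
proof -
  have "exp (\<i> * (pi / 3)) + exp (- (\<i> * (pi / 3))) = 2 * cos (complex_of_real (pi / 3))"
    by (simp add: cos_exp_eq)
  also have "cos (complex_of_real (pi / 3)) = complex_of_real (cos (pi / 3))"
    by (rule cos_of_real)
  finally show ?thesis by (simp add: cos_60)
qed

lemma moment_factor_mult:
  assumes "norm z < 2"
  shows "moment_factor z * (exp (3 / 2 * z) + exp (- (3 / 2) * z)) =
    (z\<^sup>2 + complex_of_real ((pi / 3)\<^sup>2)) * (exp z - exp (- z))"
proof -
  define a where "a = \<i> * complex_of_real (pi / 3)"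
  define s where "s = sinhc ((z + a) / 2) * sinhc ((z - a) / 2)"
  have s: "s \<noteq> 0" using sinhc_half_shift_nonzero[OF assms] by (simp add: s_def a_def)
  have "a\<^sup>2 = - (complex_of_real ((pi / 3)\<^sup>2))" by (simp add: a_def power_mult_distrib power_divide)
  hence "z\<^sup>2 + complex_of_real ((pi / 3)\<^sup>2) = z\<^sup>2 - a\<^sup>2" by simp
  also have "\<dots> = (z + a) * (z - a)" by (simp add: power2_eq_square algebra_simps)
  finally have "(z\<^sup>2 + complex_of_real ((pi / 3)\<^sup>2)) * s = (2 * ((z + a) / 2) * sinhc ((z + a) / 2)) * (2 * ((z - a) / 2) * sinhc ((z - a) / 2))"
    by (simp add: s_def mult_ac) (simp add: algebra_simps)
  also have "\<dots> = (exp ((z + a) / 2) - exp (- ((z + a) / 2))) * (exp ((z - a) / 2) - exp (- ((z - a) / 2)))"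
    unfolding mult_sinhc ..
  \<comment> \<open>The product is 2 cosh z - 2 cosh a, and 2 cosh a = 2 cos(pi/3) = 1.\<close>
  also have "\<dots> = exp z + exp (- z) - (exp a + exp (- a))"
  proof -
    have "(z + a) / 2 + (z - a) / 2 = z" "(z + a) / 2 + - ((z - a) / 2) = a" by (simp_all add: field_simps)
    moreover have "- ((z + a) / 2) + (z - a) / 2 = - a" "- ((z + a) / 2) + - ((z - a) / 2) = - z"
      by (simp_all add: field_simps)
    ultimately show ?thesis by (simp add: left_diff_distrib right_diff_distrib exp_add[symmetric])
  qed
  also have "exp a + exp (- a) = 1" using exp_third_pi by (simp add: a_def)
  finally have s_eq: "(z\<^sup>2 + complex_of_real ((pi / 3)\<^sup>2)) * s = exp z + exp (- z) - 1" .
  define u where "u = exp (z / 2)"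
  define v where "v = exp (- (z / 2))"
  have uv: "u * v = 1" by (simp add: u_def v_def exp_add[symmetric])
  have e: "exp z = u\<^sup>2" "exp (- z) = v\<^sup>2" "exp (3 / 2 * z) = u ^ 3" "exp (- (3 / 2) * z) = v ^ 3"
    unfolding u_def v_def exp_of_nat_mult[symmetric] by (simp_all add: field_simps)
  \<comment> \<open>Both sides are (u - v)(u + v)(u^2 + v^2 - 1), by the factorisation of a sum of
    cubes and \<open>u * v = 1\<close>.\<close>
  have "(u - v) * (u ^ 3 + v ^ 3) = (u\<^sup>2 + v\<^sup>2 - 1) * (u\<^sup>2 - v\<^sup>2)"
  proof -
    have "u ^ 3 + v ^ 3 = (u + v) * (u\<^sup>2 + v\<^sup>2 - u * v)" by algebra
    thus ?thesis unfolding uv by algebra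
  qed
  also have "\<dots> = (z\<^sup>2 + complex_of_real ((pi / 3)\<^sup>2)) * s * (u\<^sup>2 - v\<^sup>2)" by (simp only: s_eq e)
  finally have "(u - v) * (u ^ 3 + v ^ 3) / s = (z\<^sup>2 + complex_of_real ((pi / 3)\<^sup>2)) * (u\<^sup>2 - v\<^sup>2)"
    using s by (simp add: field_simps)
  moreover have "moment_factor z = (u - v) / s" by (simp add: moment_factor_def u_def v_def s_def a_def)
  ultimately show ?thesis unfolding e by simp
qed

text \<open>Up to normalisation this is the residue at the pole; it supplies the limit 2 / sqrt 3 of
  the normalised moments. The second \<open>sinhc\<close> has argument 0 here.\<close>

lemma moment_factor_third_pi: "moment_factor (\<i> * (pi / 3)) = \<i> * (pi / 3) * (2 / sqrt 3)"
proof -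
  define a where "a = \<i> * complex_of_real (pi / 3)"
  have sin: "exp (\<i> * complex_of_real x) - exp (- (\<i> * complex_of_real x)) = 2 * \<i> * complex_of_real (sin x)" for x
    by (simp add: sin_of_real[symmetric] sin_exp_eq)
  have "exp (a / 2) - exp (- (a / 2)) = \<i>"
    using sin[of "pi / 6"] by (simp add: a_def sin_30)
  moreover have "exp a - exp (- a) = \<i> * sqrt 3"
    using sin[of "pi / 3"] by (simp add: a_def sin_60)
  moreover have "a \<noteq> 0" by (simp add: a_def)
  moreover have "moment_factor a = (exp (a / 2) - exp (- (a / 2))) / (sinhc ((a + a) / 2) * sinhc ((a - a) / 2))"
    by (simp only: moment_factor_def a_def)
  ultimately have "moment_factor a = \<i> / (\<i> * sqrt 3 / (2 * a))"
    by (simp add: sinhc_def)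
  also have "\<dots> = a * (2 / sqrt 3)" by (simp add: field_simps)
  finally show ?thesis by (simp add: a_def)
qed

text \<open>The bridge between the formal series \<open>moment_fps\<close> and an analytic function:
  both sides agree after multiplication by the series of 2 cosh(3z/2), which is nonzero and can be
  cancelled.\<close>

lemma fps_expansion_moment_factor:
  "fps_expansion moment_factor 0 =
     (fps_X ^ 2 + fps_const ((pi / 3)\<^sup>2)) * Abs_fps (\<lambda>n. complex_of_real (moment_fps $ n))"
proof -
  let ?F = "fps_expansion moment_factor 0"
  let ?H = "Abs_fps (\<lambda>n. complex_of_real (moment_fps $ n))"
  let ?C = "fps_exp (3 / 2) + fps_exp (- (3 / 2)) :: complex fps"
  have F: "moment_factor has_fps_expansion ?F"
    by (rule has_fps_expansion_fps_expansion[OF _ _ moment_factor_holomorphic]) auto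
  have H: "?H * ?C = fps_exp 1 - fps_exp (- 1)"
  proof (rule fps_ext)
    fix n
    have "complex_of_real ((moment_fps * (fps_exp (3 / 2) + fps_exp (- (3 / 2)))) $ n) =
        complex_of_real ((fps_exp 1 - fps_exp (- 1)) $ n)"
      by (simp only: moment_fps_mult)
    thus "(?H * ?C) $ n = (fps_exp 1 - fps_exp (- 1)) $ n"
      by (simp add: fps_mult_nth)
  qed
  have "(\<lambda>z. moment_factor z * (exp (3 / 2 * z) + exp (- (3 / 2) * z))) has_fps_expansion (?F * ?C)"
    by (intro fps_expansion_intros F)
  moreover have ev: "eventually (\<lambda>z. moment_factor z * (exp (3 / 2 * z) + exp (- (3 / 2) * z)) =
      (z\<^sup>2 + complex_of_real ((pi / 3)\<^sup>2)) * (exp z - exp (- z))) (nhds 0)"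
  proof -
    have "eventually (\<lambda>z::complex. z \<in> ball 0 2) (nhds 0)"
      by (rule eventually_nhds_in_open) auto
    thus ?thesis by eventually_elim (rule moment_factor_mult, simp)
  qed
  ultimately have "(\<lambda>z. (z\<^sup>2 + complex_of_real ((pi / 3)\<^sup>2)) * (exp z - exp (- z))) has_fps_expansion (?F * ?C)"
    using has_fps_expansion_cong[OF ev refl, of "?F * ?C"] by blast
  moreover have "(\<lambda>z. (z\<^sup>2 + complex_of_real ((pi / 3)\<^sup>2)) * (exp z - exp (- z))) has_fps_expansion
      ((fps_X ^ 2 + fps_const (complex_of_real ((pi / 3)\<^sup>2))) * (fps_exp 1 - fps_exp (- 1)))"
    by (intro fps_expansion_intros)
  ultimately have "?F * ?C = (fps_X ^ 2 + fps_const (complex_of_real ((pi / 3)\<^sup>2))) * (?H * ?C)"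
    unfolding H by (rule fps_expansion_unique_complex)
  moreover have "?C \<noteq> 0"
  proof
    assume "?C = 0"
    hence "?C $ 0 = 0" by (simp only: fps_zero_nth)
    thus False by simp
  qed
  ultimately show ?thesis by (simp add: mult.assoc[symmetric])
qed

lemma geometric_sums_tail_bound:
  fixes f :: "nat \<Rightarrow> real"
  assumes "f sums S" "\<And>i. \<bar>f i\<bar> \<le> C * \<theta> ^ i" "0 \<le> \<theta>" "\<theta> < 1"
  shows "\<bar>(\<Sum>i<n. f i) - S\<bar> \<le> C / (1 - \<theta>) * \<theta> ^ n"
proof -
  have "(\<lambda>i. f (i + n)) sums (S - (\<Sum>i<n. f i))" by (rule sums_split_initial_segment[OF assms(1)])
  moreover have g: "(\<lambda>i. C * \<theta> ^ n * \<theta> ^ i) sums (C * \<theta> ^ n * (1 / (1 - \<theta>)))"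
    by (intro sums_mult geometric_sums) (use assms in auto)
  moreover have "norm (f (i + n)) \<le> C * \<theta> ^ n * \<theta> ^ i" for i
    using assms(2)[of "i + n"] by (simp add: power_add mult_ac)
  ultimately have "norm (S - (\<Sum>i<n. f i)) \<le> C * \<theta> ^ n * (1 / (1 - \<theta>))"
    using norm_suminf_le[of "\<lambda>i. f (i + n)" "\<lambda>i. C * \<theta> ^ n * \<theta> ^ i"]
    by (simp add: sums_iff)
  thus ?thesis by (simp add: abs_minus_commute mult_ac)
qed

text \<open>The factor z^2 + (pi/3)^2 makes the sum telescope: the normalised moment is exactly a
  partial sum of the series of \<open>moment_factor\<close> at \<open>\<i>\<close> pi/3, divided by
  that point. Its distance from the limit is the tail of a series that converges up to radius
  2.\<close>

lemma moment_fps_odd_asymptotics: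
  "\<exists>C. \<forall>n. \<bar>(-1) ^ n * (pi / 3) ^ (2 * n + 2) * moment_fps $ (2 * n + 1) - 2 / sqrt 3\<bar> \<le> C * (1 / 2) ^ n"
proof -
  define a where "a = pi / 3"
  have a: "a > 0" by (simp add: a_def)
  define k where "k j = ((if j = 0 then 0 else moment_fps $ (2 * j - 1)) + a\<^sup>2 * moment_fps $ (2 * j + 1))" for j
  let ?F = "fps_expansion moment_factor 0"
  have Fodd: "?F $ (2 * j + 1) = complex_of_real (k j)" for j
    unfolding fps_expansion_moment_factor
    by (simp add: distrib_right fps_X_power_mult_nth k_def a_def)
  have Feven: "?F $ n = 0" if "even n" for n
    unfolding fps_expansion_moment_factor
    using that by (simp add: distrib_right fps_X_power_mult_nth moment_fps_even_nth)
  have sums: "(\<lambda>n. ?F $ n * w ^ n) sums moment_factor w" if "norm w < 2" for w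
    using holomorphic_power_series[OF moment_factor_holomorphic, of w] that
    by (simp add: fps_expansion_def)
  have "(\<lambda>n. ?F $ n * (\<i> * a) ^ n) sums moment_factor (\<i> * a)"
    by (rule sums) (use pi_less_4 in \<open>simp add: a_def norm_mult\<close>)
  moreover have "?F $ n * (\<i> * a) ^ n = 0" if "n \<notin> range (\<lambda>j. 2 * j + 1)" for n
  proof -
    have "even n" using that by (metis oddE rangeI)
    thus ?thesis by (simp add: Feven)
  qed
  ultimately have "(\<lambda>j. ?F $ (2 * j + 1) * (\<i> * a) ^ (2 * j + 1)) sums moment_factor (\<i> * a)"
    by (subst sums_mono_reindex) (auto simp: strict_mono_def)
  also have "moment_factor (\<i> * a) = \<i> * a * complex_of_real (2 / sqrt 3)"
    using moment_factor_third_pi by (simp add: a_def)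
  also have "(\<lambda>j. ?F $ (2 * j + 1) * (\<i> * a) ^ (2 * j + 1)) =
      (\<lambda>j. \<i> * a * complex_of_real ((-1) ^ j * a ^ (2 * j) * k j))"
  proof -
    have "(\<i> ^ x)\<^sup>2 = (-1) ^ x" for x by (induction x) (simp_all add: power_mult_distrib)
    thus ?thesis unfolding Fodd by (simp add: fun_eq_iff power_add power_mult_distrib power_mult mult_ac)
  qed
  finally have "(\<lambda>j. complex_of_real ((-1) ^ j * a ^ (2 * j) * k j)) sums complex_of_real (2 / sqrt 3)"
    using a by (subst (asm) sums_mult_iff) auto
  hence S: "(\<lambda>j. (-1) ^ j * a ^ (2 * j) * k j) sums (2 / sqrt 3)"
    by (simp only: sums_of_real_iff)
  \<comment> \<open>3/2 lies below the radius 2, and (pi/3)/(3/2) is at most 7/10, whose square is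
    at most 1/2. This is the origin of the error ratio 1/2.\<close>
  have "summable (\<lambda>n. ?F $ n * (3 / 2) ^ n)"
    using sums[of "3 / 2"] by (simp add: sums_iff)
  hence "Bseq (\<lambda>n. ?F $ n * (3 / 2) ^ n)" by (intro convergent_imp_Bseq summable_imp_convergent)
  then obtain B where B: "norm (?F $ n * (3 / 2) ^ n) \<le> B" for n by (auto simp: Bseq_def)
  have bound: "\<bar>(-1) ^ j * a ^ (2 * j) * k j\<bar> \<le> B * (1 / 2) ^ j" for j
  proof -
    have "B \<ge> 0" using B[of 0] by (meson norm_ge_zero order_trans)
    have "\<bar>k j\<bar> * (3 / 2) ^ (2 * j + 1) \<le> B"
      using B[of "2 * j + 1"] unfolding Fodd by (simp add: norm_mult norm_power)
    hence "\<bar>k j\<bar> \<le> B * (2 / 3) ^ (2 * j + 1)" by (simp add: field_simps)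
    also have "\<dots> \<le> B * (2 / 3) ^ (2 * j)" using \<open>B \<ge> 0\<close> by (intro mult_left_mono) auto
    finally have "a ^ (2 * j) * \<bar>k j\<bar> \<le> a ^ (2 * j) * (B * (2 / 3) ^ (2 * j))"
      using a by (intro mult_left_mono) auto
    also have "\<dots> = B * ((a * (2 / 3))\<^sup>2) ^ j"
      by (simp only: power_mult[symmetric] power_mult_distrib mult_ac)
    also have "\<dots> \<le> B * (1 / 2) ^ j"
    proof -
      have "a * (2 / 3) \<le> 7 / 10" using pi_approx by (simp add: a_def)
      hence "(a * (2 / 3))\<^sup>2 \<le> (7 / 10)\<^sup>2" using a by (intro power_mono) auto
      also have "\<dots> \<le> 1 / 2" by (simp add: power2_eq_square)
      finally show ?thesis using \<open>B \<ge> 0\<close> by (intro mult_left_mono power_mono) auto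
    qed
    finally show ?thesis using a by (simp add: abs_mult power_abs)
  qed
  have partial: "(-1) ^ n * a ^ (2 * n + 2) * moment_fps $ (2 * n + 1) =
      (\<Sum>j<Suc n. (-1) ^ j * a ^ (2 * j) * k j)" for n
  proof (induction n)
    case (Suc n)
    have "(\<Sum>j<Suc (Suc n). (-1) ^ j * a ^ (2 * j) * k j) =
        (-1) ^ n * a ^ (2 * n + 2) * moment_fps $ (2 * n + 1) + (-1) ^ Suc n * a ^ (2 * Suc n) * k (Suc n)"
      by (simp only: Suc.IH sum.lessThan_Suc[of _ "Suc n"])
    also have "\<dots> = (-1) ^ Suc n * a ^ (2 * Suc n + 2) * moment_fps $ (2 * Suc n + 1)"
      by (simp add: k_def algebra_simps power2_eq_square)
    finally show ?case ..
  qed (simp add: k_def power2_eq_square)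
  have "\<bar>(-1) ^ n * a ^ (2 * n + 2) * moment_fps $ (2 * n + 1) - 2 / sqrt 3\<bar> \<le> B * (1 / 2) ^ n" for n
    using geometric_sums_tail_bound[OF S bound, of "Suc n"] unfolding partial by simp
  thus ?thesis unfolding a_def by blast
qed

text \<open>A case of the duplication formula. It converts the quotient of
  \<open>fact (2 * n + 1)\<close> by \<open>fact n\<close> in \<open>kz_coeff\<close> into
  \<open>Gamma (real n + 3 / 2)\<close> times a power of 4.\<close>

lemma fact_double_eq_Gamma: "fact (2 * n + 1) = fact n * 2 ^ (2 * n + 1) * Gamma (real n + 3 / 2) / sqrt pi"
proof (induction n)
  case 0
  have "Gamma (1 / 2 + 1 :: real) = 1 / 2 * Gamma (1 / 2)" by (rule Gamma_plus1) auto
  thus ?case by (simp add: Gamma_one_half_real add.commute)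
next
  case (Suc n)
  have "Gamma (real n + 3 / 2 + 1) = (real n + 3 / 2) * Gamma (real n + 3 / 2)"
    by (rule Gamma_plus1) (auto elim!: nonpos_Ints_cases)
  hence G: "Gamma (real (Suc n) + 3 / 2) = (real n + 3 / 2) * Gamma (real n + 3 / 2)"
    by (simp add: algebra_simps)
  have "fact (2 * Suc n + 1) = real (2 * n + 3) * (real (2 * n + 2) * fact (2 * n + 1))"
    by (simp add: algebra_simps)
  also have "\<dots> = fact (Suc n) * 2 ^ (2 * Suc n + 1) * Gamma (real (Suc n) + 3 / 2) / sqrt pi"
    unfolding Suc.IH G by (simp add: field_simps)
  finally show ?case .
qed

text \<open>Per step of \<open>n\<close> the factors 1/6, 4 and (3/pi)^2 multiply to 6/pi^2; the
  error ratio 1/2 of the moments halves this to 3/pi^2.\<close>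

theorem kz_coeff_asymptotics:
  "\<exists>C. \<forall>n. \<bar>kz_coeff n - 12 * sqrt 3 / pi powr (5 / 2) * Gamma (real n + 3 / 2) * (6 / pi\<^sup>2) ^ n\<bar>
     \<le> C * Gamma (real n + 3 / 2) * (3 / pi\<^sup>2) ^ n"
proof -
  obtain C where C: "\<bar>(-1) ^ n * (pi / 3) ^ (2 * n + 2) * moment_fps $ (2 * n + 1) - 2 / sqrt 3\<bar> \<le> C * (1 / 2) ^ n" for n
    using moment_fps_odd_asymptotics by blast
  define c where "c n = (-1) ^ n * (pi / 3) ^ (2 * n + 2) * moment_fps $ (2 * n + 1)" for n
  define K where "K = 18 / (sqrt pi * pi\<^sup>2)"
  have K: "K > 0" by (simp add: K_def)
  have sq: "sqrt pi * pi\<^sup>2 = pi powr (5 / 2)"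
  proof -
    have "pi powr (1 / 2 + 2) = pi powr (1 / 2) * pi powr 2" by (rule powr_add)
    thus ?thesis by (simp add: powr_half_sqrt powr_numeral)
  qed
  have eq: "kz_coeff n = K * Gamma (real n + 3 / 2) * (6 / pi\<^sup>2) ^ n * c n" for n
  proof -
    have "moment_fps $ (2 * n + 1) = (-1) ^ n * (3 / pi) ^ (2 * n + 2) * c n"
      by (simp add: c_def power_divide field_simps)
    hence "kz_coeff n = (- 1 / 6) ^ n * (2 ^ (2 * n + 1) * Gamma (real n + 3 / 2) / sqrt pi) *
        ((-1) ^ n * (3 / pi) ^ (2 * n + 2) * c n)"
      by (simp only: kz_coeff_def moment_def fact_double_eq_Gamma) (simp add: field_simps)
    also have "\<dots> = ((- 1 / 6) * 2\<^sup>2 * (-1) * (3 / pi)\<^sup>2) ^ n * (2 * (3 / pi)\<^sup>2 / sqrt pi) *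
        Gamma (real n + 3 / 2) * c n"
      by (simp only: power_mult_distrib power_add power_mult) (simp add: field_simps)
    also have "(- 1 / 6) * 2\<^sup>2 * (-1) * (3 / pi)\<^sup>2 = 6 / pi\<^sup>2" by (simp add: power_divide)
    also have "2 * (3 / pi)\<^sup>2 / sqrt pi = K" by (simp add: K_def power_divide)
    finally show ?thesis by (simp add: mult_ac)
  qed
  have K': "12 * sqrt 3 / pi powr (5 / 2) = K * (2 / sqrt 3)"
    unfolding K_def sq by (simp add: field_simps)
  have "\<bar>kz_coeff n - 12 * sqrt 3 / pi powr (5 / 2) * Gamma (real n + 3 / 2) * (6 / pi\<^sup>2) ^ n\<bar>
     \<le> (K * C) * Gamma (real n + 3 / 2) * (3 / pi\<^sup>2) ^ n" for n
  proof -
    have G: "Gamma (real n + 3 / 2) > 0" by (rule Gamma_real_pos) simp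
    have "kz_coeff n - 12 * sqrt 3 / pi powr (5 / 2) * Gamma (real n + 3 / 2) * (6 / pi\<^sup>2) ^ n =
        K * Gamma (real n + 3 / 2) * (6 / pi\<^sup>2) ^ n * (c n - 2 / sqrt 3)"
      unfolding eq K' by (simp add: algebra_simps)
    hence "\<bar>kz_coeff n - 12 * sqrt 3 / pi powr (5 / 2) * Gamma (real n + 3 / 2) * (6 / pi\<^sup>2) ^ n\<bar> =
        K * Gamma (real n + 3 / 2) * (6 / pi\<^sup>2) ^ n * \<bar>c n - 2 / sqrt 3\<bar>"
      using K G by (simp add: abs_mult)
    also have "\<dots> \<le> K * Gamma (real n + 3 / 2) * (6 / pi\<^sup>2) ^ n * (C * (1 / 2) ^ n)"
      using K G C[of n] unfolding c_def by (intro mult_left_mono) auto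
    also have "\<dots> = (K * C) * Gamma (real n + 3 / 2) * ((6 / pi\<^sup>2) * (1 / 2)) ^ n"
      unfolding power_mult_distrib by (simp only: mult_ac)
    finally show ?thesis by simp
  qed
  thus ?thesis by blast
qed

section \<open>Watson's lemma for a ratio of Gamma values\<close>

definition asymp_fps :: "('a \<Rightarrow> real) \<Rightarrow> 'a filter \<Rightarrow> ('a \<Rightarrow> real) \<Rightarrow> real fps \<Rightarrow> bool" where
  "asymp_fps z F f A \<longleftrightarrow>
     (\<forall>m. (\<lambda>x. f x - (\<Sum>i\<le>m. A $ i * z x ^ i)) \<in> O[F](\<lambda>x. z x ^ Suc m))"

lemma asymp_fpsD: "asymp_fps z F f A \<Longrightarrow> (\<lambda>x. f x - (\<Sum>i\<le>m. A $ i * z x ^ i)) \<in> O[F](\<lambda>x. z x ^ Suc m)"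
  by (simp only: asymp_fps_def)

lemma asymp_fps_cong:
  assumes "eventually (\<lambda>x. f x = g x) F" "asymp_fps z F f A"
  shows "asymp_fps z F g A"
  unfolding asymp_fps_def
proof
  fix m
  have "(\<lambda>x. g x - (\<Sum>i\<le>m. A $ i * z x ^ i)) \<in> O[F](\<lambda>x. z x ^ Suc m) \<longleftrightarrow>
      (\<lambda>x. f x - (\<Sum>i\<le>m. A $ i * z x ^ i)) \<in> O[F](\<lambda>x. z x ^ Suc m)"
    by (rule landau_o.big.in_cong) (use assms(1) in \<open>auto elim: eventually_mono\<close>)
  thus "(\<lambda>x. g x - (\<Sum>i\<le>m. A $ i * z x ^ i)) \<in> O[F](\<lambda>x. z x ^ Suc m)"
    using asymp_fpsD[OF assms(2)] by blast
qed

lemma asymp_fps_add: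
  assumes "asymp_fps z F f A" "asymp_fps z F g B"
  shows "asymp_fps z F (\<lambda>x. f x + g x) (A + B)"
  unfolding asymp_fps_def
proof
  fix m
  have "(\<lambda>x. (f x - (\<Sum>i\<le>m. A $ i * z x ^ i)) + (g x - (\<Sum>i\<le>m. B $ i * z x ^ i))) \<in> O[F](\<lambda>x. z x ^ Suc m)"
    by (intro sum_in_bigo asymp_fpsD assms)
  thus "(\<lambda>x. f x + g x - (\<Sum>i\<le>m. (A + B) $ i * z x ^ i)) \<in> O[F](\<lambda>x. z x ^ Suc m)"
    by (simp add: sum.distrib algebra_simps)
qed

lemma power_in_bigo_power:
  assumes "(z \<longlongrightarrow> (0::real)) F" "m \<le> n"
  shows "(\<lambda>x. z x ^ n) \<in> O[F](\<lambda>x. z x ^ m)"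
proof -
  have "z \<in> O[F](\<lambda>_. 1)" by (rule bigoI_tendsto[of _ _ 0]) (use assms in auto)
  hence "(\<lambda>x. z x ^ (n - m)) \<in> O[F](\<lambda>_. 1 ^ (n - m))" by (rule landau_o.big_power)
  hence "(\<lambda>x. z x ^ m * z x ^ (n - m)) \<in> O[F](\<lambda>x. z x ^ m * 1)"
    by (intro landau_o.big.mult landau_o.big_refl) simp_all
  thus ?thesis using assms(2) by (simp add: power_add[symmetric])
qed

lemma asymp_fps_monom_0: "asymp_fps z F (\<lambda>_. c) (fps_const c)"
  by (simp add: asymp_fps_def if_distrib[of "\<lambda>c. c * _"] cong: if_cong)

lemma asymp_fps_poly_bound:
  assumes "(z \<longlongrightarrow> 0) F" "asymp_fps z F f A"
  shows "f \<in> O[F](\<lambda>_. 1)"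
proof -
  have "(\<lambda>x. f x - A $ 0) \<in> O[F](\<lambda>x. z x ^ 1)" using asymp_fpsD[OF assms(2), of 0] by simp
  hence "(\<lambda>x. f x - A $ 0) \<in> O[F](\<lambda>x. z x ^ 0)"
    by (rule landau_o.big_trans) (rule power_in_bigo_power[OF assms(1)], simp)
  hence "(\<lambda>x. (f x - A $ 0) + A $ 0) \<in> O[F](\<lambda>_. 1)" by (intro sum_in_bigo(1)) simp_all
  thus ?thesis by simp
qed

text \<open>The error is (f - P) g + P (g - Q) plus the terms of P Q of degree above
  \<open>m\<close>, where P and Q are the truncations; \<open>g\<close> and P are bounded as the
  gauge tends to 0.\<close>

lemma asymp_fps_mult:
  assumes z: "(z \<longlongrightarrow> 0) F" and f: "asymp_fps z F f A" and g: "asymp_fps z F g B"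
  shows "asymp_fps z F (\<lambda>x. f x * g x) (A * B)"
  unfolding asymp_fps_def
proof
  fix m
  define P where "P x = (\<Sum>i\<le>m. A $ i * z x ^ i)" for x
  define Q where "Q x = (\<Sum>i\<le>m. B $ i * z x ^ i)" for x
  let ?D = "{(i, j). i + j \<le> m}"
  let ?t = "\<lambda>x (i, j). A $ i * B $ j * z x ^ (i + j)"
  have P: "P \<in> O[F](\<lambda>_. 1)" unfolding P_def[abs_def]
  proof (rule big_sum_in_bigo)
    fix i show "(\<lambda>x. A $ i * z x ^ i) \<in> O[F](\<lambda>_. 1)"
      using power_in_bigo_power[OF z, of 0 i] by (cases "A $ i = 0") auto
  qed
  have "(\<lambda>x. (f x - P x) * g x) \<in> O[F](\<lambda>x. z x ^ Suc m * 1)"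
    unfolding P_def by (intro landau_o.big.mult asymp_fpsD[OF f] asymp_fps_poly_bound[OF z g])
  hence 1: "(\<lambda>x. (f x - P x) * g x) \<in> O[F](\<lambda>x. z x ^ Suc m)" by (simp only: mult_1_right)
  have "(\<lambda>x. P x * (g x - Q x)) \<in> O[F](\<lambda>x. 1 * z x ^ Suc m)"
    unfolding Q_def by (intro landau_o.big.mult asymp_fpsD[OF g] P)
  hence 2: "(\<lambda>x. P x * (g x - Q x)) \<in> O[F](\<lambda>x. z x ^ Suc m)" by (simp only: mult_1_left)
  have fin: "finite ({..m} \<times> {..m})" by simp
  have PQ: "P x * Q x = (\<Sum>p\<in>{..m} \<times> {..m}. ?t x p)" for x
    unfolding P_def Q_def sum_product sum.cartesian_product
    by (intro sum.cong) (auto simp: power_add)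
  have AB: "(\<Sum>k\<le>m. (A * B) $ k * z x ^ k) = (\<Sum>p\<in>?D. ?t x p)" for x
  proof -
    have "(\<Sum>p\<in>?D. ?t x p) = (\<Sum>k\<le>m. \<Sum>i\<le>k. A $ i * B $ (k - i) * z x ^ (i + (k - i)))"
      by (rule sum.triangle_reindex_eq)
    thus ?thesis by (simp add: fps_mult_nth sum_distrib_right atMost_atLeast0)
  qed
  have "(\<Sum>p\<in>{..m} \<times> {..m}. ?t x p) = (\<Sum>p\<in>{..m} \<times> {..m} - ?D. ?t x p) + (\<Sum>p\<in>?D. ?t x p)" for x
    by (rule sum.subset_diff[OF _ fin]) auto
  hence diff: "P x * Q x - (\<Sum>k\<le>m. (A * B) $ k * z x ^ k) = (\<Sum>p\<in>{..m} \<times> {..m} - ?D. ?t x p)" for x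
    by (simp add: PQ AB)
  have 3: "(\<lambda>x. P x * Q x - (\<Sum>k\<le>m. (A * B) $ k * z x ^ k)) \<in> O[F](\<lambda>x. z x ^ Suc m)"
    unfolding diff
  proof (rule big_sum_in_bigo)
    fix p assume "p \<in> {..m} \<times> {..m} - ?D"
    then obtain i j where p: "p = (i, j)" "Suc m \<le> i + j" by fastforce
    have "(\<lambda>x. (A $ i * B $ j) * z x ^ (i + j)) \<in> O[F](\<lambda>x. z x ^ Suc m)"
      using power_in_bigo_power[OF z p(2)] by (cases "A $ i * B $ j = 0") auto
    thus "(\<lambda>x. ?t x p) \<in> O[F](\<lambda>x. z x ^ Suc m)" by (simp add: p)
  qed
  have "(\<lambda>x. (f x - P x) * g x + P x * (g x - Q x) +
      (P x * Q x - (\<Sum>k\<le>m. (A * B) $ k * z x ^ k))) \<in> O[F](\<lambda>x. z x ^ Suc m)"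
    by (rule sum_in_bigo(1)[OF sum_in_bigo(1)[OF 1 2] 3])
  thus "(\<lambda>x. f x * g x - (\<Sum>k\<le>m. (A * B) $ k * z x ^ k)) \<in> O[F](\<lambda>x. z x ^ Suc m)"
    by (simp add: algebra_simps)
qed

lemma asymp_fps_cmult:
  assumes "(z \<longlongrightarrow> 0) F" "asymp_fps z F f A"
  shows "asymp_fps z F (\<lambda>x. c * f x) (fps_const c * A)"
  by (intro asymp_fps_mult assms asymp_fps_monom_0)

lemma asymp_fps_sum:
  assumes "\<And>k. k \<in> S \<Longrightarrow> asymp_fps z F (f k) (A k)"
  shows "asymp_fps z F (\<lambda>x. \<Sum>k\<in>S. f k x) (\<Sum>k\<in>S. A k)"
  using assms asymp_fps_monom_0[of z F 0]
  by (induction S rule: infinite_finite_induct) (auto intro: asymp_fps_add)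

lemma asymp_fps_prod:
  assumes "(z \<longlongrightarrow> 0) F" "\<And>k. k \<in> S \<Longrightarrow> asymp_fps z F (f k) (A k)"
  shows "asymp_fps z F (\<lambda>x. \<Prod>k\<in>S. f k x) (\<Prod>k\<in>S. A k)"
  using assms(2) asymp_fps_monom_0[of z F 1]
  by (induction S rule: infinite_finite_induct) (auto intro: asymp_fps_mult[OF assms(1)])

lemma asymp_fps_power:
  assumes "(z \<longlongrightarrow> 0) F" "asymp_fps z F f A"
  shows "asymp_fps z F (\<lambda>x. f x ^ k) (A ^ k)"
  using asymp_fps_prod[OF assms(1), of "{..<k}" "\<lambda>_. f" "\<lambda>_. A"] assms(2) by simp

lemma asymp_fps_X: "asymp_fps z F z fps_X"
  unfolding asymp_fps_def
proof
  fix m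
  have "(\<Sum>i\<le>m. fps_X $ i * z x ^ i) = (if m = 0 then 0 else z x)" for x
    by (simp add: fps_X_def if_distrib[of "\<lambda>c. c * _"] cong: if_cong)
  thus "(\<lambda>x. z x - (\<Sum>i\<le>m. fps_X $ i * z x ^ i)) \<in> O[F](\<lambda>x. z x ^ Suc m)"
    by (cases "m = 0") simp_all
qed

text \<open>The inner function \<open>f\<close> itself is the gauge for \<open>\<phi>\<close>. As
  \<open>H\<close> has no constant term, \<open>f\<close> is of the order of \<open>z\<close>, so
  errors in powers of \<open>f\<close> are errors in the same powers of \<open>z\<close>.\<close>

lemma asymp_fps_compose:
  assumes z: "(z \<longlongrightarrow> 0) F" and f: "asymp_fps z F f H" "H $ 0 = 0"
    and \<phi>: "asymp_fps f F \<phi> G"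
  shows "asymp_fps z F \<phi> (G oo H)"
  unfolding asymp_fps_def
proof
  fix m
  have "(\<lambda>x. f x - (\<Sum>i\<le>0. H $ i * z x ^ i)) \<in> O[F](\<lambda>x. z x ^ Suc 0)" by (rule asymp_fpsD[OF f(1)])
  hence "f \<in> O[F](z)" using f(2) by simp
  hence "(\<lambda>x. f x ^ Suc m) \<in> O[F](\<lambda>x. z x ^ Suc m)" by (rule landau_o.big_power)
  with asymp_fpsD[OF \<phi>]
  have 1: "(\<lambda>x. \<phi> x - (\<Sum>i\<le>m. G $ i * f x ^ i)) \<in> O[F](\<lambda>x. z x ^ Suc m)"
    by (rule landau_o.big_trans)
  have "asymp_fps z F (\<lambda>x. \<Sum>i\<le>m. G $ i * f x ^ i) (\<Sum>i\<le>m. fps_const (G $ i) * H ^ i)"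
    by (intro asymp_fps_sum asymp_fps_cmult asymp_fps_power z f(1))
  from asymp_fpsD[OF this, of m]
  have 2: "(\<lambda>x. (\<Sum>i\<le>m. G $ i * f x ^ i) - (\<Sum>j\<le>m. (\<Sum>i\<le>m. fps_const (G $ i) * H ^ i) $ j * z x ^ j))
      \<in> O[F](\<lambda>x. z x ^ Suc m)" .
  have "(\<Sum>i\<le>m. fps_const (G $ i) * H ^ i) $ j = (G oo H) $ j" if "j \<le> m" for j
    unfolding fps_compose_nth fps_sum_nth fps_mult_left_const_nth atLeast0AtMost
    by (rule sum.mono_neutral_right) (use that startsby_zero_power_prefix[OF f(2)] in auto)
  hence "(\<Sum>j\<le>m. (\<Sum>i\<le>m. fps_const (G $ i) * H ^ i) $ j * z x ^ j) = (\<Sum>j\<le>m. (G oo H) $ j * z x ^ j)" for x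
    by (intro sum.cong refl) simp
  with sum_in_bigo(1)[OF 1 2]
  show "(\<lambda>x. \<phi> x - (\<Sum>j\<le>m. (G oo H) $ j * z x ^ j)) \<in> O[F](\<lambda>x. z x ^ Suc m)" by simp
qed

lemma asymp_fps_sums:
  assumes z: "(z \<longlongrightarrow> 0) F" and r: "r > 0"
    and sums: "\<And>u. \<bar>u\<bar> < r \<Longrightarrow> (\<lambda>n. A $ n * u ^ n) sums f u"
  shows "asymp_fps z F (\<lambda>x. f (z x)) A"
  unfolding asymp_fps_def
proof
  fix m
  \<comment> \<open>Convergence at \<open>r / 2\<close> gives absolute convergence at
    \<open>r / 3\<close>, and with it one constant for all remainders in that smaller disc.\<close>
  have "summable (\<lambda>n. A $ n * (r / 2) ^ n)" using sums[of "r / 2"] r by (simp add: sums_iff)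
  hence "summable (\<lambda>n. norm (A $ n * (r / 3) ^ n))" by (rule powser_insidea) (use r in simp)
  hence S: "summable (\<lambda>n. norm (A $ (n + Suc m) * (r / 3) ^ (n + Suc m)))"
    by (rule summable_ignore_initial_segment)
  define C where "C = (\<Sum>n. norm (A $ (n + Suc m) * (r / 3) ^ (n + Suc m))) / (r / 3) ^ Suc m"
  have bound: "norm (f u - (\<Sum>i\<le>m. A $ i * u ^ i)) \<le> C * norm (u ^ Suc m)" if u: "\<bar>u\<bar> < r / 3" for u
  proof -
    define q where "q = \<bar>u\<bar> / (r / 3)"
    have q: "0 \<le> q" "q \<le> 1" "\<bar>u\<bar> = q * (r / 3)" using u r by (auto simp: q_def)
    have "(\<lambda>n. A $ (n + Suc m) * u ^ (n + Suc m)) sums (f u - (\<Sum>i<Suc m. A $ i * u ^ i))"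
      by (rule sums_split_initial_segment[OF sums]) (use u r in simp)
    moreover have "norm (A $ (n + Suc m) * u ^ (n + Suc m)) \<le>
        norm (A $ (n + Suc m) * (r / 3) ^ (n + Suc m)) * q ^ Suc m" for n
    proof -
      have "norm (A $ (n + Suc m) * u ^ (n + Suc m)) = \<bar>A $ (n + Suc m)\<bar> * (r / 3) ^ (n + Suc m) * q ^ (n + Suc m)"
        by (simp only: real_norm_def abs_mult power_abs q(3) power_mult_distrib mult_ac)
      also have "\<dots> \<le> \<bar>A $ (n + Suc m)\<bar> * (r / 3) ^ (n + Suc m) * q ^ Suc m"
        using q r by (intro mult_left_mono power_decreasing) auto
      finally show ?thesis using r by (simp add: abs_mult power_abs)
    qed
    ultimately have "norm (f u - (\<Sum>i<Suc m. A $ i * u ^ i)) \<le>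
        (\<Sum>n. norm (A $ (n + Suc m) * (r / 3) ^ (n + Suc m)) * q ^ Suc m)"
      using norm_suminf_le[of "\<lambda>n. A $ (n + Suc m) * u ^ (n + Suc m)"] summable_mult2[OF S, of "q ^ Suc m"]
      by (simp only: sums_iff)
    also have "\<dots> = (\<Sum>n. norm (A $ (n + Suc m) * (r / 3) ^ (n + Suc m))) * q ^ Suc m"
      by (rule suminf_mult2[OF S, symmetric])
    also have "\<dots> = C * (q * (r / 3)) ^ Suc m"
      using r by (simp only: C_def power_mult_distrib) simp
    also have "(q * (r / 3)) ^ Suc m = norm (u ^ Suc m)"
      by (simp only: real_norm_def power_abs q(3))
    finally show ?thesis by (simp only: lessThan_Suc_atMost)
  qed
  have "eventually (\<lambda>x. \<bar>z x\<bar> < r / 3) F"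
    using order_tendstoD(2)[OF tendsto_rabs[OF z], of "r / 3"] r by simp
  hence "eventually (\<lambda>x. norm (f (z x) - (\<Sum>i\<le>m. A $ i * z x ^ i)) \<le> C * norm (z x ^ Suc m)) F"
    by eventually_elim (rule bound)
  thus "(\<lambda>x. f (z x) - (\<Sum>i\<le>m. A $ i * z x ^ i)) \<in> O[F](\<lambda>x. z x ^ Suc m)" by (rule bigoI)
qed


section \<open>Laplace and Beta integrals\<close>

lemma has_integral_change_of_variables_nonneg:
  fixes f g h :: "real \<Rightarrow> real"
  assumes "S \<in> sets lebesgue" "\<And>x. x \<in> S \<Longrightarrow> (g has_field_derivative h x) (at x within S)"
    "inj_on g S" "\<And>x. x \<in> g ` S \<Longrightarrow> f x \<ge> 0" "(f has_integral b) (g ` S)"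
  shows "((\<lambda>x. \<bar>h x\<bar> * f (g x)) has_integral b) S"
proof -
  \<comment> \<open>The change of variables theorem is about absolute integrability, which
    nonnegativity supplies.\<close>
  have "f absolutely_integrable_on g ` S"
    by (rule nonnegative_absolutely_integrable_1) (use assms in auto)
  moreover have "integral (g ` S) f = b" using assms(5) by (rule integral_unique)
  ultimately have "(\<lambda>x. \<bar>h x\<bar> * f (g x)) absolutely_integrable_on S \<and>
      integral S (\<lambda>x. \<bar>h x\<bar> * f (g x)) = b"
    using has_absolute_integral_change_of_variables_1'[OF assms(1-3), of f b] by blast
  thus ?thesis using set_lebesgue_integral_eq_integral(1) by (auto simp: has_integral_iff)
qed

lemma has_integral_powr_exp:
  fixes N p :: real
  assumes "N > 0" "p > 0"
  shows "((\<lambda>u. u powr (p - 1) * exp (- (N * u))) has_integral Gamma p / N powr p) {0<..}"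
proof -
  have img: "(\<lambda>u. N * u) ` {0<..} = {0<..}"
    using assms(1) by (auto simp: image_iff intro!: bexI[of _ "_ / N"])
  have "((\<lambda>t. t powr (p - 1) / exp t) has_integral Gamma p) {0..}"
    by (rule Gamma_integral_real[OF assms(2)])
  moreover have "((\<lambda>t. t powr (p - 1) / exp t) has_integral Gamma p) {0..} \<longleftrightarrow>
      ((\<lambda>t. t powr (p - 1) / exp t) has_integral Gamma p) {0<..}"
    by (rule has_integral_spike_set_eq; rule negligible_subset[of "{0}"]) auto
  ultimately have "((\<lambda>t. t powr (p - 1) / exp t) has_integral Gamma p) {0<..}" by simp
  hence "((\<lambda>u. \<bar>N\<bar> * ((N * u) powr (p - 1) / exp (N * u))) has_integral Gamma p) {0<..}"
    by (intro has_integral_change_of_variables_nonneg[where f = "\<lambda>t. t powr (p - 1) / exp t" and g = "\<lambda>u. N * u"])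
       (use assms img in \<open>auto intro!: derivative_eq_intros inj_onI\<close>)
  hence "((\<lambda>u. (\<bar>N\<bar> * ((N * u) powr (p - 1) / exp (N * u))) / N powr p) has_integral Gamma p / N powr p) {0<..}"
    by (rule has_integral_divide)
  note int = this
  have "(\<bar>N\<bar> * ((N * u) powr (p - 1) / exp (N * u))) / N powr p = u powr (p - 1) * exp (- (N * u))"
    if "u \<in> {0<..}" for u
    using assms that by (simp add: powr_mult powr_diff exp_minus field_simps)
  thus ?thesis by (rule has_integral_eq[OF _ int])
qed

text \<open>The substitution t = exp(-u) turns the Beta integral into a Laplace integral in
  \<open>N\<close>, whose other factor is free of \<open>N\<close> and can be expanded at u =
  0.\<close>

lemma has_integral_exp_powr:
  fixes N :: real
  assumes "N > 0"
  shows "((\<lambda>u. exp (- (N * u)) * (exp u - 1) powr (- 1 / 2)) has_integral Beta (N + 1 / 2) (1 / 2)) {0<..}"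
proof -
  have img: "(\<lambda>u. exp (- u)) ` {0<..} = {0<..<1::real}"
  proof (intro equalityI subsetI)
    fix t :: real assume "t \<in> {0<..<1}"
    thus "t \<in> (\<lambda>u. exp (- u)) ` {0<..}" by (intro image_eqI[of _ _ "- ln t"]) auto
  qed auto
  have "((\<lambda>t. t powr (N + 1 / 2 - 1) * (1 - t) powr (1 / 2 - 1)) has_integral Beta (N + 1 / 2) (1 / 2)) {0..1}"
    by (rule has_integral_Beta_real) (use assms in auto)
  hence "((\<lambda>t. t powr (N + 1 / 2 - 1) * (1 - t) powr (1 / 2 - 1)) has_integral Beta (N + 1 / 2) (1 / 2)) {0<..<1}"
    by (simp add: has_integral_Icc_iff_Ioo)
  hence "((\<lambda>u. \<bar>- exp (- u)\<bar> * (exp (- u) powr (N + 1 / 2 - 1) * (1 - exp (- u)) powr (1 / 2 - 1)))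
      has_integral Beta (N + 1 / 2) (1 / 2)) {0<..}"
    by (intro has_integral_change_of_variables_nonneg[where g = "\<lambda>u. exp (- u)" and
          f = "\<lambda>t. t powr (N + 1 / 2 - 1) * (1 - t) powr (1 / 2 - 1)"])
       (use img in \<open>auto intro!: derivative_eq_intros inj_onI\<close>)
  note int = this
  have "\<bar>- exp (- u)\<bar> * (exp (- u) powr (N + 1 / 2 - 1) * (1 - exp (- u)) powr (1 / 2 - 1)) =
      exp (- (N * u)) * (exp u - 1) powr (- 1 / 2)" if "u \<in> {0<..}" for u
  proof -
    have "1 - exp (- u) = exp (- u) * (exp u - 1)" by (simp add: algebra_simps exp_add[symmetric])
    hence "(1 - exp (- u)) powr (1 / 2 - 1) = exp (- u) powr (- 1 / 2) * (exp u - 1) powr (- 1 / 2)"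
      using that by (simp add: powr_mult)
    moreover have "exp (- u) * (exp (- u) powr (N + 1 / 2 - 1) * exp (- u) powr (- 1 / 2)) = exp (- (N * u))"
      by (simp add: powr_def exp_add[symmetric] algebra_simps)
    ultimately show ?thesis by (simp only: abs_minus_cancel abs_exp_cancel mult.assoc[symmetric])
  qed
  thus ?thesis by (rule has_integral_eq[OF _ int])
qed

text \<open>The series of (exp u - 1)/u - 1; without constant term it can be substituted into the
  binomial series.\<close>

definition expm1_fps :: "real fps" where
  "expm1_fps = Abs_fps (\<lambda>n. if n = 0 then 0 else 1 / fact (Suc n))"

definition watson_fps :: "real fps" where
  "watson_fps = fps_binomial (- 1 / 2) oo expm1_fps"

lemma asymp_fps_expm1:
  "asymp_fps (\<lambda>u. u) (at_right 0) (\<lambda>u. ((exp u - 1) / u) powr (- 1 / 2)) watson_fps"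
  unfolding watson_fps_def
proof (rule asymp_fps_compose)
  define E where "E u = (if u = 0 then 0 else (exp u - 1) / u - 1)" for u :: real
  have sums: "(\<lambda>n. expm1_fps $ n * u ^ n) sums E u" for u
  proof (cases "u = 0")
    case True
    have "(\<lambda>n. expm1_fps $ n * u ^ n) = (\<lambda>_. 0)"
      using True by (auto simp: fun_eq_iff expm1_fps_def power_0_left)
    thus ?thesis using True by (simp add: E_def)
  next
    case False
    have "(\<lambda>n. u ^ n / fact n) sums exp u"
      using exp_converges[of u] by (simp add: divide_inverse mult.commute)
    from sums_split_initial_segment[OF this, of 1]
    have "(\<lambda>n. u ^ Suc n / fact (Suc n)) sums (exp u - 1)" by simp
    hence "(\<lambda>n. u ^ Suc n / fact (Suc n) / u) sums ((exp u - 1) / u)" by (rule sums_divide)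
    hence "(\<lambda>n. u ^ n / fact (Suc n)) sums ((exp u - 1) / u)" using False by simp
    from sums_diff[OF this sums_single[of 0 "\<lambda>_. 1"]]
    have "(\<lambda>n. u ^ n / fact (Suc n) - (if n = 0 then 1 else 0)) sums E u" using False by (simp add: E_def)
    moreover have "u ^ n / fact (Suc n) - (if n = 0 then 1 else 0) = expm1_fps $ n * u ^ n" for n
      by (simp add: expm1_fps_def)
    ultimately show ?thesis by simp
  qed
  show id: "((\<lambda>u::real. u) \<longlongrightarrow> 0) (at_right 0)" by (rule tendsto_ident_at)
  show E: "asymp_fps (\<lambda>u. u) (at_right 0) E expm1_fps"
    by (rule asymp_fps_sums[OF id zero_less_one sums])
  have "E \<in> O[at_right 0](\<lambda>u. u)"
    using asymp_fpsD[OF E, of 0] by (simp add: expm1_fps_def)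
  then obtain c where c: "eventually (\<lambda>u. norm (E u) \<le> c * norm u) (at_right 0)"
    by (auto elim: landau_o.bigE)
  have E0: "(E \<longlongrightarrow> 0) (at_right 0)"
    by (rule Lim_null_comparison[OF c]) (rule tendsto_mult_right_zero[OF tendsto_norm_zero[OF id]])
  show "expm1_fps $ 0 = 0" by (simp add: expm1_fps_def)
  have "asymp_fps E (at_right 0) (\<lambda>u. (1 + E u) powr (- 1 / 2)) (fps_binomial (- 1 / 2))"
    by (rule asymp_fps_sums[OF E0 zero_less_one]) (use gen_binomial_real in simp)
  thus "asymp_fps E (at_right 0) (\<lambda>u. ((exp u - 1) / u) powr (- 1 / 2)) (fps_binomial (- 1 / 2))"
    by (rule asymp_fps_cong[rotated]) (auto simp: E_def eventually_at_right_less intro!: eventually_at_rightI[of 0 1])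
qed

text \<open>Integration over the half-line needs the bound for all positive \<open>u\<close>. Near 0
  it is the asymptotic expansion; from \<open>d\<close> on, the function is at most 1 and every
  monomial of the truncation is dominated by a multiple of \<open>u ^ Suc m\<close>.\<close>

lemma watson_remainder_bound:
  "\<exists>C. \<forall>u>0. \<bar>((exp u - 1) / u) powr (- 1 / 2) - (\<Sum>j\<le>m. watson_fps $ j * u ^ j)\<bar> \<le> C * u ^ Suc m"
proof -
  define g where "g u = ((exp u - 1) / u) powr (- 1 / 2)" for u :: real
  define R where "R u = g u - (\<Sum>j\<le>m. watson_fps $ j * u ^ j)" for u
  have "R \<in> O[at_right 0](\<lambda>u. u ^ Suc m)"
    unfolding R_def[abs_def] g_def by (rule asymp_fpsD[OF asymp_fps_expm1])
  then obtain c where "eventually (\<lambda>u. norm (R u) \<le> c * norm (u ^ Suc m)) (at_right 0)"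
    by (auto elim: landau_o.bigE)
  then obtain d where d: "d > 0" "\<And>u. 0 < u \<Longrightarrow> u < d \<Longrightarrow> norm (R u) \<le> c * norm (u ^ Suc m)"
    unfolding eventually_at_right_field by auto
  define C where "C = 1 / d ^ Suc m + (\<Sum>j\<le>m. \<bar>watson_fps $ j\<bar> / d ^ (Suc m - j))"
  have "\<bar>R u\<bar> \<le> max c C * u ^ Suc m" if u: "u > 0" for u
  proof (cases "u < d")
    case True
    have "\<bar>R u\<bar> \<le> c * u ^ Suc m" using d(2)[OF u True] u by simp
    also have "\<dots> \<le> max c C * u ^ Suc m" using u by (intro mult_right_mono) auto
    finally show ?thesis .
  next
    case False
    have ud: "1 \<le> u / d" using False d(1) by simp
    have "exp u \<ge> 1 + u" by (rule exp_ge_add_one_self)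
    hence "g u \<le> 1" unfolding g_def using u powr_mono2'[of "-1 / 2" 1 "(exp u - 1) / u"] by (simp add: field_simps)
    also have "1 \<le> (u / d) ^ Suc m" using ud by (rule one_le_power)
    finally have 1: "\<bar>g u\<bar> \<le> 1 / d ^ Suc m * u ^ Suc m"
      by (simp add: g_def power_divide)
    have 2: "\<bar>watson_fps $ j * u ^ j\<bar> \<le> \<bar>watson_fps $ j\<bar> / d ^ (Suc m - j) * u ^ Suc m" if "j \<le> m" for j
    proof -
      have "u ^ j * 1 \<le> u ^ j * (u / d) ^ (Suc m - j)"
        using ud u by (intro mult_left_mono one_le_power) auto
      also have "\<dots> = u ^ Suc m / d ^ (Suc m - j)"
        using that by (simp add: power_divide power_add[symmetric])
      finally show ?thesis using u mult_left_mono[of "u ^ j" "u ^ Suc m / d ^ (Suc m - j)" "\<bar>watson_fps $ j\<bar>"]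
        by (simp add: abs_mult power_abs)
    qed
    have "\<bar>R u\<bar> \<le> \<bar>g u\<bar> + (\<Sum>j\<le>m. \<bar>watson_fps $ j * u ^ j\<bar>)"
      unfolding R_def by (intro order.trans[OF abs_triangle_ineq4] add_left_mono sum_abs)
    also have "\<dots> \<le> 1 / d ^ Suc m * u ^ Suc m + (\<Sum>j\<le>m. \<bar>watson_fps $ j\<bar> / d ^ (Suc m - j) * u ^ Suc m)"
      by (intro add_mono 1 sum_mono 2) auto
    also have "\<dots> = C * u ^ Suc m" by (simp add: C_def sum_distrib_right distrib_right)
    also have "\<dots> \<le> max c C * u ^ Suc m" using u by (intro mult_right_mono) auto
    finally show ?thesis .
  qed
  thus ?thesis unfolding R_def g_def by blast
qed

definition watson_sum :: "nat \<Rightarrow> real \<Rightarrow> real" where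
  "watson_sum m N = (\<Sum>j\<le>m. watson_fps $ j * (Gamma (real j + 1 / 2) / N powr (real j + 1 / 2)))"

text \<open>The remainder bound is integrated against exp(-Nu) u^(-1/2); each power of
  \<open>u\<close> becomes a Gamma value over a power of \<open>N\<close>.\<close>

lemma Beta_half_expansion:
  "\<exists>C. \<forall>N>0. \<bar>Beta (N + 1 / 2) (1 / 2) - watson_sum m N\<bar>
     \<le> C * (Gamma (real m + 3 / 2) / N powr (real m + 3 / 2))"
proof -
  obtain C where C: "\<And>u. u > 0 \<Longrightarrow> \<bar>((exp u - 1) / u) powr (- 1 / 2) - (\<Sum>j\<le>m. watson_fps $ j * u ^ j)\<bar> \<le> C * u ^ Suc m"
    using watson_remainder_bound by blast
  have "\<bar>Beta (N + 1 / 2) (1 / 2) - watson_sum m N\<bar>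
     \<le> C * (Gamma (real m + 3 / 2) / N powr (real m + 3 / 2))" (is "\<bar>?I\<bar> \<le> ?J") if N: "N > 0" for N
  proof -
    let ?f = "\<lambda>u. exp (- (N * u)) * (exp u - 1) powr (- 1 / 2) -
      (\<Sum>j\<le>m. watson_fps $ j * (u powr (real j + 1 / 2 - 1) * exp (- (N * u))))"
    let ?g = "\<lambda>u. C * (u powr (real m + 3 / 2 - 1) * exp (- (N * u)))"
    have f: "(?f has_integral ?I) {0<..}"
      unfolding watson_sum_def
      by (intro has_integral_diff has_integral_sum has_integral_mult_right has_integral_exp_powr
          has_integral_powr_exp N) auto
    have g: "(?g has_integral ?J) {0<..}"
      by (intro has_integral_mult_right has_integral_powr_exp N) auto
    have bound: "\<bar>?f u\<bar> \<le> ?g u" if "u \<in> {0<..}" for u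
    proof -
      have u: "u > 0" using that by simp
      have "(exp u - 1) powr (- 1 / 2) = u powr (- 1 / 2) * ((exp u - 1) / u) powr (- 1 / 2)"
        using u by (subst powr_mult[symmetric]) auto
      moreover have "u powr (real j + 1 / 2 - 1) = u powr (- 1 / 2) * u ^ j" for j
        using u by (simp add: powr_realpow[symmetric] powr_add[symmetric] algebra_simps)
      moreover have "u powr (real m + 3 / 2 - 1) = u powr (- 1 / 2) * u ^ Suc m"
        using u by (simp only: powr_realpow[symmetric] powr_add[symmetric]) (simp add: algebra_simps)
      ultimately have eq: "?f u = exp (- (N * u)) * u powr (- 1 / 2) *
          (((exp u - 1) / u) powr (- 1 / 2) - (\<Sum>j\<le>m. watson_fps $ j * u ^ j))"
        "?g u = exp (- (N * u)) * u powr (- 1 / 2) * (C * u ^ Suc m)"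
        by (simp_all only: right_diff_distrib sum_distrib_left mult_ac)
      show ?thesis unfolding eq abs_mult using C[OF u] by (simp add: mult_left_mono)
    qed
    have "?I \<le> ?J" by (rule has_integral_le[OF f g]) (use bound abs_le_iff in blast)
    moreover have "- ?I \<le> ?J"
      by (rule has_integral_le[OF has_integral_neg[OF f] g]) (use bound abs_le_iff in blast)
    ultimately show ?thesis by linarith
  qed
  thus ?thesis by blast
qed

section \<open>The change of variable\<close>

definition inv_n :: "nat \<Rightarrow> real" where "inv_n N = 1 / real N"

lemma inv_n_tendsto: "inv_n \<longlonglongrightarrow> 0"
  unfolding inv_n_def[abs_def] by (rule lim_1_over_n)

abbreviation asymp_n :: "(nat \<Rightarrow> real) \<Rightarrow> real fps \<Rightarrow> bool" where
  "asymp_n \<equiv> asymp_fps inv_n sequentially"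

text \<open>Gamma(j + 1/2) is \<open>pochhammer (1 / 2) j\<close> times sqrt pi, and the root
  cancels against the one in the Beta value. The coefficients are thus rational, as computability
  requires.\<close>

definition Gamma_half_fps :: "real fps" where
  "Gamma_half_fps = Abs_fps (\<lambda>j. pochhammer (1 / 2) j * watson_fps $ j)"

definition Gamma_ratio :: "nat \<Rightarrow> nat \<Rightarrow> real" where
  "Gamma_ratio p N = Gamma (real (N - p) + 3 / 2) / (fact N * sqrt (real N))"

text \<open>The first factor stems from Gamma(N + 3/2) = (N + 1/2) Gamma(N + 1/2). Each step from
  \<open>i\<close> to \<open>Suc i\<close> divides by N - (i - 1/2), which expands as a geometric
  series in 1/N.\<close>

definition Gamma_ratio_fps :: "nat \<Rightarrow> real fps" where
  "Gamma_ratio_fps p = (1 + fps_const (1 / 2) * fps_X) * Gamma_half_fps *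
     (\<Prod>i<p. fps_X * Abs_fps (\<lambda>k. (real i - 1 / 2) ^ k))"

lemma asymp_n_Gamma_half:
  "asymp_n (\<lambda>N. sqrt (real N) * Gamma (real N + 1 / 2) / fact N) Gamma_half_fps"
  unfolding asymp_fps_def
proof
  fix m
  obtain C where C: "\<And>N. N > 0 \<Longrightarrow> \<bar>Beta (N + 1 / 2) (1 / 2) - watson_sum m N\<bar>
     \<le> C * (Gamma (real m + 3 / 2) / N powr (real m + 3 / 2))"
    using Beta_half_expansion by blast
  define K where "K = C * Gamma (real m + 3 / 2) / sqrt pi"
  let ?r = "\<lambda>N. sqrt (real N) * Gamma (real N + 1 / 2) / fact N - (\<Sum>j\<le>m. Gamma_half_fps $ j * inv_n N ^ j)"
  have "norm (?r N) \<le> K * norm (inv_n N ^ Suc m)" if "N > 0" for N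
  proof -
    have N: "real N > 0" using that by simp
    have Beta: "Beta (real N + 1 / 2) (1 / 2) = Gamma (real N + 1 / 2) * sqrt pi / fact N"
      by (simp add: Beta_def Gamma_one_half_real Gamma_fact[symmetric] add.commute)
    have G: "Gamma (real j + 1 / 2) = pochhammer (1 / 2) j * sqrt pi" for j
    proof -
      have "pochhammer (1 / 2) j = Gamma (1 / 2 + real j) / Gamma (1 / 2 :: real)"
        by (rule pochhammer_Gamma) (auto elim!: nonpos_Ints_cases)
      thus ?thesis by (simp add: Gamma_one_half_real add.commute)
    qed
    have pw: "N powr (real j + 1 / 2) = real N ^ j * sqrt (real N)" for j
      using N by (simp add: powr_add powr_realpow powr_half_sqrt)
    have pw': "N powr (real m + 3 / 2) = real N ^ Suc m * sqrt (real N)"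
      using pw[of "Suc m"] by (simp add: add.commute)
    have "sqrt (real N) / sqrt pi * (watson_fps $ j * (Gamma (real j + 1 / 2) / N powr (real j + 1 / 2))) =
        Gamma_half_fps $ j * inv_n N ^ j" for j
      unfolding G pw using N by (simp add: inv_n_def power_divide Gamma_half_fps_def)
    hence "?r N = sqrt (real N) / sqrt pi * (Beta (N + 1 / 2) (1 / 2) - watson_sum m N)"
      by (simp add: right_diff_distrib sum_distrib_left Beta watson_sum_def)
    hence "norm (?r N) = sqrt (real N) / sqrt pi * \<bar>Beta (N + 1 / 2) (1 / 2) - watson_sum m N\<bar>"
      by (simp add: abs_mult)
    also have "\<dots> \<le> sqrt (real N) / sqrt pi * (C * (Gamma (real m + 3 / 2) / N powr (real m + 3 / 2)))"
      using C[OF N] by (intro mult_left_mono) auto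
    also have "\<dots> = K * norm (inv_n N ^ Suc m)"
      unfolding pw' K_def inv_n_def using N by (simp add: power_divide)
    finally show ?thesis .
  qed
  hence "eventually (\<lambda>N. norm (?r N) \<le> K * norm (inv_n N ^ Suc m)) sequentially"
    by (intro eventually_mono[OF eventually_gt_at_top[of 0]])
  thus "?r \<in> O(\<lambda>N. inv_n N ^ Suc m)" by (rule bigoI)
qed

lemma asymp_n_inverse_diff: "asymp_n (\<lambda>N. 1 / (real N - c)) (fps_X * Abs_fps (\<lambda>k. c ^ k))"
proof -
  have "asymp_n (\<lambda>N. (\<lambda>u. 1 / (1 - c * u)) (inv_n N)) (Abs_fps (\<lambda>k. c ^ k))"
  proof (rule asymp_fps_sums[OF inv_n_tendsto])
    show "1 / (\<bar>c\<bar> + 1) > 0" by simp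
    fix u assume u: "\<bar>u\<bar> < 1 / (\<bar>c\<bar> + 1)"
    have "\<bar>c * u\<bar> \<le> \<bar>c\<bar> * (1 / (\<bar>c\<bar> + 1))" unfolding abs_mult using u by (intro mult_left_mono) auto
    also have "\<dots> < 1" by (simp add: field_simps)
    finally have "(\<lambda>n. (c * u) ^ n) sums (1 / (1 - c * u))" by (intro geometric_sums) simp
    thus "(\<lambda>n. Abs_fps (\<lambda>k. c ^ k) $ n * u ^ n) sums (1 / (1 - c * u))"
      by (simp add: power_mult_distrib)
  qed
  hence "asymp_n (\<lambda>N. inv_n N * (1 / (1 - c * inv_n N))) (fps_X * Abs_fps (\<lambda>k. c ^ k))"
    by (intro asymp_fps_mult[OF inv_n_tendsto] asymp_fps_X) simp
  moreover have "eventually (\<lambda>N. inv_n N * (1 / (1 - c * inv_n N)) = 1 / (real N - c)) sequentially"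
    by (rule eventually_mono[OF eventually_gt_at_top[of 0]]) (simp add: inv_n_def field_simps)
  ultimately show ?thesis by (rule asymp_fps_cong[rotated])
qed

lemma Gamma_real_Suc_shift: "Gamma (real (Suc n) + 3 / 2) = (real n + 3 / 2) * Gamma (real n + 3 / 2)"
proof -
  have "Gamma (real n + 3 / 2 + 1) = (real n + 3 / 2) * Gamma (real n + 3 / 2)"
    by (rule Gamma_plus1) (auto elim!: nonpos_Ints_cases)
  thus ?thesis by (simp add: algebra_simps)
qed

lemma Gamma_ratio_Suc:
  assumes "p < N" shows "Gamma_ratio (Suc p) N = Gamma_ratio p N * (1 / (real N - (real p - 1 / 2)))"
proof -
  obtain k where k: "N = Suc (p + k)" using assms less_imp_Suc_add by blast
  have "Gamma_ratio p N = (real k + 3 / 2) * Gamma_ratio (Suc p) N"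
    using Gamma_real_Suc_shift[of k] by (simp add: Gamma_ratio_def k Suc_diff_le)
  moreover have "real N - (real p - 1 / 2) = real k + 3 / 2" by (simp add: k)
  ultimately show ?thesis by simp
qed

lemma asymp_n_Gamma_ratio: "asymp_n (Gamma_ratio p) (Gamma_ratio_fps p)"
proof (induction p)
  case 0
  have "asymp_n (\<lambda>N. 1 + 1 / 2 * inv_n N) (1 + fps_const (1 / 2) * fps_X)"
    using asymp_fps_add[OF asymp_fps_monom_0[of inv_n sequentially 1]
        asymp_fps_cmult[OF inv_n_tendsto asymp_fps_X, of "1 / 2"]] by simp
  from asymp_fps_mult[OF inv_n_tendsto this asymp_n_Gamma_half]
  have "asymp_n (\<lambda>N. (1 + 1 / 2 * inv_n N) * (sqrt (real N) * Gamma (real N + 1 / 2) / fact N)) (Gamma_ratio_fps 0)"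
    by (simp add: Gamma_ratio_fps_def)
  moreover have "(1 + 1 / 2 * inv_n N) * (sqrt (real N) * Gamma (real N + 1 / 2) / fact N) = Gamma_ratio 0 N"
    if "N > 0" for N
  proof -
    have "Gamma (real N + 1 / 2 + 1) = (real N + 1 / 2) * Gamma (real N + 1 / 2)"
      by (rule Gamma_plus1) (auto elim!: nonpos_Ints_cases)
    moreover have "real N + 1 / 2 + 1 = real N + 3 / 2" by simp
    ultimately have G: "Gamma (real N + 3 / 2) = (real N + 1 / 2) * Gamma (real N + 1 / 2)" by simp
    have "1 + 1 / 2 * inv_n N = (real N + 1 / 2) / real N" using that by (simp add: inv_n_def field_simps)
    hence "(1 + 1 / 2 * inv_n N) * (sqrt (real N) * Gamma (real N + 1 / 2) / fact N) =
        (real N + 1 / 2) * Gamma (real N + 1 / 2) / fact N * (sqrt (real N) / real N)"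
      by (simp add: mult_ac)
    also have "sqrt (real N) / real N = 1 / sqrt (real N)"
      using real_div_sqrt[of "real N"] that by (simp add: field_simps)
    finally show ?thesis by (simp add: Gamma_ratio_def G)
  qed
  hence "eventually (\<lambda>N. (1 + 1 / 2 * inv_n N) * (sqrt (real N) * Gamma (real N + 1 / 2) / fact N) = Gamma_ratio 0 N) sequentially"
    by (intro eventually_mono[OF eventually_gt_at_top[of 0]])
  ultimately show ?case by (rule asymp_fps_cong[rotated])
next
  case (Suc p)
  have "asymp_n (\<lambda>N. Gamma_ratio p N * (1 / (real N - (real p - 1 / 2)))) (Gamma_ratio_fps (Suc p))"
    using asymp_fps_mult[OF inv_n_tendsto Suc.IH asymp_n_inverse_diff[of "real p - 1 / 2"]]
    by (simp add: Gamma_ratio_fps_def mult.assoc)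
  moreover have "eventually (\<lambda>N. Gamma_ratio p N * (1 / (real N - (real p - 1 / 2))) = Gamma_ratio (Suc p) N) sequentially"
    using eventually_gt_at_top[of p] by eventually_elim (rule Gamma_ratio_Suc[symmetric])
  ultimately show ?case by (rule asymp_fps_cong[rotated])
qed

lemma Gamma_ratio_fps_nth_below: "n < p \<Longrightarrow> Gamma_ratio_fps p $ n = 0"
proof -
  assume "n < p"
  have "(\<Prod>i<p. fps_X * Abs_fps (\<lambda>k. (real i - 1 / 2) ^ k)) =
      fps_X ^ p * (\<Prod>i<p. Abs_fps (\<lambda>k. (real i - 1 / 2) ^ k))"
    by (simp add: prod.distrib)
  hence "Gamma_ratio_fps p = fps_X ^ p * ((1 + fps_const (1 / 2) * fps_X) *
      Gamma_half_fps * (\<Prod>i<p. Abs_fps (\<lambda>k. (real i - 1 / 2) ^ k)))"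
    by (simp only: Gamma_ratio_fps_def mult_ac)
  thus ?thesis using \<open>n < p\<close> by (simp only: fps_X_power_mult_nth if_True)
qed

lemma Gamma_ratio_bigo: "Gamma_ratio p \<in> O(\<lambda>N. inv_n N ^ p)"
proof (cases p)
  case 0
  thus ?thesis using asymp_fps_poly_bound[OF inv_n_tendsto asymp_n_Gamma_ratio[of 0]] by simp
next
  case (Suc m)
  have "(\<Sum>i\<le>m. Gamma_ratio_fps p $ i * inv_n N ^ i) = 0" for N
    by (rule sum.neutral) (simp add: Suc Gamma_ratio_fps_nth_below)
  thus ?thesis using asymp_fpsD[OF asymp_n_Gamma_ratio[of p], of m] by (simp add: Suc)
qed

text \<open>The source of factorial decay of \<open>Gamma_ratio\<close> in its first argument, which
  outweighs the growth 4^p of the coefficients in the tail of the main sum.\<close>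

lemma Gamma_fact_le: "fact i * Gamma (real k + 3 / 2) \<le> Gamma (real (k + i) + 3 / 2)"
proof (induction i)
  case (Suc i)
  have "fact (Suc i) * Gamma (real k + 3 / 2) = real (Suc i) * (fact i * Gamma (real k + 3 / 2))" by simp
  also have "\<dots> \<le> (real (k + i) + 3 / 2) * Gamma (real (k + i) + 3 / 2)"
    using Suc.IH by (intro mult_mono) (auto intro!: Gamma_real_nonneg)
  finally show ?case using Gamma_real_Suc_shift[of "k + i"] by simp
qed simp

lemma Gamma_le_fact: "Gamma (real n + 3 / 2) \<le> fact (Suc n)"
proof (induction n)
  case 0
  have "Gamma (1 / 2 + 1 :: real) = 1 / 2 * Gamma (1 / 2)" by (rule Gamma_plus1) auto
  moreover have "sqrt pi \<le> sqrt 4" using pi_less_4 by (subst real_sqrt_le_iff) auto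
  ultimately show ?case by (simp add: Gamma_one_half_real)
next
  case (Suc n)
  have "(real n + 3 / 2) * Gamma (real n + 3 / 2) \<le> real (Suc (Suc n)) * fact (Suc n)"
    using Suc by (intro mult_mono) (auto intro!: Gamma_real_nonneg)
  thus ?case unfolding Gamma_real_Suc_shift by simp
qed

text \<open>\<open>ln_quot\<close> is \<open>ln (1 + x) / x\<close>, and \<open>quot_ln\<close> is its inverse.\<close>
definition ln_quot :: "real fps" where
  "ln_quot = Abs_fps (\<lambda>n. (-1) ^ n / real (Suc n))"

definition quot_ln :: "real fps" where
  "quot_ln = inverse (1 + fps_X) oo (ln_quot - 1)"

definition kappa :: "real fps" where
  "kappa = fps_shift 1 quot_ln"

definition weight_fps :: "real fps" where
  "weight_fps = fps_binomial (1 / 24) * (fps_binomial (3 / 2) oo (fps_X * kappa))"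

lemma ln_quot_nth_0: "ln_quot $ 0 = 1" by (simp add: ln_quot_def)

lemma fps_ln_eq: "fps_ln 1 = fps_X * ln_quot"
proof (rule fps_ext)
  fix n show "fps_ln 1 $ n = (fps_X * ln_quot) $ n"
    by (cases n) (simp_all add: fps_ln_nth ln_quot_def)
qed

lemma quot_ln_mult: "quot_ln * ln_quot = 1"
proof -
  have 0: "(ln_quot - 1) $ 0 = 0" by (simp add: ln_quot_nth_0)
  have "quot_ln * ((1 + fps_X) oo (ln_quot - 1)) = (inverse (1 + fps_X) * (1 + fps_X)) oo (ln_quot - 1)"
    unfolding quot_ln_def by (rule fps_compose_mult_distrib[OF 0, symmetric])
  also have "inverse (1 + fps_X) * (1 + fps_X :: real fps) = 1" by (rule inverse_mult_eq_1) simp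
  also have "(1 + fps_X) oo (ln_quot - 1) = ln_quot" using 0 by (simp add: fps_compose_add_distrib)
  finally show ?thesis by simp
qed

lemma quot_ln_eq: "quot_ln = 1 + fps_X * kappa"
proof (rule fps_ext)
  fix n
  have "quot_ln $ 0 = 1" by (simp add: quot_ln_def)
  thus "quot_ln $ n = (1 + fps_X * kappa) $ n" by (cases n) (simp_all add: kappa_def)
qed

lemma X_kappa_nth_0: "(fps_X * kappa) $ 0 = 0" by simp

text \<open>The exponent -n of 1 + x kappa is split as 3/2 - (n + 3/2), to obtain binomials that
  combine with \<open>Gamma (real n + 3 / 2)\<close>.\<close>

lemma ln_quot_power:
  "ln_quot ^ n = (fps_binomial (3 / 2) oo (fps_X * kappa)) *
     (fps_binomial (- (real n + 3 / 2)) oo (fps_X * kappa))"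
proof -
  have "(fps_binomial (3 / 2) oo (fps_X * kappa)) * (fps_binomial (- (real n + 3 / 2)) oo (fps_X * kappa)) =
      fps_binomial (- of_nat n) oo (fps_X * kappa)"
    unfolding fps_compose_mult_distrib[OF X_kappa_nth_0, symmetric] fps_binomial_add_mult[symmetric] by simp
  moreover have "((1 + fps_X) ^ n oo (fps_X * kappa)) * (fps_binomial (- of_nat n) oo (fps_X * kappa)) = 1"
  proof -
    have "(1 + fps_X) ^ n * inverse ((1 + fps_X) ^ n) = (1 :: real fps)" by (rule inverse_mult_eq_1') simp
    thus ?thesis unfolding fps_binomial_minus_of_nat fps_compose_mult_distrib[OF X_kappa_nth_0, symmetric]
      by (simp only: fps_compose_1)
  qed
  moreover have "(1 + fps_X) ^ n oo (fps_X * kappa) = quot_ln ^ n"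
    unfolding fps_compose_power[OF X_kappa_nth_0, symmetric] by (simp add: fps_compose_add_distrib quot_ln_eq)
  moreover have "quot_ln ^ n * ln_quot ^ n = 1" by (simp add: power_mult_distrib[symmetric] quot_ln_mult)
  ultimately show ?thesis by (metis mult.commute mult.left_commute mult_1_right)
qed

text \<open>Gamma(a) times the binomial of -a over j is (-1)^j Gamma(a + j)/j!. After this step the
  Gamma value depends on \<open>n + j\<close> alone, and the coefficient on \<open>j\<close> and
  \<open>N - n - j\<close>.\<close>

lemma Gamma_mult_coeff:
  assumes "n \<le> N"
  shows "Gamma (real n + 3 / 2) * (fps_binomial (1 / 24) * fps_ln 1 ^ n) $ N =
    (\<Sum>j\<le>N - n. (-1) ^ j / fact j * Gamma (real (n + j) + 3 / 2) * (weight_fps * kappa ^ j) $ (N - n - j))"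
proof -
  have "fps_binomial (1 / 24) * fps_ln 1 ^ n = fps_X ^ n * (weight_fps * (fps_binomial (- (real n + 3 / 2)) oo (fps_X * kappa)))"
    by (simp only: fps_ln_eq power_mult_distrib ln_quot_power weight_fps_def mult_ac)
  hence "(fps_binomial (1 / 24) * fps_ln 1 ^ n) $ N =
      (weight_fps * (fps_binomial (- (real n + 3 / 2)) oo (fps_X * kappa))) $ (N - n)"
    using assms by (simp only: fps_X_power_mult_nth) simp
  also have "\<dots> = (\<Sum>j\<le>N - n. (- (real n + 3 / 2) gchoose j) * (weight_fps * (fps_X * kappa) ^ j) $ (N - n))"
    by (subst fps_mult_compose_nth) simp_all
  also have "\<dots> = (\<Sum>j\<le>N - n. (- (real n + 3 / 2) gchoose j) * (weight_fps * kappa ^ j) $ (N - n - j))"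
  proof (intro sum.cong refl)
    fix j assume j: "j \<in> {..N - n}"
    have "weight_fps * (fps_X * kappa) ^ j = fps_X ^ j * (weight_fps * kappa ^ j)"
      by (simp only: power_mult_distrib mult_ac)
    thus "(- (real n + 3 / 2) gchoose j) * (weight_fps * (fps_X * kappa) ^ j) $ (N - n) =
        (- (real n + 3 / 2) gchoose j) * (weight_fps * kappa ^ j) $ (N - n - j)"
      using j by (simp only: fps_X_power_mult_nth) simp
  qed
  also have "Gamma (real n + 3 / 2) * \<dots> = (\<Sum>j\<le>N - n. (-1) ^ j / fact j * Gamma (real (n + j) + 3 / 2) *
      (weight_fps * kappa ^ j) $ (N - n - j))"
    unfolding sum_distrib_left
  proof (intro sum.cong refl)
    fix j
    have "Gamma (real n + 3 / 2) > 0" by (rule Gamma_real_pos) simp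
    hence "Gamma (real n + 3 / 2) \<noteq> 0" by (metis less_irrefl)
    moreover have "pochhammer (real n + 3 / 2) j = Gamma (real n + 3 / 2 + real j) / Gamma (real n + 3 / 2)"
      by (rule pochhammer_Gamma) (auto elim!: nonpos_Ints_cases)
    ultimately have "Gamma (real n + 3 / 2) * (- (real n + 3 / 2) gchoose j) = (-1) ^ j / fact j * Gamma (real (n + j) + 3 / 2)"
      by (simp add: gbinomial_pochhammer algebra_simps)
    thus "Gamma (real n + 3 / 2) * ((- (real n + 3 / 2) gchoose j) * (weight_fps * kappa ^ j) $ (N - n - j)) =
      (-1) ^ j / fact j * Gamma (real (n + j) + 3 / 2) * (weight_fps * kappa ^ j) $ (N - n - j)"
      by (simp only: mult.assoc[symmetric])
  qed
  finally show ?thesis .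
qed

lemma sum_triangle_swap:
  fixes F :: "nat \<Rightarrow> nat \<Rightarrow> nat \<Rightarrow> 'a::comm_monoid_add"
  shows "(\<Sum>n\<le>N. \<Sum>j\<le>N - n. F n j (N - n - j)) = (\<Sum>p\<le>N. \<Sum>j\<le>N - p. F (N - p - j) j p)"
proof -
  have "(\<Sum>n\<le>N. \<Sum>j\<le>N - n. F n j (N - n - j)) = (\<Sum>(n, j)\<in>(SIGMA n:{..N}. {..N - n}). F n j (N - n - j))"
    by (simp add: sum.Sigma)
  also have "\<dots> = (\<Sum>(p, j)\<in>(SIGMA p:{..N}. {..N - p}). F (N - p - j) j p)"
    by (rule sum.reindex_bij_witness[of _ "\<lambda>(p, j). (N - p - j, j)" "\<lambda>(n, j). (N - n - j, j)"]) auto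
  finally show ?thesis by (simp add: sum.Sigma)
qed

text \<open>Collecting the terms with \<open>p = N - n - j\<close> fixes
  \<open>n + j = N - p\<close>, so a single Gamma value remains; the inner sum over \<open>j\<close>
  is a partial sum of the exponential of - kappa / \<open>\<rho>\<close>.\<close>

lemma sum_Gamma_coeff:
  fixes \<rho> :: real
  assumes "\<rho> > 0"
  shows "(\<Sum>n\<le>N. Gamma (real n + 3 / 2) * \<rho> ^ n * (fps_binomial (1 / 24) * fps_ln 1 ^ n) $ N) =
    (\<Sum>p\<le>N. Gamma (real (N - p) + 3 / 2) * \<rho> ^ (N - p) *
       (\<Sum>j\<le>N - p. (- (1 / \<rho>)) ^ j / fact j * (weight_fps * kappa ^ j) $ p))"
proof -
  define F where "F n j p = \<rho> ^ n * ((-1) ^ j / fact j * Gamma (real (n + j) + 3 / 2) * (weight_fps * kappa ^ j) $ p)" for n j p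
  have "(\<Sum>n\<le>N. Gamma (real n + 3 / 2) * \<rho> ^ n * (fps_binomial (1 / 24) * fps_ln 1 ^ n) $ N) =
      (\<Sum>n\<le>N. \<Sum>j\<le>N - n. F n j (N - n - j))"
  proof (intro sum.cong refl)
    fix n assume n: "n \<in> {..N}"
    have "Gamma (real n + 3 / 2) * \<rho> ^ n * (fps_binomial (1 / 24) * fps_ln 1 ^ n) $ N =
        \<rho> ^ n * (Gamma (real n + 3 / 2) * (fps_binomial (1 / 24) * fps_ln 1 ^ n) $ N)"
      by (simp only: mult_ac)
    also have "\<dots> = (\<Sum>j\<le>N - n. F n j (N - n - j))"
      using n by (simp only: Gamma_mult_coeff atMost_iff F_def sum_distrib_left)
    finally show "Gamma (real n + 3 / 2) * \<rho> ^ n * (fps_binomial (1 / 24) * fps_ln 1 ^ n) $ N =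
        (\<Sum>j\<le>N - n. F n j (N - n - j))" .
  qed
  also have "\<dots> = (\<Sum>p\<le>N. \<Sum>j\<le>N - p. F (N - p - j) j p)" by (rule sum_triangle_swap)
  also have "\<dots> = (\<Sum>p\<le>N. Gamma (real (N - p) + 3 / 2) * \<rho> ^ (N - p) *
       (\<Sum>j\<le>N - p. (- (1 / \<rho>)) ^ j / fact j * (weight_fps * kappa ^ j) $ p))"
    unfolding sum_distrib_left
  proof (intro sum.cong refl)
    fix p j assume "p \<in> {..N}" "j \<in> {..N - p}"
    hence j: "N - p - j + j = N - p" by simp
    have "\<rho> ^ (N - p - j) = \<rho> ^ (N - p) * (1 / \<rho>) ^ j"
      using assms by (subst j[symmetric], unfold power_add) (simp add: power_divide)
    hence "\<rho> ^ (N - p - j) * (-1) ^ j = \<rho> ^ (N - p) * (- (1 / \<rho>)) ^ j"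
      by (simp add: power_minus[of "1 / \<rho>"])
    thus "F (N - p - j) j p = Gamma (real (N - p) + 3 / 2) * \<rho> ^ (N - p) *
        ((- (1 / \<rho>)) ^ j / fact j * (weight_fps * kappa ^ j) $ p)"
      unfolding F_def j by (simp add: field_simps)
  qed
  finally show ?thesis .
qed

text \<open>The radius \<open>1 / 4\<close> is small enough for the norms of \<open>ln_quot - 1\<close> and \<open>fps_X * kappa\<close> to be
  less than 1, so that these can be substituted into the binomial series.\<close>
definition fps_norm_le :: "real fps \<Rightarrow> real \<Rightarrow> bool" where
  "fps_norm_le A Q \<longleftrightarrow> (\<forall>n. (\<Sum>p\<le>n. \<bar>A $ p\<bar> * (1 / 4) ^ p) \<le> Q)"

lemma fps_norm_leD: "fps_norm_le A Q \<Longrightarrow> (\<Sum>p\<le>n. \<bar>A $ p\<bar> * (1 / 4) ^ p) \<le> Q"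
  by (simp only: fps_norm_le_def)

lemma fps_norm_le_nonneg: "fps_norm_le A Q \<Longrightarrow> 0 \<le> Q"
  using fps_norm_leD[of A Q 0] by (simp add: order_trans[OF abs_ge_zero])

lemma fps_norm_le_nth:
  assumes "fps_norm_le A Q" shows "\<bar>A $ p\<bar> \<le> Q * 4 ^ p"
proof -
  have "\<bar>A $ p\<bar> * (1 / 4) ^ p \<le> (\<Sum>p\<le>p. \<bar>A $ p\<bar> * (1 / 4) ^ p)"
    by (rule member_le_sum) auto
  also have "\<dots> \<le> Q" by (rule fps_norm_leD[OF assms])
  finally show ?thesis by (simp add: power_divide field_simps)
qed

lemma fps_norm_le_mult:
  assumes "fps_norm_le A P" "fps_norm_le B Q"
  shows "fps_norm_le (A * B) (P * Q)"
  unfolding fps_norm_le_def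
proof
  fix n
  define a where "a p = \<bar>A $ p\<bar> * (1 / 4) ^ p" for p
  define b where "b p = \<bar>B $ p\<bar> * (1 / 4) ^ p" for p
  have nonneg: "a p \<ge> 0" "b p \<ge> 0" for p by (simp_all add: a_def b_def)
  have "(\<Sum>p\<le>n. \<bar>(A * B) $ p\<bar> * (1 / 4) ^ p) \<le> (\<Sum>p\<le>n. \<Sum>i\<le>p. a i * b (p - i))"
  proof (rule sum_mono)
    fix p
    have "\<bar>(A * B) $ p\<bar> * (1 / 4) ^ p \<le> (\<Sum>i\<le>p. \<bar>A $ i * B $ (p - i)\<bar>) * (1 / 4) ^ p"
      unfolding fps_mult_nth atLeast0AtMost by (intro mult_right_mono sum_abs) auto
    also have "\<dots> = (\<Sum>i\<le>p. a i * b (p - i))"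
      unfolding sum_distrib_right
    proof (intro sum.cong refl)
      fix i assume "i \<in> {..p}"
      hence "(1 / 4 :: real) ^ p = (1 / 4) ^ i * (1 / 4) ^ (p - i)" by (simp add: power_add[symmetric])
      thus "\<bar>A $ i * B $ (p - i)\<bar> * (1 / 4) ^ p = a i * b (p - i)" by (simp add: a_def b_def abs_mult)
    qed
    finally show "\<bar>(A * B) $ p\<bar> * (1 / 4) ^ p \<le> (\<Sum>i\<le>p. a i * b (p - i))" .
  qed
  also have "\<dots> = (\<Sum>(i, j)\<in>{(i, j). i + j \<le> n}. a i * b j)"
    by (rule sum.triangle_reindex_eq[symmetric])
  also have "\<dots> \<le> (\<Sum>(i, j)\<in>{..n} \<times> {..n}. a i * b j)"
    by (rule sum_mono2) (auto intro: nonneg mult_nonneg_nonneg)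
  also have "\<dots> = (\<Sum>i\<le>n. a i) * (\<Sum>j\<le>n. b j)"
    by (simp add: sum_product sum.cartesian_product)
  also have "\<dots> \<le> P * Q"
    unfolding a_def b_def
    by (intro mult_mono fps_norm_leD assms fps_norm_le_nonneg[OF assms(1)] sum_nonneg) auto
  finally show "(\<Sum>p\<le>n. \<bar>(A * B) $ p\<bar> * (1 / 4) ^ p) \<le> P * Q" .
qed

lemma fps_norm_le_power: "fps_norm_le A Q \<Longrightarrow> fps_norm_le (A ^ k) (Q ^ k)"
proof (induction k)
  case 0
  have "(\<Sum>p\<le>n. \<bar>(1 :: real fps) $ p\<bar> * (1 / 4) ^ p) = 1" for n
    by (simp add: fps_one_nth if_distrib[of abs] if_distrib[of "\<lambda>c. c * _"] cong: if_cong)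
  thus ?case by (simp add: fps_norm_le_def)
qed (simp add: fps_norm_le_mult)

lemma fps_norm_le_compose:
  assumes H: "fps_norm_le H q" "H $ 0 = 0" and G: "\<And>n. (\<Sum>k\<le>n. \<bar>G $ k\<bar> * q ^ k) \<le> Q"
  shows "fps_norm_le (G oo H) Q"
  unfolding fps_norm_le_def
proof
  fix n
  have "(\<Sum>p\<le>n. \<bar>(G oo H) $ p\<bar> * (1 / 4) ^ p) \<le>
      (\<Sum>p\<le>n. \<Sum>k\<le>n. \<bar>G $ k\<bar> * (\<bar>(H ^ k) $ p\<bar> * (1 / 4) ^ p))"
  proof (rule sum_mono)
    fix p assume p: "p \<in> {..n}"
    have "(G oo H) $ p = (\<Sum>k\<le>n. G $ k * (H ^ k) $ p)"
      unfolding fps_compose_nth atLeast0AtMost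
      by (rule sum.mono_neutral_left) (use p startsby_zero_power_prefix[OF H(2)] in auto)
    hence "\<bar>(G oo H) $ p\<bar> * (1 / 4) ^ p \<le> (\<Sum>k\<le>n. \<bar>G $ k * (H ^ k) $ p\<bar>) * (1 / 4) ^ p"
      by (simp add: sum_abs mult_right_mono)
    thus "\<bar>(G oo H) $ p\<bar> * (1 / 4) ^ p \<le> (\<Sum>k\<le>n. \<bar>G $ k\<bar> * (\<bar>(H ^ k) $ p\<bar> * (1 / 4) ^ p))"
      by (simp add: sum_distrib_right abs_mult mult.assoc)
  qed
  also have "\<dots> = (\<Sum>k\<le>n. \<bar>G $ k\<bar> * (\<Sum>p\<le>n. \<bar>(H ^ k) $ p\<bar> * (1 / 4) ^ p))"
    unfolding sum_distrib_left by (rule sum.swap)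
  also have "\<dots> \<le> (\<Sum>k\<le>n. \<bar>G $ k\<bar> * q ^ k)"
    by (intro sum_mono mult_left_mono fps_norm_leD fps_norm_le_power H) auto
  also have "\<dots> \<le> Q" by (rule G)
  finally show "(\<Sum>p\<le>n. \<bar>(G oo H) $ p\<bar> * (1 / 4) ^ p) \<le> Q" .
qed

lemma geometric_sum_le:
  fixes x :: real
  assumes "0 \<le> x" "x < 1" shows "(\<Sum>k\<le>n. x ^ k) \<le> 1 / (1 - x)"
proof -
  have "(\<Sum>k\<le>n. x ^ k) \<le> (\<Sum>k. x ^ k)"
    by (rule sum_le_suminf) (use assms in \<open>auto intro: summable_geometric\<close>)
  also have "\<dots> = 1 / (1 - x)" by (rule suminf_geometric) (use assms in simp)
  finally show ?thesis .
qed

lemma sum_bound_geometric: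
  fixes x c :: real
  assumes "0 \<le> x" "x < 1" "a 0 = 0" "\<And>k. \<bar>a k\<bar> \<le> c"
  shows "(\<Sum>k\<le>n. \<bar>a k\<bar> * x ^ k) \<le> c * (1 / (1 - x) - 1)"
proof -
  have "c \<ge> 0" using assms(4)[of 0] by (rule order_trans[OF abs_ge_zero])
  have "(\<Sum>k\<le>n. \<bar>a k\<bar> * x ^ k) \<le> (\<Sum>k\<le>n. c * x ^ k - (if k = 0 then c else 0))"
    by (rule sum_mono) (use assms in \<open>auto intro: mult_right_mono\<close>)
  also have "\<dots> = c * ((\<Sum>k\<le>n. x ^ k) - 1)" by (simp add: sum_subtractf sum_distrib_left right_diff_distrib)
  also have "\<dots> \<le> c * (1 / (1 - x) - 1)"
    using \<open>c \<ge> 0\<close> geometric_sum_le[OF assms(1,2), of n] by (intro mult_left_mono) auto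
  finally show ?thesis .
qed

text \<open>The ratio of consecutive binomials is (a - k)/(k + 1), of modulus at most 1 from k = 1
  on; only the first step can grow, to \<open>a\<close>.\<close>

lemma abs_gbinomial_le_2:
  fixes a :: real
  assumes "0 \<le> a" "a \<le> 2" shows "\<bar>a gchoose k\<bar> \<le> 2"
proof (induction k)
  case (Suc k)
  have eq: "a gchoose Suc k = (a gchoose k) * ((a - real k) / real (Suc k))"
    by (simp add: gbinomial_mult_1[of a k] gbinomial_absorption' field_simps gbinomial_prod_rev)
  show ?case
  proof (cases "k = 0")
    case False
    have "\<bar>(a - real k) / real (Suc k)\<bar> \<le> 1" using assms False by (simp add: abs_le_iff field_simps)
    hence "\<bar>a gchoose k\<bar> * \<bar>(a - real k) / real (Suc k)\<bar> \<le> 2 * 1" by (intro mult_mono Suc.IH) auto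
    thus ?thesis unfolding eq abs_mult by simp
  qed (use assms in simp)
qed simp

lemma fps_norm_le_ln_quot: "fps_norm_le (ln_quot - 1) (1 / 6)"
  unfolding fps_norm_le_def
proof
  fix n
  \<comment> \<open>Beyond degree 0 the coefficients of \<open>ln_quot\<close> have modulus at most
    1/2, and the powers of 1/4 from the first on sum to 1/3.\<close>
  have "(\<Sum>p\<le>n. \<bar>(ln_quot - 1) $ p\<bar> * (1 / 4) ^ p) \<le> 1 / 2 * (1 / (1 - 1 / 4) - 1)"
    by (rule sum_bound_geometric) (auto simp: ln_quot_def abs_mult power_abs field_simps)
  thus "(\<Sum>p\<le>n. \<bar>(ln_quot - 1) $ p\<bar> * (1 / 4) ^ p) \<le> 1 / 6" by simp
qed

lemma fps_norm_le_X_kappa: "fps_norm_le (fps_X * kappa) (1 / 5)"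
proof -
  have "fps_X * kappa = (inverse (1 + fps_X) - 1) oo (ln_quot - 1)"
    using quot_ln_eq by (simp add: fps_compose_sub_distrib quot_ln_def algebra_simps)
  moreover have "fps_norm_le ((inverse (1 + fps_X) - 1) oo (ln_quot - 1)) (1 / 5)"
  proof (rule fps_norm_le_compose[OF fps_norm_le_ln_quot])
    fix n
    have "(\<Sum>k\<le>n. \<bar>(inverse (1 + fps_X) - 1) $ k\<bar> * (1 / 6) ^ k) \<le> 1 * (1 / (1 - 1 / 6) - 1 :: real)"
      by (rule sum_bound_geometric) (auto simp: fps_inverse_fps_X_plus1 power_abs)
    thus "(\<Sum>k\<le>n. \<bar>(inverse (1 + fps_X) - 1) $ k\<bar> * (1 / 6) ^ k) \<le> (1 / 5 :: real)" by simp
  qed (simp add: ln_quot_nth_0)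
  ultimately show ?thesis by simp
qed

text \<open>Removing the factor \<open>fps_X\<close> multiplies the bound by 4, from 1/5 to 4/5. A
  norm of at most 1 is what bounds all powers of \<open>kappa\<close> uniformly.\<close>

lemma fps_norm_le_kappa: "fps_norm_le kappa 1"
  unfolding fps_norm_le_def
proof
  fix n
  have "(\<Sum>p\<le>n. \<bar>kappa $ p\<bar> * (1 / 4) ^ p) = 4 * (\<Sum>p\<le>n. \<bar>(fps_X * kappa) $ Suc p\<bar> * (1 / 4) ^ Suc p)"
    by (simp add: sum_distrib_left)
  also have "(\<Sum>p\<le>n. \<bar>(fps_X * kappa) $ Suc p\<bar> * (1 / 4) ^ Suc p) =
      (\<Sum>p\<le>Suc n. \<bar>(fps_X * kappa) $ p\<bar> * (1 / 4) ^ p)"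
    by (subst sum.atMost_Suc_shift) simp
  also have "\<dots> \<le> 1 / 5" by (rule fps_norm_leD[OF fps_norm_le_X_kappa])
  finally show "(\<Sum>p\<le>n. \<bar>kappa $ p\<bar> * (1 / 4) ^ p) \<le> 1" by simp
qed

lemma weight_kappa_nth_bound: "\<exists>W\<ge>0. \<forall>j p. \<bar>(weight_fps * kappa ^ j) $ p\<bar> \<le> W * 4 ^ p"
proof -
  have binom: "(\<Sum>k\<le>n. \<bar>fps_binomial a $ k\<bar> * x ^ k) \<le> 2 * (1 / (1 - x))"
    if "0 \<le> a" "a \<le> 2" "0 \<le> x" "x < 1" for a x :: real and n
  proof -
    have "(\<Sum>k\<le>n. \<bar>fps_binomial a $ k\<bar> * x ^ k) \<le> (\<Sum>k\<le>n. 2 * x ^ k)"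
      using that abs_gbinomial_le_2 by (intro sum_mono mult_right_mono) auto
    also have "\<dots> \<le> 2 * (1 / (1 - x))"
      unfolding sum_distrib_left[symmetric] by (intro mult_left_mono geometric_sum_le that) simp
    finally show ?thesis .
  qed
  have "fps_norm_le (fps_binomial (3 / 2) oo (fps_X * kappa)) (2 * (1 / (1 - 1 / 5)))"
    by (rule fps_norm_le_compose[OF fps_norm_le_X_kappa X_kappa_nth_0]) (rule binom, auto)
  moreover have "fps_norm_le (fps_binomial (1 / 24)) (2 * (1 / (1 - 1 / 4)))"
    unfolding fps_norm_le_def using binom[of "1 / 24" "1 / 4"] by simp
  ultimately have w: "fps_norm_le weight_fps (2 * (1 / (1 - 1 / 4)) * (2 * (1 / (1 - 1 / 5))))"
    unfolding weight_fps_def by (intro fps_norm_le_mult)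
  define W where "W = 2 * (1 / (1 - 1 / 4)) * (2 * (1 / (1 - 1 / 5)) :: real)"
  have "fps_norm_le (weight_fps * kappa ^ j) W" for j
    using fps_norm_le_mult[OF w fps_norm_le_power[OF fps_norm_le_kappa, of j]] by (simp add: W_def)
  hence "\<bar>(weight_fps * kappa ^ j) $ p\<bar> \<le> W * 4 ^ p" for j p by (rule fps_norm_le_nth)
  moreover have "W \<ge> 0" by (simp add: W_def)
  ultimately show ?thesis by blast
qed

definition kappa1 :: "real fps" where "kappa1 = kappa - fps_const (1 / 2)"

text \<open>Subtracting the constant term of \<open>kappa\<close> splits off the factor \<open>exp (- \<tau> / 2)\<close> and leaves a polynomial in \<open>\<tau>\<close>
  with rational coefficients.\<close>
definition exp_coeff :: "real \<Rightarrow> nat \<Rightarrow> real" where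
  "exp_coeff \<tau> p = exp (- \<tau> / 2) * (\<Sum>k\<le>p. (- \<tau>) ^ k / fact k * (weight_fps * kappa1 ^ k) $ p)"

lemma kappa_nth_0: "kappa $ 0 = 1 / 2"
proof -
  have "(quot_ln * ln_quot) $ 1 = 0" by (simp add: quot_ln_mult)
  moreover have "quot_ln $ 0 = 1" by (simp add: quot_ln_def)
  moreover have "ln_quot $ 1 = - 1 / 2" by (simp add: ln_quot_def)
  ultimately have "quot_ln $ 1 = 1 / 2" by (simp add: fps_mult_nth ln_quot_nth_0)
  thus ?thesis by (simp add: kappa_def)
qed

text \<open>Expand \<open>kappa ^ j\<close> in powers of \<open>kappa1\<close>, which has no
  constant term, so only exponents \<open>k \<le> p\<close> reach degree \<open>p\<close>. For fixed
  \<open>k\<close> the sum over \<open>j\<close> is an exponential series shifted by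
  \<open>k\<close>.\<close>

lemma exp_coeff_sums: "(\<lambda>j. (- \<tau>) ^ j / fact j * (weight_fps * kappa ^ j) $ p) sums exp_coeff \<tau> p"
proof -
  have k0: "kappa1 $ 0 = 0" by (simp add: kappa1_def kappa_nth_0)
  have nth: "(weight_fps * kappa ^ j) $ p = (\<Sum>k\<le>p. real (j choose k) * (1 / 2) ^ (j - k) * (weight_fps * kappa1 ^ k) $ p)" for j
  proof -
    have van: "(weight_fps * kappa1 ^ k) $ p = 0" if "k > p" for k
      using startsby_zero_power_prefix[OF k0] that by (intro fps_mult_nth_below'[where k = k]) auto
    have "kappa ^ j = (kappa1 + fps_const (1 / 2)) ^ j" by (simp add: kappa1_def)
    also have "\<dots> = (\<Sum>k\<le>j. of_nat (j choose k) * kappa1 ^ k * fps_const (1 / 2) ^ (j - k))"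
      by (rule binomial_ring)
    finally have "weight_fps * kappa ^ j =
        (\<Sum>k\<le>j. fps_const (real (j choose k) * (1 / 2) ^ (j - k)) * (weight_fps * kappa1 ^ k))"
      by (simp add: sum_distrib_left fps_of_nat[symmetric] fps_const_power mult_ac)
    hence "(weight_fps * kappa ^ j) $ p = (\<Sum>k\<le>j. real (j choose k) * (1 / 2) ^ (j - k) * (weight_fps * kappa1 ^ k) $ p)"
      by (simp add: fps_sum_nth)
    also have "\<dots> = (\<Sum>k\<le>max j p. real (j choose k) * (1 / 2) ^ (j - k) * (weight_fps * kappa1 ^ k) $ p)"
      by (rule sum.mono_neutral_left) (auto simp: not_le)
    also have "\<dots> = (\<Sum>k\<le>p. real (j choose k) * (1 / 2) ^ (j - k) * (weight_fps * kappa1 ^ k) $ p)"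
      by (rule sum.mono_neutral_right) (auto simp: not_le van)
    finally show ?thesis .
  qed
  have "(\<lambda>j. (- \<tau>) ^ j / fact j * (real (j choose k) * (1 / 2) ^ (j - k))) sums ((- \<tau>) ^ k / fact k * exp (- \<tau> / 2))" for k
  proof -
    define f where "f j = (- \<tau>) ^ j / fact j * (real (j choose k) * (1 / 2) ^ (j - k))" for j
    have "(\<lambda>i. y ^ i / fact i) sums exp y" for y :: real
      using exp_converges[of y] by (simp add: divide_inverse mult.commute)
    from this[of "- \<tau> / 2"]
    have "(\<lambda>i. (- \<tau>) ^ k / fact k * ((- \<tau> / 2) ^ i / fact i)) sums ((- \<tau>) ^ k / fact k * exp (- \<tau> / 2))"
      by (rule sums_mult)
    moreover have "(- \<tau>) ^ k / fact k * ((- \<tau> / 2) ^ i / fact i) = f (i + k)" for i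
      by (unfold power_divide) (simp add: f_def binomial_fact power_add power_divide mult_ac)
    moreover have "(\<Sum>j<k. f j) = 0" by (rule sum.neutral) (simp add: f_def)
    ultimately have "f sums ((- \<tau>) ^ k / fact k * exp (- \<tau> / 2))"
      using sums_iff_shift[of f k "(- \<tau>) ^ k / fact k * exp (- \<tau> / 2)"] by (simp only: add_0_right)
    thus ?thesis unfolding f_def[abs_def] .
  qed
  hence "(\<lambda>j. \<Sum>k\<le>p. (- \<tau>) ^ j / fact j * (real (j choose k) * (1 / 2) ^ (j - k)) * (weight_fps * kappa1 ^ k) $ p)
      sums (\<Sum>k\<le>p. (- \<tau>) ^ k / fact k * exp (- \<tau> / 2) * (weight_fps * kappa1 ^ k) $ p)"
    by (intro sums_sum sums_mult2)
  thus ?thesis unfolding nth exp_coeff_def sum_distrib_left by (simp add: mult_ac)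
qed

section \<open>The asymptotic expansion\<close>

lemma exp_partial_sum_le:
  fixes x :: real
  assumes "x \<ge> 0" "finite A" shows "(\<Sum>j\<in>A. x ^ j / fact j) \<le> exp x"
proof -
  have e: "(\<lambda>i. x ^ i / fact i) sums exp x"
    using exp_converges[of x] by (simp add: divide_inverse mult.commute)
  have "(\<Sum>j\<in>A. x ^ j / fact j) \<le> (\<Sum>j. x ^ j / fact j)"
    by (rule sum_le_suminf) (use assms e in \<open>auto simp: sums_iff\<close>)
  thus ?thesis using e by (simp add: sums_iff)
qed

definition kappa_exp_partial :: "real \<Rightarrow> nat \<Rightarrow> nat \<Rightarrow> real" where
  "kappa_exp_partial \<tau> p M = (\<Sum>j\<le>M. (- \<tau>) ^ j / fact j * (weight_fps * kappa ^ j) $ p)"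

lemma exp_coeff_partial_sums:
  assumes "\<tau> \<ge> 0"
  shows "\<exists>K\<ge>0. \<forall>p M.
    \<bar>kappa_exp_partial \<tau> p M\<bar> \<le> K * 4 ^ p \<and>
    \<bar>kappa_exp_partial \<tau> p M - exp_coeff \<tau> p\<bar> \<le> K * 4 ^ p * (1 / 2) ^ M"
proof -
  obtain W where W: "W \<ge> 0" "\<And>j p. \<bar>(weight_fps * kappa ^ j) $ p\<bar> \<le> W * 4 ^ p"
    using weight_kappa_nth_bound by blast
  define t where "t p j = (- \<tau>) ^ j / fact j * (weight_fps * kappa ^ j) $ p" for p j
  \<comment> \<open>Doubling the argument buys a geometric rate:
    \<open>\<tau> ^ j / fact j \<le> exp (2 * \<tau>) / 2 ^ j\<close>.\<close>
  define K where "K = W * exp (2 * \<tau>)"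
  have t: "\<bar>t p j\<bar> \<le> W * 4 ^ p * (\<tau> ^ j / fact j)" for p j
  proof -
    have "\<bar>t p j\<bar> = \<tau> ^ j / fact j * \<bar>(weight_fps * kappa ^ j) $ p\<bar>"
      using assms by (simp add: t_def abs_mult power_abs)
    also have "\<dots> \<le> \<tau> ^ j / fact j * (W * 4 ^ p)" using W assms by (intro mult_left_mono) auto
    finally show ?thesis by (simp add: mult_ac)
  qed
  have "\<bar>\<Sum>j\<le>M. t p j\<bar> \<le> K * 4 ^ p" for p M
  proof -
    have "\<bar>\<Sum>j\<le>M. t p j\<bar> \<le> (\<Sum>j\<le>M. W * 4 ^ p * (\<tau> ^ j / fact j))"
      by (rule order.trans[OF sum_abs sum_mono]) (rule t)
    also have "\<dots> = W * 4 ^ p * (\<Sum>j\<le>M. \<tau> ^ j / fact j)" by (simp add: sum_distrib_left)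
    also have "\<dots> \<le> W * 4 ^ p * exp (2 * \<tau>)"
      using W assms by (intro mult_left_mono order.trans[OF exp_partial_sum_le[OF assms]]) auto
    finally show ?thesis by (simp add: K_def mult_ac)
  qed
  moreover have "\<bar>(\<Sum>j\<le>M. t p j) - exp_coeff \<tau> p\<bar> \<le> K * 4 ^ p * (1 / 2) ^ M" for p M
  proof -
    have "\<bar>t p j\<bar> \<le> K * 4 ^ p * (1 / 2) ^ j" for j
    proof -
      have "(2 * \<tau>) ^ j / fact j \<le> exp (2 * \<tau>)"
        using exp_partial_sum_le[of "2 * \<tau>" "{j}"] assms by simp
      hence "W * 4 ^ p * ((2 * \<tau>) ^ j / fact j * (1 / 2) ^ j) \<le> W * 4 ^ p * (exp (2 * \<tau>) * (1 / 2) ^ j)"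
        using W by (intro mult_left_mono mult_right_mono) auto
      moreover have "(2 * \<tau>) ^ j / fact j * (1 / 2) ^ j = \<tau> ^ j / fact j"
        by (simp add: power_mult_distrib power_divide)
      ultimately have "W * 4 ^ p * (\<tau> ^ j / fact j) \<le> K * 4 ^ p * (1 / 2) ^ j"
        by (simp only: K_def mult_ac)
      thus ?thesis using t[of p j] by linarith
    qed
    moreover have "(\<lambda>j. t p j) sums exp_coeff \<tau> p" unfolding t_def by (rule exp_coeff_sums)
    ultimately have "\<bar>(\<Sum>j<Suc M. t p j) - exp_coeff \<tau> p\<bar> \<le> K * 4 ^ p / (1 - 1 / 2) * (1 / 2) ^ Suc M"
      by (intro geometric_sums_tail_bound) auto
    thus ?thesis by (simp add: lessThan_Suc_atMost)
  qed
  moreover have "K \<ge> 0" using W by (simp add: K_def)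
  ultimately show ?thesis unfolding kappa_exp_partial_def t_def by blast
qed

text \<open>Exponentially small terms have the zero expansion. The factor
  \<open>real (Suc N)\<close> is the one that \<open>sum_Gamma_choose_le\<close> produces.\<close>

lemma half_power_bigo: "(\<lambda>N. real (Suc N) * (1 / 2) ^ (N - p)) \<in> O(\<lambda>N. inv_n N ^ m)"
proof -
  have big: "(\<lambda>N. real (Suc N) * ((1 / 2) ^ N * 2 ^ p)) \<in> O(\<lambda>N. (1 / real N) ^ m)"
    by real_asymp
  have "eventually (\<lambda>N. real (Suc N) * ((1 / 2) ^ N * 2 ^ p) = real (Suc N) * (1 / 2) ^ (N - p)) sequentially"
    using eventually_ge_at_top[of p]
  proof eventually_elim
    case (elim N)
    hence "(1 / 2 :: real) ^ N = (1 / 2) ^ (N - p) * (1 / 2) ^ p" by (simp add: power_add[symmetric])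
    thus ?case by (simp add: power_divide)
  qed
  from iffD1[OF landau_o.big.in_cong[OF this] big] show ?thesis unfolding inv_n_def .
qed

text \<open>\<open>\<tau> ^ p\<close> is the quotient of \<open>\<rho> ^ (N - p)\<close> by
  \<open>\<rho> ^ N\<close>. The sum can stop at \<open>p = i\<close> because
  \<open>Gamma_ratio_fps p\<close> starts in degree \<open>p\<close>.\<close>

definition expansion_fps :: "real \<Rightarrow> real fps" where
  "expansion_fps \<tau> = Abs_fps (\<lambda>i. \<Sum>p\<le>i. exp_coeff \<tau> p * \<tau> ^ p * Gamma_ratio_fps p $ i)"

lemma Gamma_ratio_le:
  assumes "m + i \<le> N" shows "Gamma_ratio (m + i) N \<le> Gamma_ratio m N / fact i"
proof -
  have "fact i * Gamma (real (N - (m + i)) + 3 / 2) \<le> Gamma (real (N - (m + i) + i) + 3 / 2)"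
    by (rule Gamma_fact_le)
  also have "N - (m + i) + i = N - m" using assms by simp
  finally have "Gamma (real (N - (m + i)) + 3 / 2) \<le> Gamma (real (N - m) + 3 / 2) / fact i"
    by (simp add: field_simps)
  hence "Gamma (real (N - (m + i)) + 3 / 2) / (fact N * sqrt (real N)) \<le>
      (Gamma (real (N - m) + 3 / 2) / fact i) / (fact N * sqrt (real N))"
    by (rule divide_right_mono) simp
  thus ?thesis by (simp add: Gamma_ratio_def mult_ac)
qed

lemma Gamma_ratio_nonneg: "Gamma_ratio p N \<ge> 0"
  unfolding Gamma_ratio_def by (intro divide_nonneg_nonneg Gamma_real_nonneg) auto

text \<open>The sum is cut at \<open>p = m\<close>. Below the cut, partial sums are replaced by
  \<open>exp_coeff\<close> at exponentially small cost, leaving finitely many known expansions.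
  Above it, every term is compared with \<open>Gamma_ratio (Suc m) N\<close>; by
  \<open>Gamma_ratio_le\<close> the quotients add up to at most a multiple of exp(4 tau), uniformly
  in \<open>N\<close>.\<close>

lemma asymp_n_main_sum:
  assumes \<tau>: "\<tau> > 0"
  shows "asymp_n (\<lambda>N. \<Sum>p\<le>N. Gamma_ratio p N * \<tau> ^ p * kappa_exp_partial \<tau> p (N - p)) (expansion_fps \<tau>)"
  unfolding asymp_fps_def
proof
  fix m
  define S where "S p M = kappa_exp_partial \<tau> p M" for p M
  obtain K where K: "K \<ge> 0" "\<And>p M. \<bar>S p M\<bar> \<le> K * 4 ^ p"
    "\<And>p M. \<bar>S p M - exp_coeff \<tau> p\<bar> \<le> K * 4 ^ p * (1 / 2) ^ M"
    using exp_coeff_partial_sums[of \<tau>] \<tau> unfolding S_def by auto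
  define A where "A = (\<Sum>p\<le>m. fps_const (exp_coeff \<tau> p * \<tau> ^ p) * Gamma_ratio_fps p)"
  have "asymp_n (\<lambda>N. \<Sum>p\<le>m. exp_coeff \<tau> p * \<tau> ^ p * Gamma_ratio p N) A"
    unfolding A_def by (intro asymp_fps_sum asymp_fps_cmult inv_n_tendsto asymp_n_Gamma_ratio)
  hence "(\<lambda>N. (\<Sum>p\<le>m. exp_coeff \<tau> p * \<tau> ^ p * Gamma_ratio p N) - (\<Sum>i\<le>m. A $ i * inv_n N ^ i)) \<in> O(\<lambda>N. inv_n N ^ Suc m)"
    by (rule asymp_fpsD)
  moreover have "A $ i = expansion_fps \<tau> $ i" if "i \<le> m" for i
    unfolding A_def expansion_fps_def fps_sum_nth fps_mult_left_const_nth fps_nth_Abs_fps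
    by (rule sum.mono_neutral_right) (use that Gamma_ratio_fps_nth_below in \<open>auto simp: not_le\<close>)
  ultimately have 1: "(\<lambda>N. (\<Sum>p\<le>m. exp_coeff \<tau> p * \<tau> ^ p * Gamma_ratio p N) -
      (\<Sum>i\<le>m. expansion_fps \<tau> $ i * inv_n N ^ i)) \<in> O(\<lambda>N. inv_n N ^ Suc m)"
    by simp
  have 2: "(\<lambda>N. \<Sum>p\<le>m. Gamma_ratio p N * \<tau> ^ p * (S p (N - p) - exp_coeff \<tau> p)) \<in> O(\<lambda>N. inv_n N ^ Suc m)"
  proof (rule big_sum_in_bigo)
    fix p
    have "Gamma_ratio p \<in> O(\<lambda>_. 1)" by (rule asymp_fps_poly_bound[OF inv_n_tendsto asymp_n_Gamma_ratio])
    moreover have "(\<lambda>N. S p (N - p) - exp_coeff \<tau> p) \<in> O(\<lambda>N. inv_n N ^ Suc m)"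
    proof (rule landau_o.big_trans[OF bigoI half_power_bigo])
      have "norm (S p (N - p) - exp_coeff \<tau> p) \<le> (K * 4 ^ p) * norm (real (Suc N) * (1 / 2) ^ (N - p))" for N
      proof -
        have "norm (S p (N - p) - exp_coeff \<tau> p) \<le> K * 4 ^ p * (1 * (1 / 2) ^ (N - p))" using K(3)[of p "N - p"] by simp
        also have "\<dots> \<le> K * 4 ^ p * (real (Suc N) * (1 / 2) ^ (N - p))"
          using K(1) by (intro mult_left_mono mult_right_mono) auto
        finally show ?thesis by simp
      qed
      thus "eventually (\<lambda>N. norm (S p (N - p) - exp_coeff \<tau> p) \<le> (K * 4 ^ p) * norm (real (Suc N) * (1 / 2) ^ (N - p))) sequentially"
        by simp
    qed
    ultimately have "(\<lambda>N. Gamma_ratio p N * (S p (N - p) - exp_coeff \<tau> p)) \<in> O(\<lambda>N. 1 * inv_n N ^ Suc m)"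
      by (rule landau_o.big.mult)
    hence "(\<lambda>N. \<tau> ^ p * (Gamma_ratio p N * (S p (N - p) - exp_coeff \<tau> p))) \<in> O(\<lambda>N. inv_n N ^ Suc m)"
      using \<tau> by simp
    thus "(\<lambda>N. Gamma_ratio p N * \<tau> ^ p * (S p (N - p) - exp_coeff \<tau> p)) \<in> O(\<lambda>N. inv_n N ^ Suc m)"
      by (simp only: mult_ac)
  qed
  have 3: "(\<lambda>N. \<Sum>p\<in>{m<..N}. Gamma_ratio p N * \<tau> ^ p * S p (N - p)) \<in> O(\<lambda>N. inv_n N ^ Suc m)"
  proof (rule landau_o.big_trans[OF bigoI Gamma_ratio_bigo[of "Suc m"]])
    define B where "B = K * (4 * \<tau>) ^ Suc m * exp (4 * \<tau>)"
    have "norm (\<Sum>p\<in>{m<..N}. Gamma_ratio p N * \<tau> ^ p * S p (N - p)) \<le> B * norm (Gamma_ratio (Suc m) N)"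
      for N
    proof -
      have "norm (\<Sum>p\<in>{m<..N}. Gamma_ratio p N * \<tau> ^ p * S p (N - p)) \<le>
          (\<Sum>p\<in>{m<..N}. Gamma_ratio (Suc m) N * (K * (4 * \<tau>) ^ Suc m) * ((4 * \<tau>) ^ (p - Suc m) / fact (p - Suc m)))"
      proof (rule sum_norm_le)
        fix p assume p: "p \<in> {m<..N}"
        then obtain i where i: "p = Suc m + i" by (metis Suc_le_eq greaterThanAtMost_iff le_iff_add)
        have "norm (Gamma_ratio p N * \<tau> ^ p * S p (N - p)) = Gamma_ratio p N * (\<tau> ^ p * \<bar>S p (N - p)\<bar>)"
          using \<tau> Gamma_ratio_nonneg[of p N] by (simp add: abs_mult)
        also have "\<dots> \<le> Gamma_ratio (Suc m) N / fact i * (\<tau> ^ p * (K * 4 ^ p))"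
          using p \<tau> K(1) Gamma_ratio_nonneg unfolding i
          by (intro mult_mono Gamma_ratio_le mult_left_mono K(2)) auto
        also have "\<tau> ^ p * (K * 4 ^ p) = K * (4 * \<tau>) ^ Suc m * (4 * \<tau>) ^ i"
          by (simp only: i power_add power_mult_distrib mult_ac)
        finally show "norm (Gamma_ratio p N * \<tau> ^ p * S p (N - p)) \<le>
          Gamma_ratio (Suc m) N * (K * (4 * \<tau>) ^ Suc m) * ((4 * \<tau>) ^ (p - Suc m) / fact (p - Suc m))"
          by (simp add: i mult_ac)
      qed
      also have "\<dots> = Gamma_ratio (Suc m) N * (K * (4 * \<tau>) ^ Suc m) *
          (\<Sum>p\<in>{m<..N}. (4 * \<tau>) ^ (p - Suc m) / fact (p - Suc m))"
        by (simp only: sum_distrib_left)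
      also have "(\<Sum>p\<in>{m<..N}. (4 * \<tau>) ^ (p - Suc m) / fact (p - Suc m)) =
          (\<Sum>i\<in>(\<lambda>p. p - Suc m) ` {m<..N}. (4 * \<tau>) ^ i / fact i)"
        by (subst sum.reindex) (auto intro!: inj_onI)
      also have "Gamma_ratio (Suc m) N * (K * (4 * \<tau>) ^ Suc m) * \<dots> \<le>
          Gamma_ratio (Suc m) N * (K * (4 * \<tau>) ^ Suc m) * exp (4 * \<tau>)"
        using \<tau> K(1) Gamma_ratio_nonneg by (intro mult_left_mono exp_partial_sum_le mult_nonneg_nonneg) auto
      finally show ?thesis using Gamma_ratio_nonneg[of "Suc m" N] by (simp add: B_def mult_ac)
    qed
    thus "eventually (\<lambda>N. norm (\<Sum>p\<in>{m<..N}. Gamma_ratio p N * \<tau> ^ p * S p (N - p)) \<le> B * norm (Gamma_ratio (Suc m) N)) sequentially"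
      by simp
  qed
  have "eventually (\<lambda>N. ((\<Sum>p\<le>m. exp_coeff \<tau> p * \<tau> ^ p * Gamma_ratio p N) -
      (\<Sum>i\<le>m. expansion_fps \<tau> $ i * inv_n N ^ i)) +
      (\<Sum>p\<le>m. Gamma_ratio p N * \<tau> ^ p * (S p (N - p) - exp_coeff \<tau> p)) +
      (\<Sum>p\<in>{m<..N}. Gamma_ratio p N * \<tau> ^ p * S p (N - p)) =
      (\<Sum>p\<le>N. Gamma_ratio p N * \<tau> ^ p * S p (N - p)) - (\<Sum>i\<le>m. expansion_fps \<tau> $ i * inv_n N ^ i)) sequentially"
    using eventually_ge_at_top[of m]
  proof eventually_elim
    case (elim N)
    have "{..N} = {..m} \<union> {m<..N}" using elim by auto
    hence "(\<Sum>p\<le>N. Gamma_ratio p N * \<tau> ^ p * S p (N - p)) =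
        (\<Sum>p\<le>m. Gamma_ratio p N * \<tau> ^ p * S p (N - p)) + (\<Sum>p\<in>{m<..N}. Gamma_ratio p N * \<tau> ^ p * S p (N - p))"
      by (simp only:) (rule sum.union_disjoint, auto)
    moreover have "(\<Sum>p\<le>m. Gamma_ratio p N * \<tau> ^ p * S p (N - p)) =
        (\<Sum>p\<le>m. exp_coeff \<tau> p * \<tau> ^ p * Gamma_ratio p N) +
        (\<Sum>p\<le>m. Gamma_ratio p N * \<tau> ^ p * (S p (N - p) - exp_coeff \<tau> p))"
      unfolding sum.distrib[symmetric] by (intro sum.cong refl) (simp add: algebra_simps)
    ultimately show ?case by simp
  qed
  from iffD1[OF landau_o.big.in_cong[OF this] sum_in_bigo(1)[OF sum_in_bigo(1)[OF 1 2] 3]]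
  show "(\<lambda>N. (\<Sum>p\<le>N. Gamma_ratio p N * \<tau> ^ p * kappa_exp_partial \<tau> p (N - p)) -
      (\<Sum>i\<le>m. expansion_fps \<tau> $ i * inv_n N ^ i)) \<in> O(\<lambda>N. inv_n N ^ Suc m)"
    unfolding S_def .
qed

text \<open>The coefficients of \<open>ln_quot\<close> have modulus at most 1 and those of
  \<open>fps_binomial (1 / 24)\<close> at most 2, so the product is dominated by 2 (1 -
  x)^(-(n+1)).\<close>

lemma abs_ln_coeff_le:
  assumes "n \<le> N" shows "\<bar>(fps_binomial (1 / 24) * fps_ln 1 ^ n) $ N\<bar> \<le> 2 * real (N choose n)"
proof -
  have bound: "\<bar>(fps_binomial (1 / 24) * ln_quot ^ n) $ k\<bar> \<le> 2 * real ((n + k) choose n)" for k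
  proof (induction n arbitrary: k)
    case 0
    show ?case using abs_gbinomial_le_2[of "1 / 24" k] by simp
  next
    case (Suc n)
    have "\<bar>(fps_binomial (1 / 24) * ln_quot ^ Suc n) $ k\<bar> =
        \<bar>\<Sum>i\<le>k. (fps_binomial (1 / 24) * ln_quot ^ n) $ i * ln_quot $ (k - i)\<bar>"
      by (simp only: power_Suc2 mult.assoc[symmetric] fps_mult_nth[of _ ln_quot] atLeast0AtMost)
    also have "\<dots> \<le> (\<Sum>i\<le>k. 2 * real ((n + i) choose n))"
    proof (rule order.trans[OF sum_abs sum_mono])
      fix i
      have "\<bar>ln_quot $ (k - i)\<bar> \<le> 1" by (simp add: ln_quot_def abs_mult power_abs)
      hence "\<bar>(fps_binomial (1 / 24) * ln_quot ^ n) $ i\<bar> * \<bar>ln_quot $ (k - i)\<bar> \<le> 2 * real ((n + i) choose n) * 1"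
        by (intro mult_mono Suc.IH) auto
      thus "\<bar>(fps_binomial (1 / 24) * ln_quot ^ n) $ i * ln_quot $ (k - i)\<bar> \<le> 2 * real ((n + i) choose n)"
        by (simp add: abs_mult)
    qed
    also have "\<dots> = 2 * real (\<Sum>i\<le>k. (n + i) choose n)" by (simp add: sum_distrib_left)
    also have "(\<Sum>i\<le>k. (n + i) choose n) = (Suc n + k) choose Suc n"
      using choose_rising_sum(1)[of n k] by simp
    finally show ?case .
  qed
  have "fps_binomial (1 / 24) * fps_ln 1 ^ n = fps_X ^ n * (fps_binomial (1 / 24) * ln_quot ^ n)"
    by (simp only: fps_ln_eq power_mult_distrib mult_ac)
  hence "(fps_binomial (1 / 24) * fps_ln 1 ^ n) $ N = (fps_binomial (1 / 24) * ln_quot ^ n) $ (N - n)"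
    using assms by (simp only: fps_X_power_mult_nth) simp
  thus ?thesis using bound[of "N - n"] assms by simp
qed

text \<open>With Gamma(n + 3/2) bounded by (n+1)!, the \<open>n\<close>-th term is at most N! (n+1)
  x^n / (N-n)!; reversed, the sum is part of the series of exp(1/x). Taken at x = rho/2 it is
  smaller than N! rho^N by a factor of order N / 2^N.\<close>

lemma sum_Gamma_choose_le:
  fixes x :: real
  assumes "x > 0"
  shows "(\<Sum>n\<le>N. Gamma (real n + 3 / 2) * x ^ n * real (N choose n)) \<le> fact N * (real (Suc N) * (x ^ N * exp (1 / x)))"
proof -
  have "(\<Sum>n\<le>N. Gamma (real n + 3 / 2) * x ^ n * real (N choose n)) \<le>
      (\<Sum>n\<le>N. fact N * (real (Suc N) * x ^ N) * ((1 / x) ^ (N - n) / fact (N - n)))"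
  proof (rule sum_mono)
    fix n assume n: "n \<in> {..N}"
    have "Gamma (real n + 3 / 2) * x ^ n * real (N choose n) \<le> fact (Suc n) * x ^ n * real (N choose n)"
      using Gamma_le_fact assms by (intro mult_right_mono) auto
    also have "\<dots> = fact N * (real (Suc n) * x ^ n) * (1 / fact (N - n))"
      using n by (simp add: binomial_fact)
    also have "\<dots> \<le> fact N * (real (Suc N) * x ^ n) * (1 / fact (N - n))"
      using n assms by (intro mult_right_mono mult_left_mono) auto
    also have "\<dots> = fact N * (real (Suc N) * (x ^ N * (1 / x) ^ (N - n))) * (1 / fact (N - n))"
    proof -
      have "x ^ n = x ^ N * (1 / x) ^ (N - n)" using n assms by (simp add: power_divide power_diff)
      thus ?thesis by simp
    qed
    finally show "Gamma (real n + 3 / 2) * x ^ n * real (N choose n) \<le>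
        fact N * (real (Suc N) * x ^ N) * ((1 / x) ^ (N - n) / fact (N - n))"
      by (simp add: mult_ac)
  qed
  also have "\<dots> = fact N * (real (Suc N) * x ^ N) * (\<Sum>n\<le>N. (1 / x) ^ (N - n) / fact (N - n))"
    by (simp only: sum_distrib_left)
  also have "(\<Sum>n\<le>N. (1 / x) ^ (N - n) / fact (N - n)) = (\<Sum>k\<in>(\<lambda>n. N - n) ` {..N}. (1 / x) ^ k / fact k)"
    by (subst sum.reindex) (auto intro!: inj_onI)
  also have "fact N * (real (Suc N) * x ^ N) * \<dots> \<le> fact N * (real (Suc N) * x ^ N) * exp (1 / x)"
    using assms by (intro mult_left_mono exp_partial_sum_le) auto
  finally show ?thesis by (simp add: mult_ac)
qed

definition rigid_fps :: "real fps" where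
  "rigid_fps = fps_const (12 * sqrt 3 / pi powr (5 / 2)) * expansion_fps (pi\<^sup>2 / 6)"

text \<open>\<open>kz_coeff\<close> is replaced by its leading term. That part is rearranged by
  \<open>sum_Gamma_coeff\<close> into the main sum; the rest, bounded termwise with absolute values,
  has the zero expansion.\<close>

theorem asymp_n_num_rigid_interval_orders:
  "asymp_n (\<lambda>N. real (num_rigid_interval_orders N) / (fact N * sqrt (real N) * (6 / pi\<^sup>2) ^ N))
     rigid_fps"
proof -
  define \<rho> where "\<rho> = 6 / pi\<^sup>2"
  define \<tau> where "\<tau> = pi\<^sup>2 / 6"
  define C0 where "C0 = 12 * sqrt 3 / pi powr (5 / 2)"
  define b :: "nat \<Rightarrow> nat \<Rightarrow> real" where "b N n = (fps_binomial (1 / 24) * fps_ln 1 ^ n) $ N" for N n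
  define err where "err n = kz_coeff n - C0 * Gamma (real n + 3 / 2) * \<rho> ^ n" for n
  define d where "d N = fact N * sqrt (real N) * \<rho> ^ N" for N
  have \<rho>: "\<rho> > 0" "1 / \<rho> = \<tau>" and \<tau>: "\<tau> > 0" by (simp_all add: \<rho>_def \<tau>_def)
  obtain C where C: "\<And>n. \<bar>err n\<bar> \<le> C * Gamma (real n + 3 / 2) * (\<rho> / 2) ^ n"
    using kz_coeff_asymptotics unfolding err_def \<rho>_def C0_def by auto
  have C_nonneg: "C \<ge> 0"
  proof -
    have "0 \<le> C * Gamma (3 / 2)" using C[of 0] by (simp add: order_trans[OF abs_ge_zero])
    moreover have "Gamma (3 / 2 :: real) > 0" by (rule Gamma_real_pos) simp
    ultimately show ?thesis by (simp add: zero_le_mult_iff)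
  qed
  have "asymp_n (\<lambda>N. C0 * (\<Sum>p\<le>N. Gamma_ratio p N * \<tau> ^ p * kappa_exp_partial \<tau> p (N - p))) (fps_const C0 * expansion_fps \<tau>)"
    by (intro asymp_fps_cmult inv_n_tendsto asymp_n_main_sum \<tau>)
  moreover have "asymp_n (\<lambda>N. (\<Sum>n\<le>N. err n * b N n) / d N) (fps_const 0)"
    unfolding asymp_fps_def
  proof
    fix m
    have "(\<lambda>N. (\<Sum>n\<le>N. err n * b N n) / d N) \<in> O(\<lambda>N. inv_n N ^ Suc m)"
    proof (rule landau_o.big_trans[OF bigoI half_power_bigo[of 0]])
      define B where "B = 2 * C * exp (1 / (\<rho> / 2))"
      have "norm ((\<Sum>n\<le>N. err n * b N n) / d N) \<le> B * norm (real (Suc N) * (1 / 2) ^ (N - 0))" if N: "N > 0" for N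
      proof -
        have "\<bar>\<Sum>n\<le>N. err n * b N n\<bar> \<le> (\<Sum>n\<le>N. 2 * C * (Gamma (real n + 3 / 2) * (\<rho> / 2) ^ n * real (N choose n)))"
        proof (rule order.trans[OF sum_abs sum_mono])
          fix n assume n: "n \<in> {..N}"
          have "\<bar>err n\<bar> * \<bar>b N n\<bar> \<le> C * Gamma (real n + 3 / 2) * (\<rho> / 2) ^ n * (2 * real (N choose n))"
            unfolding b_def using n C_nonneg \<rho>(1)
            by (intro mult_mono C abs_ln_coeff_le mult_nonneg_nonneg Gamma_real_nonneg) auto
          thus "\<bar>err n * b N n\<bar> \<le> 2 * C * (Gamma (real n + 3 / 2) * (\<rho> / 2) ^ n * real (N choose n))"
            by (simp only: abs_mult mult_ac)
        qed
        also have "\<dots> = 2 * C * (\<Sum>n\<le>N. Gamma (real n + 3 / 2) * (\<rho> / 2) ^ n * real (N choose n))"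
          by (simp only: sum_distrib_left)
        also have "\<dots> \<le> 2 * C * (fact N * (real (Suc N) * ((\<rho> / 2) ^ N * exp (1 / (\<rho> / 2)))))"
          using C_nonneg \<rho>(1) by (intro mult_left_mono sum_Gamma_choose_le) auto
        also have "\<dots> = B * (real (Suc N) * (1 / 2) ^ N) * (fact N * 1 * \<rho> ^ N)"
          by (simp add: B_def power_divide)
        also have "\<dots> \<le> B * (real (Suc N) * (1 / 2) ^ N) * d N"
          unfolding d_def using N C_nonneg \<rho>(1) by (intro mult_left_mono mult_right_mono) (auto simp: B_def)
        finally have "\<bar>\<Sum>n\<le>N. err n * b N n\<bar> \<le> B * (real (Suc N) * (1 / 2) ^ N) * d N" .
        moreover have "d N > 0" using N \<rho>(1) by (simp add: d_def)
        ultimately show ?thesis by (simp add: field_simps)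
      qed
      thus "eventually (\<lambda>N. norm ((\<Sum>n\<le>N. err n * b N n) / d N) \<le> B * norm (real (Suc N) * (1 / 2) ^ (N - 0))) sequentially"
        by (intro eventually_mono[OF eventually_gt_at_top[of 0]])
    qed
    thus "(\<lambda>N. (\<Sum>n\<le>N. err n * b N n) / d N - (\<Sum>i\<le>m. fps_const 0 $ i * inv_n N ^ i)) \<in> O(\<lambda>N. inv_n N ^ Suc m)"
      by simp
  qed
  ultimately have "asymp_n (\<lambda>N. C0 * (\<Sum>p\<le>N. Gamma_ratio p N * \<tau> ^ p * kappa_exp_partial \<tau> p (N - p)) + (\<Sum>n\<le>N. err n * b N n) / d N)
      (fps_const C0 * expansion_fps \<tau> + fps_const 0)"
    by (rule asymp_fps_add)
  moreover have "C0 * (\<Sum>p\<le>N. Gamma_ratio p N * \<tau> ^ p * kappa_exp_partial \<tau> p (N - p)) + (\<Sum>n\<le>N. err n * b N n) / d N =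
      real (num_rigid_interval_orders N) / d N" for N
  proof -
    have "(\<Sum>p\<le>N. Gamma_ratio p N * \<tau> ^ p * kappa_exp_partial \<tau> p (N - p)) =
        (\<Sum>p\<le>N. Gamma (real (N - p) + 3 / 2) * \<rho> ^ (N - p) * kappa_exp_partial \<tau> p (N - p)) / d N"
      unfolding sum_divide_distrib
    proof (intro sum.cong refl)
      fix p assume "p \<in> {..N}"
      hence "\<rho> ^ N = \<rho> ^ (N - p) * \<rho> ^ p" by (simp add: power_add[symmetric])
      hence "\<rho> ^ (N - p) / \<rho> ^ N = \<tau> ^ p" unfolding \<rho>(2)[symmetric] using \<rho>(1) by (simp add: power_divide)
      hence "Gamma_ratio p N * \<tau> ^ p = Gamma (real (N - p) + 3 / 2) * \<rho> ^ (N - p) / d N"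
        unfolding Gamma_ratio_def d_def by (metis times_divide_times_eq)
      thus "Gamma_ratio p N * \<tau> ^ p * kappa_exp_partial \<tau> p (N - p) =
          Gamma (real (N - p) + 3 / 2) * \<rho> ^ (N - p) * kappa_exp_partial \<tau> p (N - p) / d N"
        by simp
    qed
    also have "\<dots> = (\<Sum>n\<le>N. Gamma (real n + 3 / 2) * \<rho> ^ n * b N n) / d N"
      unfolding b_def sum_Gamma_coeff[OF \<rho>(1)] kappa_exp_partial_def \<rho>(2) ..
    finally have "C0 * (\<Sum>p\<le>N. Gamma_ratio p N * \<tau> ^ p * kappa_exp_partial \<tau> p (N - p)) + (\<Sum>n\<le>N. err n * b N n) / d N =
      (C0 * (\<Sum>n\<le>N. Gamma (real n + 3 / 2) * \<rho> ^ n * b N n) + (\<Sum>n\<le>N. err n * b N n)) / d N"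
      by (simp add: add_divide_distrib)
    also have "C0 * (\<Sum>n\<le>N. Gamma (real n + 3 / 2) * \<rho> ^ n * b N n) + (\<Sum>n\<le>N. err n * b N n) =
        (\<Sum>n\<le>N. kz_coeff n * b N n)"
      unfolding sum_distrib_left sum.distrib[symmetric]
      by (intro sum.cong refl) (simp add: err_def algebra_simps)
    finally show ?thesis unfolding num_rigid_interval_orders_eq_sum b_def .
  qed
  ultimately show ?thesis by (simp add: d_def \<rho>_def \<tau>_def C0_def rigid_fps_def)
qed

section \<open>Computability\<close>

text \<open>A program for \<open>f\<close> may be run on any sufficiently long prefix of the environment, so that
  no arities have to be tracked.\<close>
definition rec_env :: "((nat \<Rightarrow> nat) \<Rightarrow> nat) \<Rightarrow> bool" where
  "rec_env f \<longleftrightarrow> (\<exists>k p. \<forall>e. \<forall>k'\<ge>k. computes p (map e [0..<k']) (f e))"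

lemma rec_env_var: "rec_env (\<lambda>e. e i)"
proof -
  have "computes (Proj i) (map e [0..<k']) (e i)" if "k' \<ge> Suc i" for e k'
    using computes.proj[of i "map e [0..<k']"] that by simp
  thus ?thesis unfolding rec_env_def by blast
qed

text \<open>Although \<open>a\<close> is an infinite family, the program for \<open>F\<close> reads
  only the first \<open>k0\<close> entries, so finitely many programs are composed.\<close>

lemma rec_env_subst:
  assumes "rec_env F" "\<And>i. rec_env (a i)"
  shows "rec_env (\<lambda>e. F (\<lambda>i. a i e))"
proof -
  obtain k0 P where P: "\<And>e k'. k' \<ge> k0 \<Longrightarrow> computes P (map e [0..<k']) (F e)"
    using assms(1) unfolding rec_env_def by blast
  have "\<forall>i. \<exists>k p. \<forall>e. \<forall>k'\<ge>k. computes p (map e [0..<k']) (a i e)"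
    using assms(2) unfolding rec_env_def by blast
  then obtain k q where q: "\<And>i e k'. k' \<ge> k i \<Longrightarrow> computes (q i) (map e [0..<k']) (a i e)"
    by metis
  define K where "K = (\<Sum>i<k0. k i)"
  have K: "k i \<le> K" if "i < k0" for i
    unfolding K_def using that by (intro member_le_sum) auto
  have "computes (Comp P (map q [0..<k0])) (map e [0..<k']) (F (\<lambda>i. a i e))" if "k' \<ge> K" for e k'
  proof (rule computes.comp)
    show "list_all2 (\<lambda>g y. computes g (map e [0..<k']) y) (map q [0..<k0])
            (map (\<lambda>i. a i e) [0..<k0])"
      using q order_trans[OF K that] by (auto simp: list_all2_map1 list_all2_map2 list_all2_same)
    show "computes P (map (\<lambda>i. a i e) [0..<k0]) (F (\<lambda>i. a i e))"
      by (rule P) simp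
  qed
  thus ?thesis unfolding rec_env_def by blast
qed

lemma rec_env_Suc:
  assumes "rec_env f" shows "rec_env (\<lambda>e. Suc (f e))"
proof -
  obtain k P where P: "\<And>e k'. k' \<ge> k \<Longrightarrow> computes P (map e [0..<k']) (f e)"
    using assms(1) unfolding rec_env_def by blast
  have "computes (Comp Succ [P]) (map e [0..<k']) (Suc (f e))" if "k' \<ge> k" for e k'
    by (rule computes.comp[where ys = "[f e]"]) (use P that computes.succ in auto)
  thus ?thesis unfolding rec_env_def by blast
qed

lemma rec_env_const: "rec_env (\<lambda>e. c)"
proof (induction c)
  case 0
  show ?case unfolding rec_env_def using computes.zero by blast
qed (rule rec_env_Suc)

text \<open>Bound variables are de Bruijn indices: counter and accumulator occupy positions 0 and 1,
  and the ambient environment is shifted by two. Projections first cut the input to a fixed length,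
  to which the primitive recursion is then applied.\<close>

lemma rec_env_rec_nat:
  assumes "rec_env N" "rec_env b" "rec_env (\<lambda>e. G (e 0) (e (Suc 0)) (\<lambda>i. e (Suc (Suc i))))"
  shows "rec_env (\<lambda>e. rec_nat (b e) (\<lambda>n y. G n y e) (N e))"
proof -
  obtain kb B where B: "\<And>e k'. k' \<ge> kb \<Longrightarrow> computes B (map e [0..<k']) (b e)"
    using assms(2) unfolding rec_env_def by blast
  obtain kn pN where N: "\<And>e k'. k' \<ge> kn \<Longrightarrow> computes pN (map e [0..<k']) (N e)"
    using assms(1) unfolding rec_env_def by blast
  obtain kg pG where G: "\<And>e k'. k' \<ge> kg \<Longrightarrow>
      computes pG (map e [0..<k']) (G (e 0) (e (Suc 0)) (\<lambda>i. e (Suc (Suc i))))"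
    using assms(3) unfolding rec_env_def by blast
  define k where "k = kb + kg + kn"
  have step: "computes pG (n # y # map e [0..<k]) (G n y e)" for n y e
  proof -
    define e' where "e' i = (if i = 0 then n else if i = 1 then y else e (i - 2))" for i
    have "map e' [0..<Suc (Suc k)] = n # y # map e [0..<k]"
      by (rule nth_equalityI) (auto simp: e'_def nth_Cons' numeral_2_eq_2 simp del: upt_Suc)
    moreover have "(\<lambda>i. e' (Suc (Suc i))) = e" "e' 0 = n" "e' (Suc 0) = y" by (auto simp: e'_def)
    ultimately show ?thesis using G[of "Suc (Suc k)" e'] by (simp add: k_def)
  qed
  have rec: "computes (PrimRec B pG) (n # map e [0..<k]) (rec_nat (b e) (\<lambda>n y. G n y e) n)" for n e
  proof (induction n)
    case 0
    show ?case using computes.prim0[OF B[of k e]] by (simp add: k_def)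
  next
    case (Suc n)
    show ?case using computes.primS[OF Suc step] by simp
  qed
  have "computes (Comp (PrimRec B pG) (pN # map Proj [0..<k])) (map e [0..<k'])
          (rec_nat (b e) (\<lambda>n y. G n y e) (N e))" if "k' \<ge> k" for e k'
  proof (rule computes.comp)
    have "computes (Proj i) (map e [0..<k']) (e i)" if "i < k" for i
      using computes.proj[of i "map e [0..<k']"] that \<open>k' \<ge> k\<close> by simp
    moreover have "computes pN (map e [0..<k']) (N e)" using N that by (simp add: k_def)
    ultimately show "list_all2 (\<lambda>g y. computes g (map e [0..<k']) y) (pN # map Proj [0..<k])
            (N e # map e [0..<k])"
      by (auto simp: list_all2_map1 list_all2_map2 list_all2_same)
  qed (rule rec)
  thus ?thesis unfolding rec_env_def by blast
qed

lemma computable2_if_rec_env: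
  assumes "rec_env (\<lambda>e. f (e 0) (e (Suc 0)))"
  shows "computable2 f"
proof -
  obtain k P where P: "\<And>e k'. k' \<ge> k \<Longrightarrow> computes P (map e [0..<k']) (f (e 0) (e (Suc 0)))"
    using assms unfolding rec_env_def by blast
  \<comment> \<open>The two inputs are padded with zeros to a prefix long enough for
    \<open>P\<close>.\<close>
  have "computes (Comp P (Proj 0 # Proj 1 # map (\<lambda>_. Zero) [0..<k])) [i, j] (f i j)" for i j
  proof (rule computes.comp)
    have "computes (Proj 0) [i, j] i" "computes (Proj 1) [i, j] j"
      using computes.proj[of 0 "[i, j]"] computes.proj[of 1 "[i, j]"] by auto
    thus "list_all2 (\<lambda>g y. computes g [i, j] y) (Proj 0 # Proj 1 # map (\<lambda>_. Zero) [0..<k])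
            (i # j # map (\<lambda>_. 0) [0..<k])"
      by (auto simp: list_all2_map1 list_all2_map2 list_all2_same intro: computes.zero)
    define e where "e n = (if n = 0 then i else if n = 1 then j else 0)" for n :: nat
    have "map e [0..<Suc (Suc k)] = i # j # map (\<lambda>_. 0) [0..<k]"
      by (rule nth_equalityI) (auto simp: e_def nth_Cons' simp del: upt_Suc)
    thus "computes P (i # j # map (\<lambda>_. 0) [0..<k]) (f i j)"
      using P[of "Suc (Suc k)" e] by (simp add: e_def)
  qed
  thus ?thesis unfolding computable2_def by blast
qed

lemma rec_env_add:
  assumes "rec_env f" "rec_env g" shows "rec_env (\<lambda>e. f e + g e)"
proof -
  have "rec_env (\<lambda>e. rec_nat (f e) (\<lambda>n y. Suc y) (g e))"
    by (intro rec_env_rec_nat rec_env_Suc rec_env_var assms)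
  moreover have "rec_nat a (\<lambda>n y. Suc y) b = a + b" for a b by (induction b) auto
  ultimately show ?thesis by simp
qed

lemma rec_env_mult:
  assumes "rec_env f" "rec_env g" shows "rec_env (\<lambda>e. f e * g e)"
proof -
  have "rec_env (\<lambda>e. rec_nat 0 (\<lambda>n y. y + f e) (g e))"
    by (intro rec_env_rec_nat rec_env_const rec_env_add rec_env_var assms
        rec_env_subst[OF assms(1)])
  moreover have "rec_nat 0 (\<lambda>n y. y + a) b = a * b" for a b :: nat by (induction b) auto
  ultimately show ?thesis by simp
qed

lemma rec_env_diff:
  assumes "rec_env f" "rec_env g" shows "rec_env (\<lambda>e. f e - g e)"
proof -
  have pre: "rec_env (\<lambda>e. rec_nat 0 (\<lambda>n y. n) (h e))" if "rec_env h" for h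
    by (intro rec_env_rec_nat rec_env_const rec_env_var that)
  have "rec_env (\<lambda>e. rec_nat (f e) (\<lambda>n y. rec_nat 0 (\<lambda>n y. n) y) (g e))"
    by (intro rec_env_rec_nat[where G = "\<lambda>n y e. rec_nat 0 (\<lambda>n y. n) y"] pre rec_env_var assms)
  moreover have "rec_nat 0 (\<lambda>n y. n) b = b - 1" for b :: nat by (cases b) auto
  moreover have "rec_nat a (\<lambda>n y. y - 1) b = a - b" for a b :: nat by (induction b) auto
  ultimately show ?thesis by simp
qed

lemma rec_env_if_eq_0:
  assumes "rec_env c" "rec_env f" "rec_env g" shows "rec_env (\<lambda>e. if c e = 0 then f e else g e)"
proof -
  have "rec_env (\<lambda>e. rec_nat (f e) (\<lambda>n y. g e) (c e))"
    by (intro rec_env_rec_nat assms rec_env_subst[OF assms(3)] rec_env_var)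
  moreover have "rec_nat a (\<lambda>n y. b) k = (if k = 0 then a else b)" for a b k :: nat
    by (cases k) auto
  ultimately show ?thesis by simp
qed

lemma rec_env_if_le:
  assumes "rec_env a" "rec_env b" "rec_env f" "rec_env g"
  shows "rec_env (\<lambda>e. if a e \<le> b e then f e else g e)"
  using rec_env_if_eq_0[OF rec_env_diff[OF assms(1,2)] assms(3,4)] by simp

lemma rec_env_sum:
  assumes "rec_env B" "rec_env (\<lambda>e. G (e 0) (\<lambda>i. e (Suc i)))"
  shows "rec_env (\<lambda>e. \<Sum>c<B e. G c e)"
proof -
  have "rec_env (\<lambda>e. G (e 0) (\<lambda>i. e (Suc (Suc i))))"
    using rec_env_subst[OF assms(2), of "\<lambda>i e. e (if i = 0 then 0 else Suc i)"]
    by (simp add: rec_env_var)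
  hence "rec_env (\<lambda>e. rec_nat 0 (\<lambda>n y. y + G n e) (B e))"
    by (intro rec_env_rec_nat rec_env_const rec_env_add rec_env_var assms)
  moreover have "rec_nat 0 (\<lambda>n y. y + G n e) b = (\<Sum>c<b. G c e)" for b e by (induction b) auto
  ultimately show ?thesis by simp
qed

lemma rec_env_prod:
  assumes "rec_env B" "rec_env (\<lambda>e. G (e 0) (\<lambda>i. e (Suc i)))"
  shows "rec_env (\<lambda>e. \<Prod>c<B e. G c e)"
proof -
  have "rec_env (\<lambda>e. G (e 0) (\<lambda>i. e (Suc (Suc i))))"
    using rec_env_subst[OF assms(2), of "\<lambda>i e. e (if i = 0 then 0 else Suc i)"]
    by (simp add: rec_env_var)
  hence "rec_env (\<lambda>e. rec_nat 1 (\<lambda>n y. y * G n e) (B e))"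
    by (intro rec_env_rec_nat rec_env_const rec_env_mult rec_env_var assms)
  moreover have "rec_nat 1 (\<lambda>n y. y * G n e) b = (\<Prod>c<b. G c e)" for b e by (induction b) auto
  ultimately show ?thesis by simp
qed

lemmas rec_env_intros = rec_env_var rec_env_const rec_env_Suc rec_env_add rec_env_mult rec_env_diff
  rec_env_if_eq_0 rec_env_if_le rec_env_sum rec_env_prod

lemma rec_env_if_eq:
  assumes "rec_env a" "rec_env b" "rec_env f" "rec_env g"
  shows "rec_env (\<lambda>e. if a e = b e then f e else g e)"
proof -
  have "rec_env (\<lambda>e. if (a e - b e) + (b e - a e) = 0 then f e else g e)"
    by (intro rec_env_intros assms)
  moreover have "(a e - b e) + (b e - a e) = 0 \<longleftrightarrow> a e = b e" for e by auto
  ultimately show ?thesis by simp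
qed

lemma rec_env_shift:
  assumes "rec_env f" shows "rec_env (\<lambda>e. f (\<lambda>i. e (Suc i)))"
  by (intro rec_env_subst[OF assms] rec_env_var)

lemma rec_env_power:
  assumes "rec_env f" "rec_env g" shows "rec_env (\<lambda>e. f e ^ g e)"
proof -
  have "rec_env (\<lambda>e. \<Prod>c<g e. f e)"
    by (intro rec_env_intros rec_env_shift[OF assms(1)] assms)
  thus ?thesis by simp
qed

lemma rec_env_div:
  assumes "rec_env f" "rec_env g" shows "rec_env (\<lambda>e. f e div g e)"
proof -
  \<comment> \<open>The quotient counts the positive multiples of the divisor up to the dividend;
    division by 0 yields 0 as in HOL.\<close>
  have "rec_env (\<lambda>e. if g e = 0 then 0 else \<Sum>c<f e. if Suc c * g e \<le> f e then 1 else 0)"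
    by (intro rec_env_intros rec_env_shift[OF assms(1)] rec_env_shift[OF assms(2)] assms)
  moreover have "(if b = 0 then 0 else \<Sum>c<a. if Suc c * b \<le> a then 1 else 0) = a div b"
    for a b :: nat
  proof (cases "b = 0")
    case False
    have "(\<Sum>c<a. if Suc c * b \<le> a then 1 else 0) = card {c \<in> {..<a}. Suc c * b \<le> a}"
      by (simp add: sum.If_cases Int_def)
    also have "{c \<in> {..<a}. Suc c * b \<le> a} = {..<a div b}"
    proof -
      have "Suc c * b \<le> a \<longleftrightarrow> c < a div b" for c
        using False by (metis Suc_le_eq less_eq_div_iff_mult_less_eq neq0_conv)
      moreover have "a div b \<le> a" by simp
      ultimately show ?thesis
        by (intro set_eqI) (metis (lifting) lessThan_iff less_le_trans mem_Collect_eq)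
    qed
    finally show ?thesis using False by (simp only: card_lessThan if_False)
  qed simp
  ultimately show ?thesis by (simp only:)
qed

lemma rec_env_mod:
  assumes "rec_env f" "rec_env g" shows "rec_env (\<lambda>e. f e mod g e)"
  unfolding modulo_nat_def by (intro rec_env_intros rec_env_div assms)

section \<open>Rational-valued functions of an environment\<close>

definition rat_repr ::
  "((nat \<Rightarrow> nat) \<Rightarrow> nat) \<Rightarrow> ((nat \<Rightarrow> nat) \<Rightarrow> nat) \<Rightarrow> ((nat \<Rightarrow> nat) \<Rightarrow> nat) \<Rightarrow> ((nat \<Rightarrow> nat) \<Rightarrow> real) \<Rightarrow> bool" where
  "rat_repr u v q g \<longleftrightarrow> rec_env u \<and> rec_env v \<and> rec_env q \<and>
     (\<forall>e. q e > 0 \<and> g e = (real (u e) - real (v e)) / real (q e))"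

text \<open>A difference of naturals over a positive natural keeps sums and binary products free of
  case distinctions on signs.\<close>

definition rat_env :: "((nat \<Rightarrow> nat) \<Rightarrow> real) \<Rightarrow> bool" where
  "rat_env g \<longleftrightarrow> (\<exists>u v q. rat_repr u v q g)"

lemma rat_reprD:
  assumes "rat_repr u v q g"
  shows "rec_env u" "rec_env v" "rec_env q" "q e > 0"
    "g e = (real (u e) - real (v e)) / real (q e)"
  using assms by (auto simp: rat_repr_def)

lemma rat_envI:
  assumes "rec_env u" "rec_env v" "rec_env q" "\<And>e. q e > 0"
    "\<And>e. g e = (real (u e) - real (v e)) / real (q e)"
  shows "rat_env g"
  using assms unfolding rat_env_def rat_repr_def by blast

lemma rat_envE:
  assumes "rat_env g" obtains u v q where "rat_repr u v q g"
  using assms unfolding rat_env_def by blast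

lemma rat_env_of_nat: "rec_env f \<Longrightarrow> rat_env (\<lambda>e. real (f e))"
  by (rule rat_envI[of f "\<lambda>_. 0" "\<lambda>_. 1"]) (auto intro: rec_env_intros)

lemma rat_env_minus:
  assumes "rat_env f" shows "rat_env (\<lambda>e. - f e)"
proof -
  obtain u v q where "rat_repr u v q f" using rat_envE[OF assms] by blast
  note f = rat_reprD[OF this]
  show ?thesis
    by (rule rat_envI[of v u q]) (use f in \<open>auto simp: field_simps\<close>)
qed

lemma rat_env_add:
  assumes "rat_env f" "rat_env g" shows "rat_env (\<lambda>e. f e + g e)"
proof -
  obtain u v q where "rat_repr u v q f" using rat_envE[OF assms(1)] by blast
  note f = rat_reprD[OF this]
  obtain u' v' q' where "rat_repr u' v' q' g" using rat_envE[OF assms(2)] by blast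
  note g = rat_reprD[OF this]
  show ?thesis
  proof (rule rat_envI[of "\<lambda>e. u e * q' e + u' e * q e" "\<lambda>e. v e * q' e + v' e * q e"
        "\<lambda>e. q e * q' e"])
    fix e
    show "q e * q' e > 0" using f(4)[of e] g(4)[of e] by simp
    show "f e + g e = (real (u e * q' e + u' e * q e) - real (v e * q' e + v' e * q e)) /
      real (q e * q' e)"
      using f(4)[of e] g(4)[of e] unfolding f(5) g(5) by (simp add: field_simps)
  qed (intro rec_env_intros f g)+
qed

lemma rat_env_diff:
  assumes "rat_env f" "rat_env g" shows "rat_env (\<lambda>e. f e - g e)"
  using rat_env_add[OF assms(1) rat_env_minus[OF assms(2)]] by simp

lemma rat_env_mult:
  assumes "rat_env f" "rat_env g" shows "rat_env (\<lambda>e. f e * g e)"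
proof -
  obtain u v q where "rat_repr u v q f" using rat_envE[OF assms(1)] by blast
  note f = rat_reprD[OF this]
  obtain u' v' q' where "rat_repr u' v' q' g" using rat_envE[OF assms(2)] by blast
  note g = rat_reprD[OF this]
  show ?thesis
  proof (rule rat_envI[of "\<lambda>e. u e * u' e + v e * v' e" "\<lambda>e. u e * v' e + v e * u' e"
        "\<lambda>e. q e * q' e"])
    fix e
    show "q e * q' e > 0" using f(4)[of e] g(4)[of e] by simp
    show "f e * g e = (real (u e * u' e + v e * v' e) - real (u e * v' e + v e * u' e)) /
      real (q e * q' e)"
      using f(4)[of e] g(4)[of e] unfolding f(5) g(5) by (simp add: field_simps)
  qed (intro rec_env_intros f g)+
qed

lemma rat_env_inverse:
  assumes "rat_env f" shows "rat_env (\<lambda>e. inverse (f e))"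
proof -
  obtain u v q where "rat_repr u v q f" using rat_envE[OF assms(1)] by blast
  note f = rat_reprD[OF this]
  show ?thesis
  \<comment> \<open>The denominator is the distance of \<open>u e\<close> and \<open>v e\<close>,
    raised to 1 where they agree, so that inverse 0 = 0 is reproduced.\<close>
  proof (rule rat_envI[of "\<lambda>e. if u e \<le> v e then 0 else q e" "\<lambda>e. if v e \<le> u e then 0 else q e"
        "\<lambda>e. (u e - v e) + (v e - u e) + (if u e = v e then 1 else 0)"])
    fix e
    show "(u e - v e) + (v e - u e) + (if u e = v e then 1 else 0) > 0" by auto
    show "inverse (f e) = (real (if u e \<le> v e then 0 else q e) -
        real (if v e \<le> u e then 0 else q e)) /
      real ((u e - v e) + (v e - u e) + (if u e = v e then 1 else 0))"
      using f(4)[of e] unfolding f(5)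
      by (cases "u e" "v e" rule: linorder_cases) (auto simp: field_simps of_nat_diff)
  qed (intro rec_env_intros rec_env_if_eq f)+
qed

lemma rat_env_divide:
  assumes "rat_env f" "rat_env g" shows "rat_env (\<lambda>e. f e / g e)"
  unfolding divide_inverse by (intro rat_env_mult rat_env_inverse assms)

lemma rat_env_if_eq:
  assumes "rec_env a" "rec_env b" "rat_env f" "rat_env g"
  shows "rat_env (\<lambda>e. if a e = b e then f e else g e)"
proof -
  obtain u v q where "rat_repr u v q f" using rat_envE[OF assms(3)] by blast
  note f = rat_reprD[OF this]
  obtain u' v' q' where "rat_repr u' v' q' g" using rat_envE[OF assms(4)] by blast
  note g = rat_reprD[OF this]
  show ?thesis
    by (rule rat_envI[of "\<lambda>e. if a e = b e then u e else u' e" "\<lambda>e. if a e = b e then v e else v' e"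
        "\<lambda>e. if a e = b e then q e else q' e"]) (use f g in \<open>auto intro: rec_env_if_eq assms(1,2)\<close>)
qed

lemma rat_env_subst:
  assumes "rat_env f" "\<And>i. rec_env (a i)"
  shows "rat_env (\<lambda>e. f (\<lambda>i. a i e))"
proof -
  obtain u v q where "rat_repr u v q f" using rat_envE[OF assms(1)] by blast
  note f = rat_reprD[OF this]
  show ?thesis
    by (rule rat_envI[OF rec_env_subst[OF f(1) assms(2)] rec_env_subst[OF f(2) assms(2)]
          rec_env_subst[OF f(3) assms(2)]]) (use f in auto)
qed

lemma rat_env_shift:
  assumes "rat_env f" shows "rat_env (\<lambda>e. f (\<lambda>i. e (Suc i)))"
  by (intro rat_env_subst[OF assms] rec_env_var)

lemma rat_env_sum_prod:
  assumes "rec_env B" "rat_env (\<lambda>e. G (e 0) (\<lambda>i. e (Suc i)))"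
  shows rat_env_sum: "rat_env (\<lambda>e. \<Sum>c<B e. G c e)"
    and rat_env_prod: "rat_env (\<lambda>e. \<Prod>c<B e. G c e)"
proof -
  obtain u v q where "rat_repr u v q (\<lambda>e. G (e 0) (\<lambda>i. e (Suc i)))" using rat_envE[OF assms(2)] by blast
  note f = rat_reprD[OF this]
  \<comment> \<open>\<open>E c e\<close> pushes the bound index \<open>c\<close> in front of the
    environment, matching the shifted form of the assumption.\<close>
  define E :: "nat \<Rightarrow> (nat \<Rightarrow> nat) \<Rightarrow> nat \<Rightarrow> nat" where "E c e = case_nat c e" for c e
  have E: "E (e 0) (\<lambda>i. e (Suc i)) = e" for e by (auto simp: E_def split: nat.split)
  have G: "G c e = (real (u (E c e)) - real (v (E c e))) / real (q (E c e))" for c e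
    using f(5)[of "E c e"] by (simp add: E_def)
  note intros = rec_env_intros rec_env_div rec_env_mod rec_env_if_eq
  \<comment> \<open>The product of all denominators is the common denominator; each of them divides
    it, so the integer quotients below are exact.\<close>
  have q: "rec_env (\<lambda>e. \<Prod>c<B e. q (E c e))"
    by (intro rec_env_prod assms(1)) (simp add: E f)
  show "rat_env (\<lambda>e. \<Sum>c<B e. G c e)"
  proof (rule rat_envI[of "\<lambda>e. \<Sum>c<B e. u (E c e) * ((\<Prod>c<B e. q (E c e)) div q (E c e))"
        "\<lambda>e. \<Sum>c<B e. v (E c e) * ((\<Prod>c<B e. q (E c e)) div q (E c e))"
        "\<lambda>e. \<Prod>c<B e. q (E c e)"])
    have "rec_env (\<lambda>e. \<Sum>c<B e. w (E c e) * ((\<Prod>c<B e. q (E c e)) div q (E c e)))"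
      if "rec_env w" for w
      by (rule rec_env_sum[OF assms(1)])
         (unfold E, intro rec_env_mult rec_env_div that f rec_env_shift[OF q])
    thus "rec_env (\<lambda>e. \<Sum>c<B e. u (E c e) * ((\<Prod>c<B e. q (E c e)) div q (E c e)))"
      "rec_env (\<lambda>e. \<Sum>c<B e. v (E c e) * ((\<Prod>c<B e. q (E c e)) div q (E c e)))"
      using f by auto
    fix e
    define Q where "Q = (\<Prod>c<B e. q (E c e))"
    show Q: "Q > 0" unfolding Q_def using f(4) by (intro prod_pos) auto
    have "G c e = (real (u (E c e) * (Q div q (E c e))) - real (v (E c e) * (Q div q (E c e)))) / real Q"
      if "c < B e" for c
    proof -
      have "q (E c e) dvd Q" unfolding Q_def using that by (intro dvd_prodI) auto
      then obtain k where k: "Q = q (E c e) * k" by blast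
      hence "k > 0" using Q by simp
      have "Q div q (E c e) = k" using k f(4) by simp
      thus ?thesis unfolding G using f(4)[of "E c e"] \<open>k > 0\<close> k by (simp add: field_simps)
    qed
    thus "(\<Sum>c<B e. G c e) = (real (\<Sum>c<B e. u (E c e) * (Q div q (E c e))) -
        real (\<Sum>c<B e. v (E c e) * (Q div q (E c e)))) / real Q"
      by (simp add: sum_subtractf[symmetric] sum_divide_distrib)
  qed (rule q)
  \<comment> \<open>Multiplying out differences would give exponentially many terms; products use
    absolute value and sign, and the parity of the number of negative factors decides the
    sign.\<close>
  define a where "a e = (u e - v e) + (v e - u e)" for e
  define s where "s e = (if v e \<le> u e then 0 else 1 :: nat)" for e
  have as: "rec_env a" "rec_env s" unfolding a_def s_def by (intro rec_env_intros f)+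
  have a: "rec_env (\<lambda>e. \<Prod>c<B e. a (E c e))"
    by (intro rec_env_prod assms(1)) (simp add: E as)
  have s: "rec_env (\<lambda>e. \<Sum>c<B e. s (E c e))"
    by (intro rec_env_sum assms(1)) (simp add: E as)
  have eq: "real (u e) - real (v e) = (-1) ^ s e * real (a e)" for e
    by (auto simp: s_def a_def)
  show "rat_env (\<lambda>e. \<Prod>c<B e. G c e)"
  proof (rule rat_envI[of "\<lambda>e. if (\<Sum>c<B e. s (E c e)) mod 2 = 0 then \<Prod>c<B e. a (E c e) else 0"
        "\<lambda>e. if (\<Sum>c<B e. s (E c e)) mod 2 = 0 then 0 else \<Prod>c<B e. a (E c e)"
        "\<lambda>e. \<Prod>c<B e. q (E c e)"])
    fix e
    show "(\<Prod>c<B e. q (E c e)) > 0" using f(4) by (intro prod_pos) auto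
    define S where "S = (\<Sum>c<B e. s (E c e))"
    define A where "A = (\<Prod>c<B e. a (E c e))"
    have "(\<Prod>c<B e. G c e) = (-1) ^ S * real A / real (\<Prod>c<B e. q (E c e))"
      unfolding G eq by (simp add: S_def A_def prod_dividef prod.distrib power_sum)
    also have "(-1) ^ S * real A = real (if S mod 2 = 0 then A else 0) - real (if S mod 2 = 0 then 0 else A)"
      by (cases "even S") (auto simp: even_iff_mod_2_eq_zero)
    finally show "(\<Prod>c<B e. G c e) = (real (if S mod 2 = 0 then A else 0) -
        real (if S mod 2 = 0 then 0 else A)) / real (\<Prod>c<B e. q (E c e))" .
  qed (intro intros a s q)+
qed

lemma rat_env_nat: "rat_env (\<lambda>e. real k)"
  by (intro rat_env_of_nat rec_env_const)

lemma rat_env_0: "rat_env (\<lambda>e. 0)" and rat_env_1: "rat_env (\<lambda>e. 1)"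
  and rat_env_numeral: "rat_env (\<lambda>e. numeral w)"
  using rat_env_nat[of 0] rat_env_nat[of 1] rat_env_nat[of "numeral w"] by simp_all

lemma rat_env_power:
  assumes "rat_env f" "rec_env g" shows "rat_env (\<lambda>e. f e ^ g e)"
proof -
  have "rat_env (\<lambda>e. \<Prod>c<g e. f e)"
    by (intro rat_env_prod rat_env_shift[OF assms(1)] assms)
  thus ?thesis by simp
qed

lemma rat_env_fact:
  assumes "rec_env f" shows "rat_env (\<lambda>e. fact (f e))"
proof -
  have "rat_env (\<lambda>e. \<Prod>c<f e. real (Suc c))"
    by (intro rat_env_prod rat_env_of_nat rec_env_intros assms)
  moreover have "fact n = (\<Prod>c<n. real (Suc c))" for n
    by (simp add: fact_prod_Suc lessThan_atLeast0)
  ultimately show ?thesis by simp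
qed

lemmas rat_env_intros = rat_env_0 rat_env_1 rat_env_numeral rat_env_minus rat_env_add rat_env_diff
  rat_env_mult rat_env_inverse rat_env_divide rat_env_power rat_env_fact rat_env_if_eq rat_env_sum
  rat_env_prod rat_env_of_nat rec_env_intros

lemma rat_env_gbinomial:
  assumes "rat_env f" "rec_env g" shows "rat_env (\<lambda>e. f e gchoose g e)"
proof -
  have "rat_env (\<lambda>e. (\<Prod>i<g e. f e - real i) / fact (g e))"
    by (intro rat_env_intros rat_env_shift[OF assms(1)] assms)
  thus ?thesis by (simp add: gbinomial_prod_rev lessThan_atLeast0)
qed

lemma rat_env_app:
  assumes "rat_env (\<lambda>e. f (e 0))" "rec_env a" shows "rat_env (\<lambda>e. f (a e))"
  using rat_env_subst[OF assms(1), of "\<lambda>_. a"] assms(2) by simp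

lemma rat_env_app2:
  assumes "rat_env (\<lambda>e. f (e 0) (e (Suc 0)))" "rec_env a" "rec_env b"
  shows "rat_env (\<lambda>e. f (a e) (b e))"
  using rat_env_subst[OF assms(1), of "\<lambda>i. if i = 0 then a else b"] assms(2,3) by simp

text \<open>The base-\<open>b\<close> digits of \<open>c\<close> run through all exponent vectors, so that a coefficient of a product
  with a variable number of factors becomes a single bounded sum of bounded products.\<close>
lemma fps_prod_nth_digits:
  fixes F :: "nat \<Rightarrow> 'a::comm_ring_1 fps"
  assumes "n < b"
  shows "(\<Prod>l<k. F l) $ n = (\<Sum>c<b ^ k. if (\<Sum>l<k. c div b ^ l mod b) = n
           then \<Prod>l<k. F l $ (c div b ^ l mod b) else 0)"
  using assms
proof (induction k arbitrary: n)
  case 0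
  thus ?case by auto
next
  case (Suc k)
  have b: "b > 0" using Suc.prems by simp
  define dg where "dg c l = c div b ^ l mod b" for c l
  have dg: "dg (a * b ^ k + c) l = (if l < k then dg c l else a)"
    if "l < Suc k" "a < b" "c < b ^ k" for a c l
  proof (cases "l < k")
    case True
    then obtain r where r: "k = Suc (l + r)" using less_imp_Suc_add by blast
    have "(a * b ^ k + c) div b ^ l = c div b ^ l + a * b ^ r * b"
    proof -
      have "a * b ^ k + c = c + (a * b ^ r * b) * b ^ l"
        by (simp add: r power_add algebra_simps)
      thus ?thesis using b by (simp only: div_mult_self1) simp
    qed
    thus ?thesis using True by (simp add: dg_def)
  next
    case False
    hence "l = k" using that by simp
    thus ?thesis using that b by (simp add: dg_def)
  qed
  define T where "T k n c = (if (\<Sum>l<k. dg c l) = n then \<Prod>l<k. F l $ (dg c l) else 0)" for k n c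
  \<comment> \<open>Grouping by the leading digit \<open>a\<close> fixes the exponent taken from the
    last factor \<open>F k\<close>.\<close>
  have "(\<Sum>c<b ^ Suc k. T (Suc k) n c) = (\<Sum>a<b. sum (T (Suc k) n) {a * b ^ k..<a * b ^ k + b ^ k})"
    by (simp add: sum.nat_group mult.commute)
  also have "\<dots> = (\<Sum>a<b. \<Sum>c<b ^ k. T (Suc k) n (a * b ^ k + c))"
    by (subst sum.atLeastLessThan_shift_0) (simp add: lessThan_atLeast0 comp_def)
  also have "\<dots> = (\<Sum>a<b. if a \<le> n then F k $ a * (\<Prod>l<k. F l) $ (n - a) else 0)"
  proof (intro sum.cong refl)
    fix a assume a: "a \<in> {..<b}"
    have T: "T (Suc k) n (a * b ^ k + c) = (if a \<le> n then F k $ a * T k (n - a) c else 0)"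
      if "c < b ^ k" for c
    proof -
      have "dg (a * b ^ k + c) l = dg c l" if "l < k" for l
        using dg[of l a c] a that \<open>c < b ^ k\<close> by auto
      moreover have "dg (a * b ^ k + c) k = a"
        using dg[of k a c] a \<open>c < b ^ k\<close> by auto
      ultimately show ?thesis unfolding T_def by (auto simp: mult.commute)
    qed
    show "(\<Sum>c<b ^ k. T (Suc k) n (a * b ^ k + c)) =
        (if a \<le> n then F k $ a * (\<Prod>l<k. F l) $ (n - a) else 0)"
    proof (cases "a \<le> n")
      case True
      have "(\<Prod>l<k. F l) $ (n - a) = (\<Sum>c<b ^ k. T k (n - a) c)"
        using Suc.IH[of "n - a"] Suc.prems unfolding T_def dg_def by simp
      thus ?thesis using True by (simp add: T sum_distrib_left)
    qed (simp add: T)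
  qed
  also have "\<dots> = (\<Sum>a\<le>n. F k $ a * (\<Prod>l<k. F l) $ (n - a))"
    by (rule sum.mono_neutral_cong_right) (use Suc.prems in auto)
  also have "\<dots> = (F k * (\<Prod>l<k. F l)) $ n"
    by (simp add: fps_mult_nth atMost_atLeast0)
  finally show ?case unfolding T_def dg_def by (simp add: mult.commute)
qed

lemma rat_env_fps_prod:
  fixes F :: "nat \<Rightarrow> real fps"
  assumes "rat_env (\<lambda>e. F (e 0) $ e (Suc 0))" "rec_env k" "rec_env n"
  shows "rat_env (\<lambda>e. (\<Prod>l<k e. F l) $ n e)"
proof -
  define S where "S k n = (\<Sum>c<Suc n ^ k. if (\<Sum>l<k. c div Suc n ^ l mod Suc n) = n
    then \<Prod>l<k. F l $ (c div Suc n ^ l mod Suc n) else 0)" for k n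
  have "rat_env (\<lambda>e. S (e 0) (e (Suc 0)))"
    unfolding S_def
    by (intro rat_env_sum rat_env_if_eq rat_env_prod rat_env_0 rec_env_intros rec_env_mod
        rec_env_div rec_env_power rat_env_app2[where f = "\<lambda>i n. F i $ n", OF assms(1)])
  moreover have "S k n = (\<Prod>l<k. F l) $ n" for k n
    unfolding S_def by (rule fps_prod_nth_digits[symmetric]) simp
  ultimately have "rat_env (\<lambda>e. (\<Prod>l<e 0. F l) $ e (Suc 0))" by (simp only:)
  from rat_env_app2[where f = "\<lambda>k n. (\<Prod>l<k. F l) $ n", OF this assms(2,3)] show ?thesis .
qed

lemma rat_env_fps_power:
  assumes "rat_env (\<lambda>e. A $ e 0)" "rec_env k" "rec_env n"
  shows "rat_env (\<lambda>e. (A ^ k e) $ n e)"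
proof -
  have "rat_env (\<lambda>e. (\<Prod>l<k e. A) $ n e)"
    by (intro rat_env_fps_prod rat_env_app[where f = "\<lambda>n. A $ n", OF assms(1)] assms rec_env_var)
  thus ?thesis by simp
qed

lemma rat_env_fps_mult:
  assumes "rat_env (\<lambda>e. A $ e 0)" "rat_env (\<lambda>e. B $ e 0)" "rec_env n"
  shows "rat_env (\<lambda>e. (A * B) $ n e)"
proof -
  have "rat_env (\<lambda>e. \<Sum>i<Suc (n e). A $ i * B $ (n e - i))"
    by (intro rat_env_intros rat_env_app[where f = "\<lambda>n. A $ n", OF assms(1)] rat_env_app[where f = "\<lambda>n. B $ n", OF assms(2)] rec_env_shift[OF assms(3)] assms(3))
  thus ?thesis by (simp only: fps_mult_nth atLeast0AtMost lessThan_Suc_atMost)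
qed

lemma rat_env_fps_compose:
  assumes "rat_env (\<lambda>e. A $ e 0)" "rat_env (\<lambda>e. B $ e 0)" "rec_env n"
  shows "rat_env (\<lambda>e. (A oo B) $ n e)"
proof -
  have "rat_env (\<lambda>e. \<Sum>i<Suc (n e). A $ i * (B ^ i) $ n e)"
    by (intro rat_env_intros rat_env_app[where f = "\<lambda>n. A $ n", OF assms(1)] rat_env_fps_power[OF assms(2)] rec_env_shift[OF assms(3)] assms(3))
  thus ?thesis by (simp only: fps_compose_nth atLeast0AtMost lessThan_Suc_atMost)
qed

lemma computable_real_seqI:
  assumes "rat_env (\<lambda>e. A (e 0) (e (Suc 0)))" "\<And>i k. \<bar>A i k - D i\<bar> \<le> 1 / 2 ^ k"
  shows "computable_real_seq D"
proof -
  obtain u v q where "rat_repr u v q (\<lambda>e. A (e 0) (e (Suc 0)))" using rat_envE[OF assms(1)] by blast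
  note f = rat_reprD[OF this]
  define E where "E i k j = (if j = 0 then i else if j = Suc 0 then k else 0)" for i k j :: nat
  have comp: "computable2 (\<lambda>i k. w (E i k))" if "rec_env w" for w
  proof (rule computable2_if_rec_env)
    have "rec_env (\<lambda>e. w (\<lambda>j. if j = 0 then e 0 else if j = Suc 0 then e (Suc 0) else 0))"
    proof (rule rec_env_subst[OF that])
      fix j show "rec_env (\<lambda>e. if j = 0 then e 0 else if j = Suc 0 then e (Suc 0) else 0)"
        by (cases "j = 0"; cases "j = Suc 0") (simp_all add: rec_env_var rec_env_const)
    qed
    thus "rec_env (\<lambda>e. w (E (e 0) (e (Suc 0))))" by (simp add: E_def[abs_def])
  qed
  define s where "s e = (if v e \<le> u e then 0 else 1 :: nat)" for e
  define p where "p e = (u e - v e) + (v e - u e)" for e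
  have "rec_env s" "rec_env p" unfolding s_def p_def by (intro rec_env_intros f)+
  hence "computable2 (\<lambda>i k. s (E i k))" "computable2 (\<lambda>i k. p (E i k))" "computable2 (\<lambda>i k. q (E i k))"
    using f(3) by (auto intro: comp)
  moreover have "(-1) ^ s (E i k) * real (p (E i k)) / real (q (E i k)) = A i k" for i k
  proof -
    have "A i k = (real (u (E i k)) - real (v (E i k))) / real (q (E i k))"
      using f(5)[of "E i k"] by (simp add: E_def)
    also have "real (u (E i k)) - real (v (E i k)) = (-1) ^ s (E i k) * real (p (E i k))"
      by (auto simp: s_def p_def)
    finally show ?thesis ..
  qed
  ultimately show ?thesis
    unfolding computable_real_seq_def using f(4) assms(2)
    by (intro exI[of _ "\<lambda>i k. s (E i k)"] exI[of _ "\<lambda>i k. p (E i k)"] exI[of _ "\<lambda>i k. q (E i k)"])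
       (auto simp: less_imp_neq[symmetric])
qed

text \<open>Provides a computable integer above a rational error constant, from which the required
  number of approximation steps is computed.\<close>

lemma rat_env_le_rec_env:
  assumes "rat_env f" shows "\<exists>b. rec_env b \<and> (\<forall>e. f e \<le> real (b e))"
proof -
  obtain u v q where "rat_repr u v q f" using rat_envE[OF assms] by blast
  note f = rat_reprD[OF this]
  have "f e \<le> real (u e)" for e
  proof -
    have "real (q e) \<ge> 1" using f(4)[of e] by simp
    hence "real (u e) * 1 \<le> real (u e) * real (q e)" by (intro mult_left_mono) auto
    thus ?thesis using f(4)[of e] unfolding f(5) by (simp add: divide_le_eq)
  qed
  thus ?thesis using f(1) by blast
qed

lemma rat_env_if_le:
  assumes "rat_env a" "rat_env b" "rat_env f" "rat_env g"
  shows "rat_env (\<lambda>e. if a e \<le> b e then f e else g e)"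
proof -
  obtain u v q where "rat_repr u v q a" using rat_envE[OF assms(1)] by blast
  note a = rat_reprD[OF this]
  obtain u' v' q' where "rat_repr u' v' q' b" using rat_envE[OF assms(2)] by blast
  note b = rat_reprD[OF this]
  have "a e \<le> b e \<longleftrightarrow> (u e * q' e + v' e * q e) - (u' e * q e + v e * q' e) = 0" for e
  proof -
    have "a e \<le> b e \<longleftrightarrow> (real (u e) - real (v e)) * real (q' e) \<le> (real (u' e) - real (v' e)) * real (q e)"
      using a(4)[of e] b(4)[of e] unfolding a(5) b(5) by (simp add: field_simps)
    also have "\<dots> \<longleftrightarrow> real (u e * q' e + v' e * q e) \<le> real (u' e * q e + v e * q' e)"
      by (simp add: algebra_simps)
    finally show ?thesis by (simp only: of_nat_le_iff diff_is_0_eq)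
  qed
  moreover have "rat_env (\<lambda>e. if (u e * q' e + v' e * q e) - (u' e * q e + v e * q' e) = 0 then f e else g e)"
    by (intro rat_env_if_eq rec_env_intros assms a b)
  ultimately show ?thesis by simp
qed

section \<open>Rationality of the power series coefficients\<close>

lemma rat_env_ln_quot: "rec_env f \<Longrightarrow> rat_env (\<lambda>e. ln_quot $ f e)"
  unfolding ln_quot_def fps_nth_Abs_fps by (intro rat_env_intros)

lemma rat_env_quot_ln: "rec_env f \<Longrightarrow> rat_env (\<lambda>e. quot_ln $ f e)"
  unfolding quot_ln_def
proof (rule rat_env_fps_compose)
  show "rat_env (\<lambda>e. inverse (1 + fps_X) $ e 0)"
    unfolding fps_inverse_fps_X_plus1 fps_nth_Abs_fps by (intro rat_env_intros)
  show "rat_env (\<lambda>e. (ln_quot - 1) $ e 0)"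
    unfolding fps_sub_nth fps_one_nth by (intro rat_env_intros rat_env_ln_quot)
qed

lemma rat_env_kappa: "rec_env f \<Longrightarrow> rat_env (\<lambda>e. kappa $ f e)"
  unfolding kappa_def fps_shift_nth by (intro rat_env_quot_ln rec_env_intros)

lemma rat_env_kappa1: "rec_env f \<Longrightarrow> rat_env (\<lambda>e. kappa1 $ f e)"
  unfolding kappa1_def fps_sub_nth fps_nth_fps_const by (intro rat_env_intros rat_env_kappa)

lemma rat_env_fps_binomial: "rat_env (\<lambda>e. a) \<Longrightarrow> rec_env f \<Longrightarrow> rat_env (\<lambda>e. fps_binomial a $ f e)"
  unfolding fps_binomial_nth by (rule rat_env_gbinomial)

lemma rat_env_weight_fps: "rec_env f \<Longrightarrow> rat_env (\<lambda>e. weight_fps $ f e)"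
  unfolding weight_fps_def
proof (rule rat_env_fps_mult)
  show "rat_env (\<lambda>e. fps_binomial (1 / 24) $ e 0)"
    by (intro rat_env_fps_binomial rat_env_intros)
  show "rat_env (\<lambda>e. (fps_binomial (3 / 2) oo fps_X * kappa) $ e 0)"
  proof (rule rat_env_fps_compose)
    show "rat_env (\<lambda>e. (fps_X * kappa) $ e 0)"
      unfolding fps_X_mult_nth by (intro rat_env_intros rat_env_kappa)
  qed (intro rat_env_fps_binomial rat_env_intros)+
qed

lemma rat_env_weight_kappa1:
  assumes "rec_env k" "rec_env p" shows "rat_env (\<lambda>e. (weight_fps * kappa1 ^ k e) $ p e)"
proof -
  have "rat_env (\<lambda>e. \<Sum>i<Suc (p e). weight_fps $ i * (kappa1 ^ k e) $ (p e - i))"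
    by (intro rat_env_intros rat_env_weight_fps rat_env_fps_power[OF rat_env_kappa1[OF rec_env_var]]
        rec_env_shift[OF assms(1)] rec_env_shift[OF assms(2)] assms)
  thus ?thesis by (simp only: fps_mult_nth atLeast0AtMost lessThan_Suc_atMost)
qed

lemma rat_env_watson_fps: "rec_env f \<Longrightarrow> rat_env (\<lambda>e. watson_fps $ f e)"
  unfolding watson_fps_def
proof (rule rat_env_fps_compose)
  show "rat_env (\<lambda>e. expm1_fps $ e 0)"
    unfolding expm1_fps_def fps_nth_Abs_fps by (intro rat_env_intros)
qed (intro rat_env_fps_binomial rat_env_intros)+

lemma rat_env_Gamma_ratio_fps:
  assumes "rec_env p" "rec_env i" shows "rat_env (\<lambda>e. Gamma_ratio_fps (p e) $ i e)"
proof -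
  define U where "U = (1 + fps_const (1 / 2) * fps_X) * Gamma_half_fps"
  have U: "rat_env (\<lambda>e. U $ f e)" if "rec_env f" for f
    unfolding U_def
  proof (rule rat_env_fps_mult[OF _ _ that])
    show "rat_env (\<lambda>e. (1 + fps_const (1 / 2) * fps_X) $ e 0)"
      unfolding fps_add_nth fps_one_nth fps_mult_left_const_nth fps_X_nth by (intro rat_env_intros)
    have "rat_env (\<lambda>e. (\<Prod>i<e 0. 1 / 2 + real i) * watson_fps $ e 0)"
      by (intro rat_env_intros rat_env_watson_fps)
    thus "rat_env (\<lambda>e. Gamma_half_fps $ e 0)"
      by (simp add: Gamma_half_fps_def pochhammer_prod lessThan_atLeast0)
  qed
  define F where "F l = fps_X * Abs_fps (\<lambda>k. (real l - 1 / 2) ^ k)" for l :: nat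
  have F: "rat_env (\<lambda>e. F (e 0) $ e (Suc 0))"
    unfolding F_def fps_X_mult_nth fps_nth_Abs_fps by (intro rat_env_intros)
  have "rat_env (\<lambda>e. \<Sum>j<Suc (i e). U $ j * (\<Prod>l<p e. F l) $ (i e - j))"
    by (intro rat_env_intros U rat_env_fps_prod[OF F] rec_env_shift[OF assms(1)] rec_env_shift[OF assms(2)] assms)
  moreover have "Gamma_ratio_fps k = U * (\<Prod>l<k. F l)" for k
    by (simp add: Gamma_ratio_fps_def U_def F_def)
  ultimately show ?thesis by (simp only: fps_mult_nth atLeast0AtMost lessThan_Suc_atMost)
qed

section \<open>Rational approximation of the transcendental constants\<close>

definition rat_limit :: "real \<Rightarrow> (nat \<Rightarrow> real) \<Rightarrow> bool" where
  "rat_limit L x \<longleftrightarrow> rat_env (\<lambda>e. x (e 0)) \<and> (\<exists>M. \<forall>n. \<bar>x n - L\<bar> \<le> M / real (Suc n))"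

lemma rat_limitE:
  assumes "rat_limit L x"
  obtains M where "rat_env (\<lambda>e. x (e 0))" "M \<ge> 0" "\<And>n. \<bar>x n - L\<bar> \<le> M / real (Suc n)"
proof -
  obtain M where M: "rat_env (\<lambda>e. x (e 0))" "\<And>n. \<bar>x n - L\<bar> \<le> M / real (Suc n)"
    using assms unfolding rat_limit_def by blast
  moreover have "M \<ge> 0" using M(2)[of 0] by (simp add: order_trans[OF abs_ge_zero])
  ultimately show ?thesis using that by blast
qed

lemma rat_limit_mult:
  assumes "rat_limit K x" "rat_limit L y" shows "rat_limit (K * L) (\<lambda>n. x n * y n)"
proof -
  obtain M where M: "rat_env (\<lambda>e. x (e 0))" "M \<ge> 0" "\<And>n. \<bar>x n - K\<bar> \<le> M / real (Suc n)"
    using rat_limitE[OF assms(1)] by blast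
  obtain N where N: "rat_env (\<lambda>e. y (e 0))" "N \<ge> 0" "\<And>n. \<bar>y n - L\<bar> \<le> N / real (Suc n)"
    using rat_limitE[OF assms(2)] by blast
  have "\<bar>x n * y n - K * L\<bar> \<le> ((\<bar>K\<bar> + M) * N + M * \<bar>L\<bar>) / real (Suc n)" for n
  proof -
    have "M / real (Suc n) \<le> M / 1" using M(2) by (intro divide_left_mono) auto
    hence "\<bar>x n\<bar> \<le> \<bar>K\<bar> + M" using M(3)[of n] by linarith
    hence "\<bar>x n\<bar> * \<bar>y n - L\<bar> \<le> (\<bar>K\<bar> + M) * (N / real (Suc n))"
      using M(2) N by (intro mult_mono) auto
    moreover have "\<bar>x n - K\<bar> * \<bar>L\<bar> \<le> M / real (Suc n) * \<bar>L\<bar>" using M(3) by (intro mult_right_mono) auto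
    moreover have "\<bar>x n * y n - K * L\<bar> \<le> \<bar>x n\<bar> * \<bar>y n - L\<bar> + \<bar>x n - K\<bar> * \<bar>L\<bar>"
    proof -
      have "x n * y n - K * L = x n * (y n - L) + (x n - K) * L" by (simp add: algebra_simps)
      thus ?thesis using abs_triangle_ineq[of "x n * (y n - L)" "(x n - K) * L"] by (simp add: abs_mult)
    qed
    ultimately show ?thesis by (simp add: add_divide_distrib)
  qed
  thus ?thesis unfolding rat_limit_def using rat_env_mult[OF M(1) N(1)] by blast
qed

lemma rat_limit_const: "rat_env (\<lambda>e. c) \<Longrightarrow> rat_limit c (\<lambda>n. c)"
  unfolding rat_limit_def by (auto intro!: exI[of _ 0])

lemma rat_limit_power: "rat_limit L x \<Longrightarrow> rat_limit (L ^ k) (\<lambda>n. x n ^ k)"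
  by (induction k) (auto intro: rat_limit_mult rat_limit_const rat_env_1)

lemma rat_limit_inverse:
  assumes "rat_limit L x" "\<And>n. x n \<ge> 1" "L \<ge> 1"
  shows "rat_limit (1 / L) (\<lambda>n. 1 / x n)"
proof -
  obtain M where M: "rat_env (\<lambda>e. x (e 0))" "M \<ge> 0" "\<And>n. \<bar>x n - L\<bar> \<le> M / real (Suc n)"
    using rat_limitE[OF assms(1)] by blast
  have "\<bar>1 / x n - 1 / L\<bar> \<le> M / real (Suc n)" for n
  proof -
    have pos: "x n * L \<ge> 1" using mult_mono[of 1 "x n" 1 L] assms(2)[of n] assms(3) by simp
    have "1 / x n - 1 / L = (L - x n) / (x n * L)"
      using assms(2)[of n] assms(3) by (simp add: field_simps)
    hence "\<bar>1 / x n - 1 / L\<bar> = \<bar>x n - L\<bar> / (x n * L)" using pos by (simp add: abs_minus_commute)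
    also have "\<dots> \<le> \<bar>x n - L\<bar> / 1" using pos by (intro divide_left_mono) auto
    also have "\<dots> \<le> M / real (Suc n)" using M(3) by simp
    finally show ?thesis .
  qed
  moreover have "rat_env (\<lambda>e. 1 / x (e 0))" by (intro rat_env_divide rat_env_1 M(1))
  ultimately show ?thesis unfolding rat_limit_def by blast
qed

definition zeta2_sum :: "nat \<Rightarrow> real" where
  "zeta2_sum n = (\<Sum>k<Suc n. 1 / real (Suc k) ^ 2)"

lemma zeta2_sum_ge_1: "zeta2_sum n \<ge> 1"
proof -
  have "(\<Sum>k\<in>{0}. 1 / real (Suc k) ^ 2) \<le> zeta2_sum n"
    unfolding zeta2_sum_def by (rule sum_mono2) auto
  thus ?thesis by simp
qed

lemma zeta2_sum_bounds:
  "zeta2_sum n \<le> pi\<^sup>2 / 6" "pi\<^sup>2 / 6 \<le> zeta2_sum n + 1 / real (Suc n)"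
proof -
  have sums: "(\<lambda>k. 1 / real (Suc k) ^ 2) sums (pi\<^sup>2 / 6)"
    using inverse_squares_sums by (simp add: add.commute)
  show "zeta2_sum n \<le> pi\<^sup>2 / 6"
    unfolding zeta2_sum_def sums_unique[OF sums] by (rule sum_le_suminf) (use sums in \<open>auto simp: sums_iff\<close>)
  \<comment> \<open>This upper sequence decreases to the same limit, since 1/(n+2)^2 is at most
    1/(n+1) - 1/(n+2).\<close>
  define u where "u n = zeta2_sum n + 1 / real (Suc n)" for n
  have "(\<lambda>n. \<Sum>k<Suc n. 1 / real (Suc k) ^ 2) \<longlonglongrightarrow> pi\<^sup>2 / 6"
    using sums unfolding sums_def by (rule LIMSEQ_Suc)
  hence "u \<longlonglongrightarrow> pi\<^sup>2 / 6 + 0"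
    unfolding u_def[abs_def] zeta2_sum_def by (intro tendsto_add) (use LIMSEQ_inverse_real_of_nat in \<open>auto simp: inverse_eq_divide\<close>)
  moreover have "decseq u"
  proof (rule decseq_SucI)
    fix n
    have "1 / (real n + 2)\<^sup>2 \<le> 1 / ((real n + 1) * (real n + 2))"
      by (rule divide_left_mono) (auto simp: power2_eq_square)
    also have "\<dots> = 1 / (real n + 1) - 1 / (real n + 2)" by (simp add: field_simps)
    finally show "u (Suc n) \<le> u n" by (simp add: u_def zeta2_sum_def add.commute)
  qed
  ultimately have "pi\<^sup>2 / 6 \<le> u n" using decseq_ge by fastforce
  thus "pi\<^sup>2 / 6 \<le> zeta2_sum n + 1 / real (Suc n)" by (simp add: u_def)
qed

lemma zeta2_le_2: "pi\<^sup>2 / 6 \<le> 2"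
  using zeta2_sum_bounds(2)[of 0] by (simp add: zeta2_sum_def)

lemma zeta2_ge_1: "pi\<^sup>2 / 6 \<ge> 1"
  using zeta2_sum_bounds(1)[of 0] by (simp add: zeta2_sum_def)

lemma rat_limit_zeta2: "rat_limit (pi\<^sup>2 / 6) zeta2_sum"
  unfolding rat_limit_def
proof (intro conjI exI[of _ 1] allI)
  show "rat_env (\<lambda>e. zeta2_sum (e 0))" unfolding zeta2_sum_def by (intro rat_env_intros)
  show "\<bar>zeta2_sum n - pi\<^sup>2 / 6\<bar> \<le> 1 / real (Suc n)" for n using zeta2_sum_bounds[of n] by linarith
qed

lemma rat_limit_exp_zeta2: "\<exists>x. rat_limit (exp (- 2 * (pi\<^sup>2 / 6))) x"
proof -
  define \<tau> where "\<tau> = pi\<^sup>2 / 6"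
  define x where "x n = (\<Sum>k<Suc n. (- 2 * zeta2_sum n) ^ k / fact k)" for n
  have "rat_env (\<lambda>e. x (e 0))"
    unfolding x_def zeta2_sum_def by (intro rat_env_intros)
  moreover have "\<bar>x n - exp (- 2 * \<tau>)\<bar> \<le> (2 + 4 * exp 8) / real (Suc n)" for n
  proof -
    define t where "t = zeta2_sum n"
    have t: "1 \<le> t" "t \<le> \<tau>" "\<tau> \<le> t + 1 / real (Suc n)" "\<tau> \<le> 2"
      using zeta2_sum_ge_1[of n] zeta2_sum_bounds[of n] zeta2_le_2 by (simp_all add: t_def \<tau>_def)
    obtain s where s: "\<bar>s\<bar> \<le> \<bar>- 2 * t\<bar>"
      "exp (- 2 * t) = (\<Sum>k<Suc n. (- 2 * t) ^ k / fact k) + exp s / fact (Suc n) * (- 2 * t) ^ Suc n"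
      using Maclaurin_exp_le[of "- 2 * t" "Suc n"] by blast
    \<comment> \<open>First of two errors, the Taylor truncation: 4^n / n! is at most exp 4, so one
      factor 4/(n+1) of the remainder term gives the rate. The second is the change of argument from
      \<open>t\<close> to \<open>\<tau>\<close>.\<close>
    have "\<bar>exp (- 2 * t) - x n\<bar> = exp s * (\<bar>- 2 * t\<bar> ^ Suc n / fact (Suc n))"
      using s(2) by (simp add: x_def t_def[symmetric] abs_mult power_abs)
    also have "\<dots> \<le> exp 4 * (4 ^ Suc n / fact (Suc n))"
      using s(1) t by (intro mult_mono divide_right_mono power_mono) auto
    also have "4 ^ Suc n / fact (Suc n) = 4 / real (Suc n) * (4 ^ n / fact n)" by simp
    also have "exp 4 * (4 / real (Suc n) * (4 ^ n / fact n)) \<le> exp 4 * (4 / real (Suc n) * exp 4)"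
      using exp_partial_sum_le[of 4 "{n}"] by (intro mult_left_mono) auto
    also have "\<dots> = 4 * exp 8 / real (Suc n)" by (simp add: exp_add[symmetric] mult_ac)
    finally have 1: "\<bar>exp (- 2 * t) - x n\<bar> \<le> 4 * exp 8 / real (Suc n)" .
    have "exp (- 2 * \<tau>) = exp (- 2 * t) * exp (- 2 * (\<tau> - t))" by (simp add: exp_add[symmetric] algebra_simps)
    hence "exp (- 2 * t) - exp (- 2 * \<tau>) = exp (- 2 * t) * (1 - exp (- 2 * (\<tau> - t)))" by (simp add: algebra_simps)
    also have "\<dots> \<le> 1 * (2 * (\<tau> - t))"
    proof (rule mult_mono)
      show "1 - exp (- 2 * (\<tau> - t)) \<le> 2 * (\<tau> - t)"
        using exp_ge_add_one_self[of "- 2 * (\<tau> - t)"] by linarith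
    qed (use t in auto)
    also have "\<dots> \<le> 2 / real (Suc n)" using t(3) by simp
    finally have "exp (- 2 * t) - exp (- 2 * \<tau>) \<le> 2 / real (Suc n)" .
    moreover have "exp (- 2 * \<tau>) \<le> exp (- 2 * t)" using t by simp
    ultimately have "\<bar>x n - exp (- 2 * \<tau>)\<bar> \<le> 2 / real (Suc n) + 4 * exp 8 / real (Suc n)"
      using 1 by linarith
    thus ?thesis by (simp only: add_divide_distrib)
  qed
  ultimately show ?thesis unfolding rat_limit_def \<tau>_def by blast
qed


text \<open>Approximates \<open>C\<close> by the largest multiple of \<open>1 / (n + 1)\<close> whose fourth power is at most \<open>x n\<close>.\<close>
lemma rat_limit_root4:
  assumes "C > 0" "rat_limit (C ^ 4) x" shows "\<exists>y. rat_limit C y"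
proof -
  obtain M where M: "rat_env (\<lambda>e. x (e 0))" "M \<ge> 0" "\<And>n. \<bar>x n - C ^ 4\<bar> \<le> M / real (Suc n)"
    using rat_limitE[OF assms(2)] by blast
  obtain B :: nat where B: "C \<le> real B" using real_arch_simple by blast
  define P where "P n j \<longleftrightarrow> real (Suc j) ^ 4 \<le> real (Suc n) ^ 4 * x n" for n j
  define y where "y n = (\<Sum>j<B * Suc n. if P n j then 1 else 0) / real (Suc n)" for n
  have "rat_env (\<lambda>e. y (e 0))"
    unfolding y_def P_def
    by (intro rat_env_divide rat_env_sum rat_env_if_le rat_env_mult rat_env_power rat_env_of_nat
        rat_env_0 rat_env_1 rec_env_intros rat_env_app[where f = x, OF M(1)])
  moreover have "\<bar>y n - C\<bar> \<le> (1 + M / C ^ 3) / real (Suc n)" for n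
  proof -
    define J where "J = card {j. j < B * Suc n \<and> P n j}"
    have mono: "P n i" if "P n j" "i \<le> j" for i j
    proof -
      have "real (Suc i) ^ 4 \<le> real (Suc j) ^ 4" using that(2) by (intro power_mono) auto
      thus ?thesis using that(1) unfolding P_def by linarith
    qed
    \<comment> \<open>\<open>P n\<close> is downward closed, so counting the admissible
      \<open>j\<close> finds the threshold without a search.\<close>
    have "\<exists>J'. {j. j < B * Suc n \<and> P n j} = {..<J'}"
    proof (cases "\<exists>j. \<not> (j < B * Suc n \<and> P n j)")
      case True
      define L where "L = (LEAST j. \<not> (j < B * Suc n \<and> P n j))"
      have L: "\<not> (L < B * Suc n \<and> P n L)" unfolding L_def using LeastI_ex[OF True] .
      have "j < B * Suc n \<and> P n j" if "j < L" for j using not_less_Least that unfolding L_def by blast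
      moreover have "j < L" if "j < B * Suc n \<and> P n j" for j
        using L mono[of j L] that by (metis le_less_trans not_le)
      ultimately show ?thesis by blast
    qed blast
    then obtain J' where "{j. j < B * Suc n \<and> P n j} = {..<J'}" by blast
    hence J: "{j. j < B * Suc n \<and> P n j} = {..<J}" by (simp add: J_def)
    have "(\<Sum>j<B * Suc n. if P n j then 1 else 0 :: real) = real (card {j \<in> {..<B * Suc n}. P n j})"
      by (subst sum.inter_filter[symmetric]) auto
    also have "{j \<in> {..<B * Suc n}. P n j} = {j. j < B * Suc n \<and> P n j}" by auto
    finally have y: "y n = real J / real (Suc n)" by (simp only: y_def J_def)
    \<comment> \<open>A mean value estimate for the fourth power with slope at least
      \<open>C ^ 3\<close>; it applies whether \<open>C\<close> is the smaller or the larger of the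
      two points.\<close>
    have pow: "(z - c) * C ^ 3 \<le> z ^ 4 - c ^ 4" if "0 \<le> c" "c \<le> z" "C \<le> z" for z c :: real
    proof -
      have "C ^ 3 \<le> z ^ 3" using that assms(1) by (intro power_mono) auto
      also have "\<dots> \<le> z ^ 3 + z\<^sup>2 * c + z * c\<^sup>2 + c ^ 3" using that by simp
      finally have "(z - c) * C ^ 3 \<le> (z - c) * (z ^ 3 + z\<^sup>2 * c + z * c\<^sup>2 + c ^ 3)"
        using that by (intro mult_left_mono) auto
      also have "\<dots> = z ^ 4 - c ^ 4" by algebra
      finally show ?thesis .
    qed
    have C3: "C ^ 3 > 0" using assms(1) by simp
    have upper: "y n - C \<le> M / C ^ 3 / real (Suc n)"
    proof (cases "y n \<le> C")
      case True
      have "0 \<le> M / C ^ 3 / real (Suc n)" using M(2) C3 by simp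
      thus ?thesis using True by linarith
    next
      case False
      hence "J > 0" using assms(1) unfolding y by (cases J) auto
      hence "J - 1 \<in> {j. j < B * Suc n \<and> P n j}" unfolding J by simp
      hence "real J ^ 4 \<le> real (Suc n) ^ 4 * x n" using \<open>J > 0\<close> by (simp add: P_def)
      hence "y n ^ 4 \<le> x n" unfolding y by (simp add: power_divide divide_le_eq mult.commute)
      hence "y n ^ 4 - C ^ 4 \<le> M / real (Suc n)" using M(3)[of n] by linarith
      hence "(y n - C) * C ^ 3 \<le> M / real (Suc n)" using pow[of C "y n"] assms(1) False by simp
      thus ?thesis using C3 by (simp add: pos_le_divide_eq mult_ac)
    qed
    have lower: "C - (y n + 1 / real (Suc n)) \<le> M / C ^ 3 / real (Suc n)"
    proof (cases "C \<le> y n + 1 / real (Suc n)")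
      case True
      have "0 \<le> M / C ^ 3 / real (Suc n)" using M(2) C3 by simp
      thus ?thesis using True by linarith
    next
      case False
      define z where "z = y n + 1 / real (Suc n)"
      have z: "z = real (Suc J) / real (Suc n)" by (simp add: z_def y add_divide_distrib)
      have "z < C" "z \<ge> 0" using False by (simp_all add: z_def y)
      have "real (Suc J) < real (B * Suc n)"
      proof -
        have "real (Suc J) < C * real (Suc n)" using \<open>z < C\<close> unfolding z by (simp add: divide_less_eq)
        also have "\<dots> \<le> real B * real (Suc n)" using B by (intro mult_right_mono) auto
        finally show ?thesis by (simp only: of_nat_mult)
      qed
      hence "J < B * Suc n" by linarith
      moreover have "J \<notin> {j. j < B * Suc n \<and> P n j}" unfolding J by simp
      ultimately have "\<not> P n J" by simp
      hence "x n < z ^ 4" unfolding P_def z by (simp add: power_divide less_divide_eq mult.commute)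
      hence "C ^ 4 - z ^ 4 \<le> M / real (Suc n)" using M(3)[of n] by linarith
      hence "(C - z) * C ^ 3 \<le> M / real (Suc n)" using pow[of z C] \<open>z < C\<close> \<open>z \<ge> 0\<close> by simp
      thus ?thesis using C3 by (simp add: z_def pos_le_divide_eq mult_ac)
    qed
    have "0 \<le> 1 / real (Suc n)" by simp
    with upper lower have "\<bar>y n - C\<bar> \<le> 1 / real (Suc n) + M / C ^ 3 / real (Suc n)" by linarith
    thus ?thesis by (simp only: add_divide_distrib)
  qed
  ultimately show ?thesis unfolding rat_limit_def by blast
qed

text \<open>The factor common to all D_i: the constant from the poles times the exponential split
  off by the constant term of \<open>kappa\<close>.\<close>

definition expansion_const :: real where
  "expansion_const = 12 * sqrt 3 / pi powr (5 / 2) * exp (- (pi\<^sup>2 / 6) / 2)"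

lemma expansion_const_pos: "expansion_const > 0"
  by (simp add: expansion_const_def)

text \<open>The fourth power removes the square root and the half-integral power of pi: it equals 24
  exp(-2 tau) / tau^5, where 24 is 12^4 * 9 / 6^5. So zeta(2) is the only number to approximate
  besides the exponential.\<close>

lemma rat_limit_expansion_const: "\<exists>x. rat_limit expansion_const x"
proof -
  define \<tau> where "\<tau> = pi\<^sup>2 / 6"
  obtain x where x: "rat_limit (exp (- 2 * \<tau>)) x" using rat_limit_exp_zeta2 unfolding \<tau>_def by blast
  have "rat_limit (24 * (exp (- 2 * \<tau>) * (1 / \<tau>) ^ 5)) (\<lambda>n. 24 * (x n * (1 / zeta2_sum n) ^ 5))"
    unfolding \<tau>_def using x[unfolded \<tau>_def] zeta2_sum_ge_1 zeta2_ge_1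
    by (intro rat_limit_mult rat_limit_power rat_limit_const rat_limit_inverse rat_limit_zeta2 rat_env_numeral) auto
  moreover have "24 * (exp (- 2 * \<tau>) * (1 / \<tau>) ^ 5) = expansion_const ^ 4"
  proof -
    have "(pi powr (5 / 2)) ^ 4 = pi powr (5 / 2 * 4)" by (simp add: powr_power)
    also have "\<dots> = pi ^ 10" using powr_realpow[of pi 10] by simp
    finally have p: "(pi powr (5 / 2)) ^ 4 = pi ^ 10" .
    have "sqrt 3 ^ 4 = (sqrt 3 ^ 2) ^ 2" by (simp only: power_mult[symmetric]) simp
    hence s: "sqrt 3 ^ 4 = 9" by simp
    have e: "exp (- \<tau> / 2) ^ 4 = exp (- 2 * \<tau>)" by (simp add: exp_of_nat_mult[symmetric])
    have "expansion_const ^ 4 = 12 ^ 4 * sqrt 3 ^ 4 / (pi powr (5 / 2)) ^ 4 * exp (- \<tau> / 2) ^ 4"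
      by (simp add: expansion_const_def \<tau>_def power_mult_distrib power_divide)
    also have "\<dots> = 12 ^ 4 * 9 / pi ^ 10 * exp (- 2 * \<tau>)" by (simp only: p s e)
    finally show ?thesis by (simp add: \<tau>_def power_divide power_mult[symmetric])
  qed
  ultimately show ?thesis using rat_limit_root4[OF expansion_const_pos] by auto
qed

text \<open>The rational coefficient of tau^(p+k) in the \<open>i\<close>-th coefficient, up to
  \<open>expansion_const\<close>.\<close>

definition expansion_coeff :: "nat \<Rightarrow> nat \<Rightarrow> nat \<Rightarrow> real" where
  "expansion_coeff i p k = (-1) ^ k / fact k * (weight_fps * kappa1 ^ k) $ p * Gamma_ratio_fps p $ i"

lemma rat_env_expansion_coeff:
  assumes "rec_env i" "rec_env p" "rec_env k" shows "rat_env (\<lambda>e. expansion_coeff (i e) (p e) (k e))"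
  unfolding expansion_coeff_def
  by (intro rat_env_intros rat_env_weight_kappa1 rat_env_Gamma_ratio_fps assms)

lemma rigid_fps_nth:
  "rigid_fps $ i =
     expansion_const * (\<Sum>p<Suc i. \<Sum>k<Suc p. (pi\<^sup>2 / 6) ^ (p + k) * expansion_coeff i p k)"
proof -
  define \<tau> where "\<tau> = pi\<^sup>2 / 6"
  have "exp_coeff \<tau> p * \<tau> ^ p * Gamma_ratio_fps p $ i =
      exp (- \<tau> / 2) * (\<Sum>k<Suc p. \<tau> ^ (p + k) * expansion_coeff i p k)" for p
    unfolding exp_coeff_def lessThan_Suc_atMost sum_distrib_left sum_distrib_right
    by (intro sum.cong refl) (simp add: expansion_coeff_def power_add power_minus[of \<tau>] mult_ac)
  thus ?thesis
    unfolding \<tau>_def[symmetric] expansion_const_def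
    by (simp only: rigid_fps_def \<tau>_def[symmetric] fps_mult_left_const_nth expansion_fps_def fps_nth_Abs_fps lessThan_Suc_atMost[of i]
        sum_distrib_left[symmetric] mult.assoc)
qed

text \<open>tau and the constant are replaced by their \<open>n\<close>-th approximations. The error
  is at most (M + |C|) bnd(i) / (n+1), so \<open>n = K * b' i * 2 ^ k\<close> achieves the precision
  asked for.\<close>

lemma computable_expansion:
  "computable_real_seq (fps_nth rigid_fps)"
proof -
  define \<tau> where "\<tau> = pi\<^sup>2 / 6"
  define C where "C = expansion_const"
  obtain c where c: "rat_limit C c" using rat_limit_expansion_const unfolding C_def by blast
  obtain M where M: "rat_env (\<lambda>e. c (e 0))" "M \<ge> 0" "\<And>n. \<bar>c n - C\<bar> \<le> M / real (Suc n)"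
    using rat_limitE[OF c] by blast
  define S where "S i t = (\<Sum>p<Suc i. \<Sum>k<Suc p. t ^ (p + k) * expansion_coeff i p k)" for i and t :: real
  \<comment> \<open>2 bounds tau, and q^2 + 1 replaces |q| as a bound that is visibly rational in
    q.\<close>
  define bnd where "bnd i = (\<Sum>p<Suc i. \<Sum>k<Suc p. real (Suc (p + k)) * 2 ^ (p + k) * (expansion_coeff i p k ^ 2 + 1))" for i
  define A where "A i n = c n * S i (zeta2_sum n)" for i n
  have zeta: "rat_env (\<lambda>e. zeta2_sum (e 0))" using rat_limit_zeta2 by (simp add: rat_limit_def)
  have A: "rat_env (\<lambda>e. A (e 0) (e (Suc 0)))"
    unfolding A_def S_def
    by (intro rat_env_mult rat_env_sum rat_env_power rat_env_expansion_coeff rec_env_intros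
        rat_env_app[where f = c, OF M(1)] rat_env_app[where f = zeta2_sum, OF zeta])
  have "rat_env (\<lambda>e. bnd (e 0))"
    unfolding bnd_def by (intro rat_env_intros rat_env_expansion_coeff)
  then obtain b where b: "rec_env b" "\<And>e. bnd (e 0) \<le> real (b e)"
    using rat_env_le_rec_env by blast
  \<comment> \<open>\<open>b\<close> may read the whole environment, whereas \<open>bnd\<close>
    depends on entry 0 only; a constant environment makes the bound a function of
    \<open>i\<close>.\<close>
  define b' where "b' i = b (\<lambda>_. i)" for i
  have b': "rec_env (\<lambda>e. b' (e 0))" unfolding b'_def by (intro rec_env_subst[OF b(1)] rec_env_var)
  have bnd: "bnd i \<le> real (b' i)" for i using b(2)[of "\<lambda>_. i"] by (simp add: b'_def)
  \<comment> \<open>\<open>K\<close> is one fixed number, so it can be written into the program as a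
    constant.\<close>
  obtain K :: nat where K: "M + \<bar>C\<bar> \<le> real K" using real_arch_simple by blast
  have err: "\<bar>A i n - C * S i \<tau>\<bar> \<le> (M + \<bar>C\<bar>) * bnd i / real (Suc n)" for i n
  proof -
    define t where "t = zeta2_sum n"
    define r where "r = 1 / real (Suc n)"
    have t: "0 \<le> t" "t \<le> \<tau>" "\<tau> - t \<le> r" "t \<le> 2" "\<tau> \<le> 2"
      using zeta2_sum_ge_1[of n] zeta2_sum_bounds[of n] zeta2_le_2 by (simp_all add: t_def \<tau>_def r_def)
    have "r \<ge> 0" by (simp add: r_def)
    have pw: "\<tau> ^ s - t ^ s \<le> real s * 2 ^ s * r" for s
    proof (induction s)
      case (Suc s)
      have "t ^ s \<le> 2 ^ s" using t by (intro power_mono)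
      have "\<tau> ^ Suc s - t ^ Suc s = \<tau> * (\<tau> ^ s - t ^ s) + (\<tau> - t) * t ^ s" by (simp add: algebra_simps)
      also have "\<dots> \<le> 2 * (real s * 2 ^ s * r) + r * 2 ^ s"
        using t Suc.IH \<open>t ^ s \<le> 2 ^ s\<close> \<open>r \<ge> 0\<close>
        by (intro add_mono mult_mono) (auto intro: power_mono)
      also have "\<dots> \<le> real (Suc s) * 2 ^ Suc s * r" using \<open>r \<ge> 0\<close> by (simp add: algebra_simps)
      finally show ?case .
    qed simp
    have summand: "\<bar>c n * t ^ s - C * \<tau> ^ s\<bar> \<le> (M + \<bar>C\<bar>) * r * (real (Suc s) * 2 ^ s)" for s
    proof -
      have ts: "0 \<le> t ^ s" "t ^ s \<le> 2 ^ s" "t ^ s \<le> \<tau> ^ s" using t by (auto intro: power_mono)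
      have "c n * t ^ s - C * \<tau> ^ s = (c n - C) * t ^ s - C * (\<tau> ^ s - t ^ s)" by (simp add: algebra_simps)
      hence "\<bar>c n * t ^ s - C * \<tau> ^ s\<bar> \<le> \<bar>c n - C\<bar> * t ^ s + \<bar>C\<bar> * (\<tau> ^ s - t ^ s)"
        using abs_triangle_ineq4[of "(c n - C) * t ^ s" "C * (\<tau> ^ s - t ^ s)"] ts by (simp add: abs_mult)
      also have "\<dots> \<le> M * r * 2 ^ s + \<bar>C\<bar> * (real s * 2 ^ s * r)"
        using M(2) M(3)[of n] ts pw[of s] \<open>r \<ge> 0\<close> by (intro add_mono mult_mono mult_left_mono) (auto simp: r_def)
      also have "\<dots> \<le> M * r * (real (Suc s) * 2 ^ s) + \<bar>C\<bar> * (real (Suc s) * 2 ^ s * r)"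
        using M(2) \<open>r \<ge> 0\<close> by (intro add_mono mult_left_mono mult_right_mono) auto
      also have "\<dots> = (M + \<bar>C\<bar>) * r * (real (Suc s) * 2 ^ s)" by algebra
      finally show ?thesis .
    qed
    have abs_le: "\<bar>q\<bar> \<le> q ^ 2 + 1" for q :: real
      using zero_le_power2[of "\<bar>q\<bar> - 1"] zero_le_power2[of q] by (simp add: power2_diff)
    have "\<bar>(\<Sum>p<Suc i. \<Sum>k<Suc p. (c n * t ^ (p + k) - C * \<tau> ^ (p + k)) * expansion_coeff i p k)\<bar> \<le>
        (\<Sum>p<Suc i. \<Sum>k<Suc p. (M + \<bar>C\<bar>) * r * (real (Suc (p + k)) * 2 ^ (p + k) * (expansion_coeff i p k ^ 2 + 1)))"
    proof (rule order.trans[OF sum_abs sum_mono], rule order.trans[OF sum_abs sum_mono])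
      fix p k
      have "\<bar>c n * t ^ (p + k) - C * \<tau> ^ (p + k)\<bar> * \<bar>expansion_coeff i p k\<bar> \<le>
          (M + \<bar>C\<bar>) * r * (real (Suc (p + k)) * 2 ^ (p + k)) * (expansion_coeff i p k ^ 2 + 1)"
        using M(2) \<open>r \<ge> 0\<close> by (intro mult_mono summand abs_le mult_nonneg_nonneg) auto
      thus "\<bar>(c n * t ^ (p + k) - C * \<tau> ^ (p + k)) * expansion_coeff i p k\<bar> \<le>
          (M + \<bar>C\<bar>) * r * (real (Suc (p + k)) * 2 ^ (p + k) * (expansion_coeff i p k ^ 2 + 1))"
        by (simp only: abs_mult mult.assoc)
    qed
    also have "(\<Sum>p<Suc i. \<Sum>k<Suc p. (c n * t ^ (p + k) - C * \<tau> ^ (p + k)) * expansion_coeff i p k) = A i n - C * S i \<tau>"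
      unfolding A_def S_def t_def[symmetric] sum_distrib_left
      by (simp only: left_diff_distrib sum_subtractf mult.assoc)
    also have "(\<Sum>p<Suc i. \<Sum>k<Suc p. (M + \<bar>C\<bar>) * r * (real (Suc (p + k)) * 2 ^ (p + k) * (expansion_coeff i p k ^ 2 + 1))) =
        (M + \<bar>C\<bar>) * bnd i / real (Suc n)"
      unfolding bnd_def by (simp only: sum_distrib_left[symmetric] r_def) simp
    finally show ?thesis .
  qed
  show ?thesis
  proof (rule computable_real_seqI)
    show "rat_env (\<lambda>e. A (e 0) (K * b' (e 0) * 2 ^ e (Suc 0)))"
      by (intro rat_env_app2[where f = A, OF A] rec_env_intros rec_env_power b')
    fix i k
    define n where "n = K * b' i * 2 ^ k"
    have "bnd i \<ge> 0" unfolding bnd_def by (intro sum_nonneg mult_nonneg_nonneg) auto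
    have "\<bar>A i n - C * S i \<tau>\<bar> \<le> (M + \<bar>C\<bar>) * bnd i / real (Suc n)" by (rule err)
    also have "\<dots> \<le> (real K * real (b' i)) / real (Suc n)"
      using K bnd[of i] M(2) \<open>bnd i \<ge> 0\<close> by (intro divide_right_mono mult_mono) auto
    also have "\<dots> = (real K * real (b' i) * 2 ^ k / real (Suc n)) / 2 ^ k" by simp
    also have "\<dots> \<le> 1 / 2 ^ k"
    proof (rule divide_right_mono)
      have "real K * real (b' i) * 2 ^ k \<le> real (Suc n)" by (simp add: n_def)
      thus "real K * real (b' i) * 2 ^ k / real (Suc n) \<le> 1" by (simp only: divide_le_eq_1) simp
    qed simp
    finally show "\<bar>A i (K * b' i * 2 ^ k) -
        rigid_fps $ i\<bar> \<le> 1 / 2 ^ k"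
      unfolding rigid_fps_nth by (simp add: n_def C_def S_def \<tau>_def)
  qed
qed

theorem theorem3:
  "\<exists>D :: nat \<Rightarrow> real.
     D 0 = 12 * sqrt 3 / (pi powr (5 / 2) * exp (pi\<^sup>2 / 12)) \<and>
     (\<forall>m :: nat. \<exists>e :: nat \<Rightarrow> real.
        e \<in> O(\<lambda>n. 1 / real n ^ (m + 1)) \<and>
        (\<forall>n\<ge>1. real (num_rigid_interval_orders n) =
           fact n * sqrt (real n) * (6 / pi\<^sup>2) ^ n *
           ((\<Sum>i=0..m. D i / real n ^ i) + e n))) \<and>
     computable_real_seq D"
proof -
  define D where "D = (fps_nth rigid_fps)"
  define d :: "nat \<Rightarrow> real" where "d n = fact n * sqrt (real n) * (6 / pi\<^sup>2) ^ n" for n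
  have D0: "D 0 = 12 * sqrt 3 / (pi powr (5 / 2) * exp (pi\<^sup>2 / 12))"
  proof -
    have "weight_fps $ 0 = 1" by (simp add: weight_fps_def)
    moreover have "Gamma_ratio_fps 0 $ 0 = 1" by (simp add: Gamma_ratio_fps_def Gamma_half_fps_def watson_fps_def)
    \<comment> \<open>In degree 0 only the term with \<open>p = 0\<close> and \<open>k = 0\<close>
      occurs, and it equals 1.\<close>
    ultimately have "D 0 = expansion_const"
      unfolding D_def rigid_fps_nth by (simp add: expansion_coeff_def)
    also have "\<dots> = 12 * sqrt 3 / (pi powr (5 / 2) * exp (pi\<^sup>2 / 12))"
      by (simp add: expansion_const_def exp_minus field_simps)
    finally show ?thesis .
  qed
  have "\<exists>e. e \<in> O(\<lambda>n. 1 / real n ^ (m + 1)) \<and>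
      (\<forall>n\<ge>1. real (num_rigid_interval_orders n) = d n * ((\<Sum>i=0..m. D i / real n ^ i) + e n))" for m
  proof (intro exI conjI allI impI)
    define e where "e n = real (num_rigid_interval_orders n) / d n - (\<Sum>i=0..m. D i / real n ^ i)" for n
    have "(\<lambda>n. real (num_rigid_interval_orders n) / d n - (\<Sum>i\<le>m. D i * inv_n n ^ i)) \<in> O(\<lambda>n. inv_n n ^ Suc m)"
      unfolding d_def D_def by (rule asymp_fpsD[OF asymp_n_num_rigid_interval_orders])
    thus "e \<in> O(\<lambda>n. 1 / real n ^ (m + 1))"
      by (simp add: e_def[abs_def] inv_n_def power_divide atMost_atLeast0)
    fix n :: nat assume "n \<ge> 1"
    hence "d n \<noteq> 0" by (simp add: d_def)
    thus "real (num_rigid_interval_orders n) = d n * ((\<Sum>i=0..m. D i / real n ^ i) + e n)"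
      by (simp add: e_def)
  qed
  moreover have "computable_real_seq D" unfolding D_def by (rule computable_expansion)
  ultimately show ?thesis using D0 unfolding d_def by blast
qed

end
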